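(* If $F_\bullet$ is a complex of free $\mathbf{Z}^n$-persistence modules such that $H_d(F_\bullet)$ has finite total dimension for all $d$, then $F_\bullet$ and $\nu F_\bullet[n]\langle\epsilon\rangle$ are naturally quasi-isomorphic.
   Context: Let $k$ be a field. A (pointwise finite dimensional) $\mathbf{Z}^n$-persistence module is a functor $M\colon \mathbf{Z}^n \to \mathbf{vec}$ from the poset $\mathbf{Z}^n$ (product order) to finite-dimensional $k$-vector spaces; morphisms are natural transformations. Its total dimension is $\sum_{z} \dim M_z$. The dual $M^*$ has $(M^* )_z = (M_{-z})^*$ and $(M^* )_{z\le z'} = (M_{-z'\le -z})^*$. The shift $M\langle z\rangle$ has components $M\langle z\rangle_w = M_{z+w}$. For $z\in\mathbf{Z}^n$, $F(z)$ is the module with $F(z)_w = k$ if $z\le w$ and $0$ otherwise, with identity structure maps between nonzero components; $I(z)=F(-z)^*$, i.e. $I(z)_w=k$ if $w\le z$ and $0$ otherwise, with identity structure maps between nonzero components. A module is free if it is isomorphic to $\bigoplus_{i\in I} F(z_i)$ for some family $(z_i)_{i\in I}$ in $\mathbf{Z}^n$. $\mathsf{Hom}(M,N)$ denotes the module with components $\mathsf{Hom}(M,N)_z=\mathrm{Hom}(M,N\langle z\rangle)$. The Nakayama functor is $\nu = \mathsf{Hom}(-,F(0))^*$, from the full subcategory of free modules to the full subcategory of injective modules; it satisfies $\nu F(z)=I(z)$. It is applied degreewise to complexes. For a chain complex $C_\bullet$ and $i\in\mathbf{Z}$, $C_\bullet[i]$ is the chain complex with $(C_\bullet[i])_d=C_{i+d}$.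 $\epsilon=(1,\dots,1)\in\mathbf{Z}^n$. "Naturally quasi-isomorphic" means isomorphic in the derived category of $\mathbf{Z}^n$-persistence modules by an isomorphism natural in $F_\bullet$. *)

theory Defs
  imports "HOL-Analysis.Analysis" "HOL-Library.Function_Algebras"
begin

text \<open>
  The poset of grades is \<open>int ^ 'n\<close> with the componentwise order. The field \<open>k\<close> is a type
  \<open>'k :: field\<close>, and a vector space is a linear subspace of an ambient \<open>k\<close>-vector space, which is
  a type \<open>'v\<close> together with a scalar multiplication \<open>s\<close> satisfying \<open>vector_space s\<close>. Maps between
  vector spaces are functions on the ambient types of which only the values on the subspace matter.
\<close>

definition linear_on :: "'a set \<Rightarrow> ('k \<Rightarrow> 'a \<Rightarrow> 'a) \<Rightarrow> ('k \<Rightarrow> 'b \<Rightarrow> 'b) \<Rightarrow>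
    ('a::ab_group_add \<Rightarrow> 'b::ab_group_add) \<Rightarrow> bool" where
  "linear_on S s t f \<longleftrightarrow>
     (\<forall>x\<in>S. \<forall>y\<in>S. f (x + y) = f x + f y) \<and> (\<forall>c. \<forall>x\<in>S. f (s c x) = t c (f x))"

definition fin_dim :: "('k::field \<Rightarrow> 'v \<Rightarrow> 'v) \<Rightarrow> 'v::ab_group_add set \<Rightarrow> bool" where
  "fin_dim s S \<longleftrightarrow> (\<exists>B. finite B \<and> B \<subseteq> S \<and> S \<subseteq> module.span s B)"

definition fun_scale :: "('k \<Rightarrow> 'b \<Rightarrow> 'b) \<Rightarrow> 'k \<Rightarrow> ('a \<Rightarrow> 'b) \<Rightarrow> 'a \<Rightarrow> 'b" where
  "fun_scale s c f = (\<lambda>x. s c (f x))"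

definition prod_scale :: "('k \<Rightarrow> 'a \<Rightarrow> 'a) \<Rightarrow> ('k \<Rightarrow> 'b \<Rightarrow> 'b) \<Rightarrow> 'k \<Rightarrow> 'a \<times> 'b \<Rightarrow> 'a \<times> 'b" where
  "prod_scale s t c p = (s c (fst p), t c (snd p))"

record ('n, 'v) pmod =
  space :: "(int ^ 'n) \<Rightarrow> 'v set"
  trans :: "(int ^ 'n) \<Rightarrow> (int ^ 'n) \<Rightarrow> 'v \<Rightarrow> 'v"

definition pers_module ::
    "('k::field \<Rightarrow> 'v \<Rightarrow> 'v) \<Rightarrow> ('n::finite, 'v::ab_group_add) pmod \<Rightarrow> bool" where
  "pers_module s M \<longleftrightarrow>
     (\<forall>z. module.subspace s (space M z)) \<and>
     (\<forall>z w. z \<le> w \<longrightarrow> linear_on (space M z) s s (trans M z w) \<and>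
                      trans M z w ` space M z \<subseteq> space M w) \<and>
     (\<forall>z. \<forall>x\<in>space M z. trans M z z x = x) \<and>
     (\<forall>z w u. z \<le> w \<longrightarrow> w \<le> u \<longrightarrow>
        (\<forall>x\<in>space M z. trans M w u (trans M z w x) = trans M z u x))"

definition pfd :: "('k::field \<Rightarrow> 'v \<Rightarrow> 'v) \<Rightarrow> ('n::finite, 'v::ab_group_add) pmod \<Rightarrow> bool" where
  "pfd s M \<longleftrightarrow> (\<forall>z. fin_dim s (space M z))"

definition pmod_hom :: "('k \<Rightarrow> 'a \<Rightarrow> 'a) \<Rightarrow> ('k \<Rightarrow> 'b \<Rightarrow> 'b) \<Rightarrow>
    ('n::finite, 'a::ab_group_add) pmod \<Rightarrow> ('n, 'b::ab_group_add) pmod \<Rightarrow>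
    (int ^ 'n \<Rightarrow> 'a \<Rightarrow> 'b) \<Rightarrow> bool" where
  "pmod_hom s t M N f \<longleftrightarrow>
     (\<forall>z. linear_on (space M z) s t (f z) \<and> f z ` space M z \<subseteq> space N z) \<and>
     (\<forall>z w. z \<le> w \<longrightarrow> (\<forall>x\<in>space M z. f w (trans M z w x) = trans N z w (f z x)))"

definition pmod_iso :: "('k \<Rightarrow> 'a \<Rightarrow> 'a) \<Rightarrow> ('k \<Rightarrow> 'b \<Rightarrow> 'b) \<Rightarrow>
    ('n::finite, 'a::ab_group_add) pmod \<Rightarrow> ('n, 'b::ab_group_add) pmod \<Rightarrow> bool" where
  "pmod_iso s t M N \<longleftrightarrow>
     (\<exists>f. pmod_hom s t M N f \<and> (\<forall>z. bij_betw (f z) (space M z) (space N z)))"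

definition pmod_shift :: "int ^ 'n::finite \<Rightarrow> ('n, 'v) pmod \<Rightarrow> ('n, 'v) pmod" where
  "pmod_shift z M = \<lparr> space = (\<lambda>w. space M (z + w)), trans = (\<lambda>w u. trans M (z + w) (z + u)) \<rparr>"

text \<open>Functionals on \<open>M\<^sub>-\<^sub>z\<close>, and natural transformations below, are represented by functions
  that are \<open>0\<close> outside their domain, so that equal maps are equal as functions.\<close>

definition dual :: "('k::field \<Rightarrow> 'v \<Rightarrow> 'v) \<Rightarrow> ('n::finite, 'v::ab_group_add) pmod \<Rightarrow>
    ('n, 'v \<Rightarrow> 'k) pmod" where
  "dual s M = \<lparr>
     space = (\<lambda>z. {\<phi>. linear_on (space M (- z)) s (*) \<phi> \<and> (\<forall>x. x \<notin> space M (- z) \<longrightarrow> \<phi> x = 0)}),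
     trans = (\<lambda>z w \<phi> x. if x \<in> space M (- w) then \<phi> (trans M (- w) (- z) x) else 0) \<rparr>"

definition dual_map :: "('n::finite, 'a) pmod \<Rightarrow> (int ^ 'n \<Rightarrow> 'a \<Rightarrow> 'b) \<Rightarrow>
    int ^ 'n \<Rightarrow> ('b \<Rightarrow> 'k::field) \<Rightarrow> 'a \<Rightarrow> 'k" where
  "dual_map M f z \<phi> = (\<lambda>x. if x \<in> space M (- z) then \<phi> (f (- z) x) else 0)"

definition Hom :: "('k \<Rightarrow> 'a \<Rightarrow> 'a) \<Rightarrow> ('k \<Rightarrow> 'b \<Rightarrow> 'b) \<Rightarrow>
    ('n::finite, 'a::ab_group_add) pmod \<Rightarrow> ('n, 'b::ab_group_add) pmod \<Rightarrow>
    ('n, int ^ 'n \<Rightarrow> 'a \<Rightarrow> 'b) pmod" where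
  "Hom s t M N = \<lparr>
     space = (\<lambda>z. {h. pmod_hom s t M (pmod_shift z N) h \<and> (\<forall>w x. x \<notin> space M w \<longrightarrow> h w x = 0)}),
     trans = (\<lambda>z z' h w x. if x \<in> space M w then trans N (z + w) (z' + w) (h w x) else 0) \<rparr>"

text \<open>The map \<open>Hom(M', N) \<rightarrow> Hom(M, N)\<close> induced by \<open>f : M \<rightarrow> M'\<close>, in each grade.\<close>

definition Hom_precomp :: "('n::finite, 'a) pmod \<Rightarrow> (int ^ 'n \<Rightarrow> 'a \<Rightarrow> 'c) \<Rightarrow>
    (int ^ 'n \<Rightarrow> 'c \<Rightarrow> 'b::zero) \<Rightarrow> int ^ 'n \<Rightarrow> 'a \<Rightarrow> 'b" where
  "Hom_precomp M f h = (\<lambda>w x. if x \<in> space M w then h w (f w x) else 0)"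

definition free_gen :: "int ^ 'n::finite \<Rightarrow> ('n, 'k::field) pmod" where
  "free_gen z = \<lparr> space = (\<lambda>w. if z \<le> w then UNIV else {0}),
                  trans = (\<lambda>w u x. if z \<le> w then x else 0) \<rparr>"

definition direct_sum :: "'i set \<Rightarrow> ('i \<Rightarrow> ('n::finite, 'v::zero) pmod) \<Rightarrow> ('n, 'i \<Rightarrow> 'v) pmod" where
  "direct_sum I N = \<lparr>
     space = (\<lambda>w. {f. finite {i. f i \<noteq> 0} \<and> (\<forall>i\<in>I. f i \<in> space (N i) w) \<and> (\<forall>i. i \<notin> I \<longrightarrow> f i = 0)}),
     trans = (\<lambda>w u f i. if i \<in> I then trans (N i) w u (f i) else 0) \<rparr>"

text \<open>The index type \<open>(int ^ 'n) \<times> 'v\<close> is no restriction: an index \<open>i\<close> can be replaced by the pair of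
  \<open>deg i\<close> and the element of \<open>M\<close> that corresponds to the \<open>i\<close>-th generator.\<close>

definition free_module ::
    "('k::field \<Rightarrow> 'v \<Rightarrow> 'v) \<Rightarrow> ('n::finite, 'v::ab_group_add) pmod \<Rightarrow> bool" where
  "free_module s M \<longleftrightarrow> (\<exists>(I :: ((int ^ 'n) \<times> 'v) set) deg.
     pmod_iso s (fun_scale (*)) M (direct_sum I (\<lambda>i. free_gen (deg i))))"

type_synonym ('n, 'k, 'v) nu_space = "((int ^ 'n) \<Rightarrow> 'v \<Rightarrow> 'k) \<Rightarrow> 'k"

definition nu :: "('k::field \<Rightarrow> 'v \<Rightarrow> 'v) \<Rightarrow> ('n::finite, 'v::ab_group_add) pmod \<Rightarrow>
    ('n, ('n, 'k, 'v) nu_space) pmod" where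
  "nu s M = dual (fun_scale (fun_scale (*))) (Hom s (*) M (free_gen 0))"

definition nu_map :: "('k::field \<Rightarrow> 'v \<Rightarrow> 'v) \<Rightarrow>
    ('n::finite, 'v::ab_group_add) pmod \<Rightarrow> ('n, 'v) pmod \<Rightarrow> (int ^ 'n \<Rightarrow> 'v \<Rightarrow> 'v) \<Rightarrow>
    int ^ 'n \<Rightarrow> ('n, 'k, 'v) nu_space \<Rightarrow> ('n, 'k, 'v) nu_space" where
  "nu_map s M M' f = dual_map (Hom s (*) M' (free_gen 0)) (\<lambda>_. Hom_precomp M f)"

abbreviation nu_scale ::
    "'k::field \<Rightarrow> ('n::finite, 'k, 'v) nu_space \<Rightarrow> ('n, 'k, 'v) nu_space" where
  "nu_scale \<equiv> fun_scale (*)"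

text \<open>\<open>diff C d\<close> is the differential from degree \<open>d\<close> to degree \<open>d - 1\<close>.\<close>

record ('n, 'v) cpx =
  obj :: "int \<Rightarrow> ('n, 'v) pmod"
  diff :: "int \<Rightarrow> (int ^ 'n) \<Rightarrow> 'v \<Rightarrow> 'v"

type_synonym ('n, 'a, 'b) cmap = "int \<Rightarrow> (int ^ 'n) \<Rightarrow> 'a \<Rightarrow> 'b"

definition complex :: "('k::field \<Rightarrow> 'v \<Rightarrow> 'v) \<Rightarrow> ('n::finite, 'v::ab_group_add) cpx \<Rightarrow> bool" where
  "complex s C \<longleftrightarrow>
     (\<forall>d. pers_module s (obj C d)) \<and>
     (\<forall>d. pmod_hom s s (obj C d) (obj C (d - 1)) (diff C d)) \<and>
     (\<forall>d z. \<forall>x\<in>space (obj C d) z. diff C (d - 1) z (diff C d z x) = 0)"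

definition chain_map :: "('k \<Rightarrow> 'a \<Rightarrow> 'a) \<Rightarrow> ('k \<Rightarrow> 'b \<Rightarrow> 'b) \<Rightarrow>
    ('n::finite, 'a::ab_group_add) cpx \<Rightarrow> ('n, 'b::ab_group_add) cpx \<Rightarrow> ('n, 'a, 'b) cmap \<Rightarrow> bool" where
  "chain_map s t C D f \<longleftrightarrow>
     (\<forall>d. pmod_hom s t (obj C d) (obj D d) (f d)) \<and>
     (\<forall>d z. \<forall>x\<in>space (obj C d) z. f (d - 1) z (diff C d z x) = diff D d z (f d z x))"

definition cycles :: "('n::finite, 'v::ab_group_add) cpx \<Rightarrow> int \<Rightarrow> int ^ 'n \<Rightarrow> 'v set" where
  "cycles C d z = {x \<in> space (obj C d) z. diff C d z x = 0}"

definition boundaries :: "('n::finite, 'v) cpx \<Rightarrow> int \<Rightarrow> int ^ 'n \<Rightarrow> 'v set" where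
  "boundaries C d z = diff C (d + 1) z ` space (obj C (d + 1)) z"

definition homologous :: "('n::finite, 'v::ab_group_add) cpx \<Rightarrow> int \<Rightarrow> int ^ 'n \<Rightarrow> ('v \<times> 'v) set" where
  "homologous C d z =
     {(x, y). x \<in> cycles C d z \<and> y \<in> cycles C d z \<and> x - y \<in> boundaries C d z}"

definition homology :: "('n::finite, 'v::ab_group_add) cpx \<Rightarrow> int \<Rightarrow> int ^ 'n \<Rightarrow> 'v set set" where
  "homology C d z = cycles C d z // homologous C d z"

definition homology_map :: "('n::finite, 'b::ab_group_add) cpx \<Rightarrow> ('n, 'a, 'b) cmap \<Rightarrow>
    int \<Rightarrow> int ^ 'n \<Rightarrow> 'a set \<Rightarrow> 'b set" where
  "homology_map D f d z X = homologous D d z `` (f d z ` X)"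

text \<open>The induced map in homology is always linear and natural in the grade, so it is an isomorphism
  of persistence modules as soon as it is bijective in each grade.\<close>

definition quasi_iso :: "('k \<Rightarrow> 'a \<Rightarrow> 'a) \<Rightarrow> ('k \<Rightarrow> 'b \<Rightarrow> 'b) \<Rightarrow>
    ('n::finite, 'a::ab_group_add) cpx \<Rightarrow> ('n, 'b::ab_group_add) cpx \<Rightarrow> ('n, 'a, 'b) cmap \<Rightarrow> bool" where
  "quasi_iso s t C D f \<longleftrightarrow> chain_map s t C D f \<and>
     (\<forall>d z. bij_betw (homology_map D f d z) (homology C d z) (homology D d z))"

text \<open>The dimension of the quotient of cycles by boundaries; only to be used for complexes of
  pointwise finite dimensional modules, as \<open>dim\<close> is \<open>0\<close> on infinite dimensional spaces.\<close>

definition homology_dim :: "('k::field \<Rightarrow> 'v \<Rightarrow> 'v) \<Rightarrow> ('n::finite, 'v::ab_group_add) cpx \<Rightarrow>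
    int \<Rightarrow> int ^ 'n \<Rightarrow> nat" where
  "homology_dim s C d z =
     vector_space.dim s (cycles C d z) - vector_space.dim s (boundaries C d z)"

definition homology_finite_total_dim ::
    "('k::field \<Rightarrow> 'v \<Rightarrow> 'v) \<Rightarrow> ('n::finite, 'v::ab_group_add) cpx \<Rightarrow> int \<Rightarrow> bool" where
  "homology_finite_total_dim s C d \<longleftrightarrow> (\<lambda>z. real (homology_dim s C d z)) summable_on UNIV"

text \<open>The differential of \<open>C[i]\<close> carries the usual sign \<open>(-1)\<^sup>i\<close>.\<close>

definition cpx_translate :: "int \<Rightarrow> ('n::finite, 'v::ab_group_add) cpx \<Rightarrow> ('n, 'v) cpx" where
  "cpx_translate i C = \<lparr> obj = (\<lambda>d. obj C (i + d)),
     diff = (\<lambda>d z x. if even i then diff C (i + d) z x else - diff C (i + d) z x) \<rparr>"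

definition cpx_shift :: "int ^ 'n::finite \<Rightarrow> ('n, 'v) cpx \<Rightarrow> ('n, 'v) cpx" where
  "cpx_shift e C = \<lparr> obj = (\<lambda>d. pmod_shift e (obj C d)), diff = (\<lambda>d z. diff C d (e + z)) \<rparr>"

definition nu_cpx :: "('k::field \<Rightarrow> 'v \<Rightarrow> 'v) \<Rightarrow> ('n::finite, 'v::ab_group_add) cpx \<Rightarrow>
    ('n, ('n, 'k, 'v) nu_space) cpx" where
  "nu_cpx s C = \<lparr> obj = (\<lambda>d. nu s (obj C d)),
     diff = (\<lambda>d. nu_map s (obj C d) (obj C (d - 1)) (diff C d)) \<rparr>"

text \<open>The functor \<open>F \<mapsto> \<nu>F[n]\<langle>\<epsilon>\<rangle>\<close> on complexes and on chain maps \<open>f : F \<rightarrow> G\<close>.\<close>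

definition serre_cpx :: "('k::field \<Rightarrow> 'v \<Rightarrow> 'v) \<Rightarrow> ('n::finite, 'v::ab_group_add) cpx \<Rightarrow>
    ('n, ('n, 'k, 'v) nu_space) cpx" where
  "serre_cpx s F = cpx_shift (\<chi> i. 1) (cpx_translate (int CARD('n)) (nu_cpx s F))"

definition serre_map :: "('k::field \<Rightarrow> 'v \<Rightarrow> 'v) \<Rightarrow> ('n::finite, 'v::ab_group_add) cpx \<Rightarrow>
    ('n, 'v) cpx \<Rightarrow> ('n, 'v, 'v) cmap \<Rightarrow> ('n, ('n, 'k, 'v) nu_space, ('n, 'k, 'v) nu_space) cmap" where
  "serre_map s F G f = (\<lambda>d z.
     nu_map s (obj F (int CARD('n) + d)) (obj G (int CARD('n) + d)) (f (int CARD('n) + d))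
       ((\<chi> i. 1) + z))"

text \<open>
  For a class \<open>\<C>\<close> of persistence modules, the derived category is the localisation of the category
  of complexes of modules in \<open>\<C>\<close> at the quasi-isomorphisms. Its morphisms are paths of chain maps
  and formal inverses of quasi-isomorphisms, modulo the congruence generated by the relations of the
  category of complexes and those making the formal inverses inverse. \<open>Fwd X Y f\<close> is the chain map
  \<open>f : X \<rightarrow> Y\<close>, and \<open>Inv X Y f\<close> is its formal inverse, from \<open>Y\<close> to \<open>X\<close>. Paths are composed
  from left to right.
\<close>

datatype ('n, 'v) step =
    Fwd "('n, 'v) cpx" "('n, 'v) cpx" "('n, 'v, 'v) cmap"
  | Inv "('n, 'v) cpx" "('n, 'v) cpx" "('n, 'v, 'v) cmap"

definition complex_in :: "('k::field \<Rightarrow> 'v \<Rightarrow> 'v) \<Rightarrow> (('n::finite, 'v::ab_group_add) pmod \<Rightarrow> bool) \<Rightarrow>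
    ('n, 'v) cpx \<Rightarrow> bool" where
  "complex_in s \<C> X \<longleftrightarrow> complex s X \<and> (\<forall>d. \<C> (obj X d))"

inductive derived_path :: "('k::field \<Rightarrow> 'v \<Rightarrow> 'v) \<Rightarrow> (('n::finite, 'v::ab_group_add) pmod \<Rightarrow> bool) \<Rightarrow>
    ('n, 'v) cpx \<Rightarrow> ('n, 'v) step list \<Rightarrow> ('n, 'v) cpx \<Rightarrow> bool"
  for s :: "'k::field \<Rightarrow> 'v::ab_group_add \<Rightarrow> 'v" and \<C> where
  Nil: "complex_in s \<C> X \<Longrightarrow> derived_path s \<C> X [] X"
| Fwd: "\<lbrakk>complex_in s \<C> X; chain_map s s X Y f; derived_path s \<C> Y p Z\<rbrakk>
    \<Longrightarrow> derived_path s \<C> X (Fwd X Y f # p) Z"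
| Inv: "\<lbrakk>complex_in s \<C> Y; quasi_iso s s X Y f; derived_path s \<C> X p Z\<rbrakk>
    \<Longrightarrow> derived_path s \<C> Y (Inv X Y f # p) Z"

inductive derived_eq :: "('k::field \<Rightarrow> 'v \<Rightarrow> 'v) \<Rightarrow> (('n::finite, 'v::ab_group_add) pmod \<Rightarrow> bool) \<Rightarrow>
    ('n, 'v) cpx \<Rightarrow> ('n, 'v) cpx \<Rightarrow> ('n, 'v) step list \<Rightarrow> ('n, 'v) step list \<Rightarrow> bool"
  for s :: "'k::field \<Rightarrow> 'v::ab_group_add \<Rightarrow> 'v" and \<C> where
  refl: "derived_path s \<C> X p Y \<Longrightarrow> derived_eq s \<C> X Y p p"
| sym: "derived_eq s \<C> X Y p q \<Longrightarrow> derived_eq s \<C> X Y q p"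
| trans: "\<lbrakk>derived_eq s \<C> X Y p q; derived_eq s \<C> X Y q r\<rbrakk> \<Longrightarrow> derived_eq s \<C> X Y p r"
| append: "\<lbrakk>derived_eq s \<C> X Y p p'; derived_eq s \<C> Y Z q q'\<rbrakk>
    \<Longrightarrow> derived_eq s \<C> X Z (p @ q) (p' @ q')"
| ext: "\<lbrakk>complex_in s \<C> X; complex_in s \<C> Y; chain_map s s X Y f; chain_map s s X Y g;
      \<forall>d z. \<forall>x\<in>space (obj X d) z. f d z x = g d z x\<rbrakk>
    \<Longrightarrow> derived_eq s \<C> X Y [Fwd X Y f] [Fwd X Y g]"
| ident: "complex_in s \<C> X \<Longrightarrow> derived_eq s \<C> X X [Fwd X X (\<lambda>d z x. x)] []"
| comp: "\<lbrakk>complex_in s \<C> X; complex_in s \<C> Y; complex_in s \<C> Z; chain_map s s X Y f; chain_map s s Y Z g\<rbrakk>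
    \<Longrightarrow> derived_eq s \<C> X Z [Fwd X Y f, Fwd Y Z g] [Fwd X Z (\<lambda>d z x. g d z (f d z x))]"
| inv_right: "\<lbrakk>complex_in s \<C> X; complex_in s \<C> Y; quasi_iso s s X Y f\<rbrakk>
    \<Longrightarrow> derived_eq s \<C> X X [Fwd X Y f, Inv X Y f] []"
| inv_left: "\<lbrakk>complex_in s \<C> X; complex_in s \<C> Y; quasi_iso s s X Y f\<rbrakk>
    \<Longrightarrow> derived_eq s \<C> Y Y [Inv X Y f, Fwd X Y f] []"

definition derived_iso :: "('k::field \<Rightarrow> 'v \<Rightarrow> 'v) \<Rightarrow> (('n::finite, 'v::ab_group_add) pmod \<Rightarrow> bool) \<Rightarrow>
    ('n, 'v) cpx \<Rightarrow> ('n, 'v) cpx \<Rightarrow> ('n, 'v) step list \<Rightarrow> bool" where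
  "derived_iso s \<C> X Y p \<longleftrightarrow> derived_path s \<C> X p Y \<and>
     (\<exists>q. derived_path s \<C> Y q X \<and> derived_eq s \<C> X X (p @ q) [] \<and> derived_eq s \<C> Y Y (q @ p) [])"

text \<open>
  \<open>F\<close> and \<open>\<nu>F[n]\<langle>\<epsilon>\<rangle>\<close> have different ambient spaces. To compare them, both are viewed as complexes
  in the product of the two ambient spaces, by means of the inclusions of the factors. In
  \<open>push_pmod i r\<close>, the map \<open>i\<close> is such an inclusion and \<open>r\<close> the projection that is its left inverse.
\<close>

definition push_pmod :: "('a \<Rightarrow> 'u) \<Rightarrow> ('u \<Rightarrow> 'a) \<Rightarrow> ('n::finite, 'a) pmod \<Rightarrow> ('n, 'u) pmod" where
  "push_pmod i r M = \<lparr> space = (\<lambda>z. i ` space M z), trans = (\<lambda>z w u. i (trans M z w (r u))) \<rparr>"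

definition push_cpx :: "('a \<Rightarrow> 'u) \<Rightarrow> ('u \<Rightarrow> 'a) \<Rightarrow> ('n::finite, 'a) cpx \<Rightarrow> ('n, 'u) cpx" where
  "push_cpx i r C = \<lparr> obj = (\<lambda>d. push_pmod i r (obj C d)), diff = (\<lambda>d z u. i (diff C d z (r u))) \<rparr>"

definition push_cmap :: "('a \<Rightarrow> 'u) \<Rightarrow> ('u \<Rightarrow> 'a) \<Rightarrow> ('n::finite, 'a, 'a) cmap \<Rightarrow> ('n, 'u, 'u) cmap" where
  "push_cmap i r f = (\<lambda>d z u. i (f d z (r u)))"

type_synonym ('n, 'k, 'v) common = "'v \<times> ('n, 'k, 'v) nu_space"

abbreviation common_scale :: "('k::field \<Rightarrow> 'v \<Rightarrow> 'v) \<Rightarrow>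
    'k \<Rightarrow> ('n::finite, 'k, 'v) common \<Rightarrow> ('n, 'k, 'v) common" where
  "common_scale s \<equiv> prod_scale s nu_scale"

definition left_cpx :: "('n::finite, 'v) cpx \<Rightarrow> ('n, ('n, 'k::field, 'v) common) cpx" where
  "left_cpx = push_cpx (\<lambda>x. (x, 0)) fst"

definition left_cmap :: "('n::finite, 'v, 'v) cmap \<Rightarrow>
    ('n, ('n, 'k::field, 'v) common, ('n, 'k, 'v) common) cmap" where
  "left_cmap = push_cmap (\<lambda>x. (x, 0)) fst"

definition right_cpx ::
    "('n::finite, ('n, 'k::field, 'v::zero) nu_space) cpx \<Rightarrow> ('n, ('n, 'k, 'v) common) cpx" where
  "right_cpx = push_cpx (\<lambda>y. (0, y)) snd"

definition right_cmap :: "('n::finite, ('n, 'k::field, 'v::zero) nu_space, ('n, 'k, 'v) nu_space) cmap \<Rightarrow>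
    ('n, ('n, 'k, 'v) common, ('n, 'k, 'v) common) cmap" where
  "right_cmap = push_cmap (\<lambda>y. (0, y)) snd"

text \<open>\<open>F\<close> and \<open>\<nu>F[n]\<langle>\<epsilon>\<rangle>\<close> are isomorphic in the derived category of \<open>\<C>\<close>, naturally with respect to
  chain maps between the complexes \<open>F\<close> satisfying \<open>P\<close>. The class \<open>\<C>\<close> matters because \<open>\<nu>\<close> does not
  preserve pointwise finite dimensionality: \<open>Hom(F, F(0))\<close> in grade \<open>- z\<close> is the product of copies of
  \<open>k\<close> over all generators of \<open>F\<close> whose degree is \<open>\<ge> z\<close>.\<close>

definition naturally_quasi_isomorphic :: "('k::field \<Rightarrow> 'v \<Rightarrow> 'v) \<Rightarrow>
    (('n::finite, ('n, 'k, 'v) common) pmod \<Rightarrow> bool) \<Rightarrow> (('n, 'v::ab_group_add) cpx \<Rightarrow> bool) \<Rightarrow> bool" where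
  "naturally_quasi_isomorphic s \<C> P \<longleftrightarrow>
     (\<exists>\<eta>. (\<forall>F. P F \<longrightarrow>
            derived_iso (common_scale s) \<C> (left_cpx F) (right_cpx (serre_cpx s F)) (\<eta> F)) \<and>
          (\<forall>F G f. P F \<longrightarrow> P G \<longrightarrow> chain_map s s F G f \<longrightarrow>
            derived_eq (common_scale s) \<C> (left_cpx F) (right_cpx (serre_cpx s G))
              (\<eta> F @ [Fwd (right_cpx (serre_cpx s F)) (right_cpx (serre_cpx s G))
                          (right_cmap (serre_map s F G f))])
              ([Fwd (left_cpx F) (left_cpx G) (left_cmap f)] @ \<eta> G)))"

definition free_complex_finite_homology ::
    "('k::field \<Rightarrow> 'v \<Rightarrow> 'v) \<Rightarrow> ('n::finite, 'v::ab_group_add) cpx \<Rightarrow> bool" where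
  "free_complex_finite_homology s F \<longleftrightarrow> complex s F \<and>
     (\<forall>d. pfd s (obj F d) \<and> free_module s (obj F d) \<and> homology_finite_total_dim s F d)"

end

theory Submission
  imports Defs "HOL-Library.Poly_Mapping"
begin

text \<open>
  Let \<open>V\<close> be the colimit of \<open>F\<close>, a complex of vector spaces filtered by the components of \<open>F\<close>. As the
  homology of \<open>F\<close> has finite total dimension, the localisation of \<open>F\<close> at the \<open>j\<close>-th variable is an acyclic
  complex of free modules over a ring of finite global dimension, so it is contractible. This gives a
  contraction \<open>h j\<close> of \<open>V\<close> that preserves the filtrations by all coordinates except the \<open>j\<close>-th. Modulo the
  elements which are small in at least one coordinate, that is in \<open>\<nu>F\<langle>\<epsilon>\<rangle>\<close> up to double duals, the composite
  \<open>h 1 \<circ> \<dots> \<circ> h n\<close> commutes with the differential up to \<open>(-1)\<^sup>n\<close>; it is a chain map \<open>F \<rightarrow> \<nu>F[n]\<langle>\<epsilon>\<rangle>\<close>. Each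
  factor \<open>h j\<close> is the connecting map of a short exact sequence with contractible middle term, so the
  composite is a quasi-isomorphism, and it is natural up to homotopy. Hence no intermediate complex is
  needed, which is why the isomorphism also exists in the derived category of pointwise finite
  dimensional modules.
\<close>

subsection \<open>Linear maps\<close>

text \<open>\<open>F\<close> may be unbounded in both directions, so a contraction of its
  localisation cannot be built by induction on the degree. Finite global dimension is therefore used
  one variable at a time: an acyclic complex of vector spaces has a contraction, and a telescope of
  the contractions over all integer bounds on one further coordinate is corrected to a single one
  that respects the filtration by that coordinate (\<open>partial_contraction_step\<close>). Over
  the integers, \<open>eps + z \<le> w\<close> says that \<open>w\<close> exceeds \<open>z\<close>
  in every coordinate; this is the origin of \<epsilon>. Each of the \<open>n\<close> contractions
  raises the degree by one, which gives \<open>[n]\<close>. Evaluation into the double dual need not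
  be bijective on chains when a degree has infinitely many generators; on homology it is, because
  \<open>F\<close> is finite dimensional in each grade. The last obstacle is formal: homotopic maps
  have to be identified by a path through complexes of the given class in one ambient type. The
  contractible complex that carries the homotopy must therefore be pointwise finite dimensional and
  fit into that type, which dictates the index type of the generators.\<close>

lemma linear_onD:
  assumes "linear_on S s t f"
  shows "x \<in> S \<Longrightarrow> y \<in> S \<Longrightarrow> f (x + y) = f x + f y" "x \<in> S \<Longrightarrow> f (s c x) = t c (f x)"
  using assms by (auto simp: linear_on_def)

lemma linear_on_subset: "linear_on S s t f \<Longrightarrow> T \<subseteq> S \<Longrightarrow> linear_on T s t f"
  unfolding linear_on_def by blast

lemma linear_on_comp:
  "linear_on S s t f \<Longrightarrow> linear_on T t u g \<Longrightarrow> f ` S \<subseteq> T \<Longrightarrow> linear_on S s u (\<lambda>x. g (f x))"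
  by (fastforce simp: linear_on_def image_subset_iff)

lemma linear_on_zero:
  assumes "vector_space s" "vector_space t" "module.subspace s S" "linear_on S s t f"
  shows "f 0 = 0"
proof -
  interpret A: vector_space s by fact
  interpret B: vector_space t by fact
  have "f (s 0 0) = t 0 (f 0)" using linear_onD(2)[OF assms(4) A.subspace_0[OF assms(3)]] .
  then show ?thesis by simp
qed

lemma linear_on_uminus:
  assumes "vector_space s" "vector_space t" "linear_on S s t f" "x \<in> S"
  shows "f (- x) = - f x"
proof -
  interpret A: vector_space s by fact
  interpret B: vector_space t by fact
  have "f (s (-1) x) = t (-1) (f x)" using linear_onD(2)[OF assms(3,4)] .
  then show ?thesis by simp
qed

lemma linear_on_diff:
  assumes "vector_space s" "vector_space t" "module.subspace s S" "linear_on S s t f" "x \<in> S" "y \<in> S"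
  shows "f (x - y) = f x - f y"
proof -
  interpret A: vector_space s by fact
  have "f (x + (- y)) = f x + f (- y)"
    using linear_onD(1)[OF assms(4,5) A.subspace_neg[OF assms(3,6)]] .
  then show ?thesis using linear_on_uminus[OF assms(1,2,4,6)] by simp
qed

lemma linear_on_UNIV_iff:
  "vector_space s \<Longrightarrow> vector_space t \<Longrightarrow> linear_on UNIV s t f \<longleftrightarrow> Vector_Spaces.linear s t f"
  by (auto simp: linear_on_def Vector_Spaces.linear_iff)

lemma subspace_zero: "vector_space s \<Longrightarrow> module.subspace s {0}"
  by (simp add: module.subspace_single_0 module_iff_vector_space)

lemma vector_space_field: "vector_space ((*) :: 'k::field \<Rightarrow> _)"
  by (rule vector_space_over_itself.vector_space_axioms)

lemma vector_space_fun: "vector_space t \<Longrightarrow> vector_space (fun_scale t)"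
  by (auto simp: vector_space_def fun_scale_def plus_fun_def fun_eq_iff)

lemma vector_space_prod: "vector_space s \<Longrightarrow> vector_space t \<Longrightarrow> vector_space (prod_scale s t)"
  by (auto simp: vector_space_def prod_scale_def)

lemma subspace_UNIV: "vector_space s \<Longrightarrow> module.subspace s UNIV"
  by (simp add: module.subspace_UNIV module_iff_vector_space)

lemma subspace_iff: "vector_space s \<Longrightarrow> module.subspace s S \<longleftrightarrow>
    0 \<in> S \<and> (\<forall>x\<in>S. \<forall>y\<in>S. x + y \<in> S) \<and> (\<forall>c. \<forall>x\<in>S. s c x \<in> S)"
  by (simp add: module.subspace_def module_iff_vector_space)

lemma subspace_minus: "vector_space s \<Longrightarrow> module.subspace s S \<Longrightarrow> x \<in> S \<Longrightarrow> y \<in> S \<Longrightarrow> x - y \<in> S"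
  by (rule module.subspace_diff[of s S]) (simp_all add: module_iff_vector_space)

lemma subspace_linear_image:
  assumes "vector_space s" "vector_space t" "module.subspace s S" "linear_on S s t f"
  shows "module.subspace t (f ` S)"
proof -
  have "f 0 = 0" using assms by (rule linear_on_zero)
  then show ?thesis using assms unfolding subspace_iff[OF assms(1)] subspace_iff[OF assms(2)]
    by (auto simp: linear_on_def image_iff; metis)
qed

lemma right_inverse_on:
  assumes "vector_space s" "vector_space t" "linear_on UNIV s t f" "module.subspace s S"
  shows "\<exists>g. linear_on UNIV t s g \<and> range g \<subseteq> S \<and> (\<forall>v\<in>f ` S. f (g v) = v)"
proof -
  interpret A: vector_space s by fact
  interpret B: vector_space t by fact
  interpret vector_space_pair s t ..
  have "Vector_Spaces.linear s t f" using assms(3) linear_on_UNIV_iff assms(1,2) by blast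
  from linear_exists_right_inverse_on[OF this assms(4)] show ?thesis
    unfolding linear_on_UNIV_iff[OF assms(2,1)] by blast
qed

lemma projection_onto:
  assumes "vector_space s" "module.subspace s S"
  shows "\<exists>p. linear_on UNIV s s p \<and> range p \<subseteq> S \<and> (\<forall>v\<in>S. p v = v)"
proof -
  have "linear_on UNIV s s (\<lambda>x. x)" by (simp add: linear_on_def)
  from right_inverse_on[OF assms(1) assms(1) this assms(2)] show ?thesis by simp
qed

text \<open>\<open>g\<close> after a linear choice of preimages under \<open>f\<close>: two
  preimages of the same vector differ by an element of \<open>S\<close> in the kernel of
  \<open>f\<close>, on which \<open>g\<close> vanishes.\<close>

lemma factor_through:
  assumes "vector_space s" "vector_space t" "vector_space u" and S: "module.subspace s S"
    and f: "linear_on S s t f" and g: "linear_on S s u g"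
    and ker: "\<And>x. x \<in> S \<Longrightarrow> f x = 0 \<Longrightarrow> g x = 0"
  shows "\<exists>h. linear_on UNIV t u h \<and> (\<forall>x\<in>S. h (f x) = g x)"
proof -
  obtain p where p: "linear_on UNIV s s p" "range p \<subseteq> S" "\<And>v. v \<in> S \<Longrightarrow> p v = v"
    using projection_onto[OF assms(1) S] by blast
  have "linear_on UNIV s t (\<lambda>x. f (p x))" using linear_on_comp[OF p(1) f p(2)] .
  then obtain r where r: "linear_on UNIV t s r" "range r \<subseteq> S"
    "\<And>v. v \<in> (\<lambda>x. f (p x)) ` S \<Longrightarrow> f (p (r v)) = v"
    using right_inverse_on[OF assms(1,2) _ S] by blast
  show ?thesis
  proof (intro exI conjI ballI)
    show "linear_on UNIV t u (\<lambda>y. g (r y))" using linear_on_comp[OF r(1) g r(2)] .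
    fix x assume x: "x \<in> S"
    have rf: "r (f x) \<in> S" using r(2) by auto
    have "f x \<in> (\<lambda>x. f (p x)) ` S" by (rule image_eqI[OF _ x]) (simp add: p(3)[OF x])
    from r(3)[OF this] have "f (r (f x)) = f x" unfolding p(3)[OF rf] .
    then have "f (r (f x) - x) = 0"
      using linear_on_diff[OF assms(1,2) S f rf x] by simp
    then have "g (r (f x) - x) = 0" using ker subspace_minus[OF assms(1) S rf x] by blast
    then show "g (r (f x)) = g x" using linear_on_diff[OF assms(1,3) S g rf x] by simp
  qed
qed

lemma fin_dim_image:
  assumes "vector_space s" "vector_space t" "module.subspace s S" "linear_on S s t f" "fin_dim s S"
  shows "fin_dim t (f ` S)"
proof -
  interpret A: vector_space s by fact
  interpret B: vector_space t by fact
  interpret vector_space_pair s t ..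
  obtain p where p: "linear_on UNIV s s p" "range p \<subseteq> S" "\<And>v. v \<in> S \<Longrightarrow> p v = v"
    using projection_onto[OF assms(1,3)] by blast
  have "Vector_Spaces.linear s t (\<lambda>x. f (p x))"
    using linear_on_comp[OF p(1) assms(4) p(2)] linear_on_UNIV_iff assms(1,2) by blast
  then interpret L: Vector_Spaces.linear s t "\<lambda>x. f (p x)" .
  obtain B where B: "finite B" "B \<subseteq> S" "S \<subseteq> A.span B" using assms(5) by (auto simp: fin_dim_def)
  have "f ` S = (\<lambda>x. f (p x)) ` S" using p(3) by auto
  also have "\<dots> \<subseteq> (\<lambda>x. f (p x)) ` A.span B" using B by blast
  also have "\<dots> = B.span ((\<lambda>x. f (p x)) ` B)" by (simp add: L.span_image)
  finally have "f ` S \<subseteq> B.span ((\<lambda>x. f (p x)) ` B)" .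
  moreover have "(\<lambda>x. f (p x)) ` B \<subseteq> f ` S" using p(2) by blast
  ultimately show ?thesis unfolding fin_dim_def using B(1) by blast
qed

text \<open>A subspace is the image of the larger space under a projection, so
  \<open>fin_dim_image\<close> applies and no bases have to be compared.\<close>

lemma fin_dim_subset:
  assumes "vector_space s" "module.subspace s S" "module.subspace s T" "S \<subseteq> T" "fin_dim s T"
  shows "fin_dim s S"
proof -
  obtain p where p: "linear_on UNIV s s p" "range p \<subseteq> S" "\<And>v. v \<in> S \<Longrightarrow> p v = v"
    using projection_onto[OF assms(1,2)] by blast
  have "p ` T = S" using p assms(4) by (auto simp: image_iff) (metis subsetD)
  then show ?thesis using fin_dim_image[OF assms(1,1,3) linear_on_subset[OF p(1)] assms(5)] by simp
qed

lemma fin_dim_add: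
  assumes "vector_space s" "fin_dim s S" "fin_dim s T" "S \<subseteq> U" "T \<subseteq> U"
    "\<And>x. x \<in> U \<Longrightarrow> \<exists>a\<in>S. \<exists>b\<in>T. x = a + b"
  shows "fin_dim s U"
proof -
  interpret A: vector_space s by fact
  obtain B C where B: "finite B" "B \<subseteq> S" "S \<subseteq> A.span B" and C: "finite C" "C \<subseteq> T" "T \<subseteq> A.span C"
    using assms(2,3) by (auto simp: fin_dim_def)
  have "x \<in> A.span (B \<union> C)" if x: "x \<in> U" for x
  proof -
    obtain a b where "a \<in> S" "b \<in> T" "x = a + b" using assms(6)[OF x] by blast
    moreover have "A.span B \<subseteq> A.span (B \<union> C)" "A.span C \<subseteq> A.span (B \<union> C)"
      by (auto intro!: A.span_mono)
    ultimately show ?thesis using B C A.span_add by blast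
  qed
  then show ?thesis unfolding fin_dim_def using B C assms(4,5) by (metis finite_Un le_sup_iff subsetI subset_trans)
qed

subsection \<open>Coordinate subspaces\<close>

abbreviation (input) "lookup \<equiv> Poly_Mapping.lookup"

abbreviation (input) "keys \<equiv> Poly_Mapping.keys"

definition pscale :: "'k::field \<Rightarrow> ('i \<Rightarrow>\<^sub>0 'k) \<Rightarrow> ('i \<Rightarrow>\<^sub>0 'k)" where
  "pscale c x = Poly_Mapping.map ((*) c) x"

lemma lookup_pscale [simp]: "lookup (pscale c x) i = c * lookup x i"
  by (simp add: pscale_def Poly_Mapping.map.rep_eq when_def)

lemma vector_space_pscale: "vector_space pscale"
  by unfold_locales (auto intro!: poly_mapping_eqI simp: lookup_add algebra_simps)

text \<open>The pieces of the filtrations are spanned by generators, so they are encoded by sets of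
  indices: intersections and sums of such subspaces become intersections and unions of sets
  (\<open>coord_space_Int\<close>, \<open>coord_space_Un\<close>).\<close>

definition coord_space :: "'i set \<Rightarrow> ('i \<Rightarrow>\<^sub>0 'k::field) set" where
  "coord_space A = {x. keys x \<subseteq> A}"

abbreviation basis :: "'i \<Rightarrow> ('i \<Rightarrow>\<^sub>0 'k::field)" where
  "basis i \<equiv> Poly_Mapping.single i 1"

lemma coord_space_iff: "x \<in> coord_space A \<longleftrightarrow> (\<forall>i. i \<notin> A \<longrightarrow> lookup x i = 0)"
  by (auto simp: coord_space_def in_keys_iff)

lemma coord_space_zero [simp]: "0 \<in> coord_space A"
  by (simp add: coord_space_iff)

lemma coord_space_add: "x \<in> coord_space A \<Longrightarrow> y \<in> coord_space A \<Longrightarrow> x + y \<in> coord_space A"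
  by (simp add: coord_space_iff lookup_add)

lemma coord_space_diff: "x \<in> coord_space A \<Longrightarrow> y \<in> coord_space A \<Longrightarrow> x - y \<in> coord_space A"
  by (simp add: coord_space_iff lookup_minus)

lemma coord_space_uminus: "x \<in> coord_space A \<Longrightarrow> - x \<in> coord_space A"
  by (simp add: coord_space_iff)

lemma coord_space_scale: "x \<in> coord_space A \<Longrightarrow> pscale c x \<in> coord_space A"
  by (simp add: coord_space_iff)

lemma coord_space_sum: "(\<And>t. t \<in> T \<Longrightarrow> f t \<in> coord_space A) \<Longrightarrow> sum f T \<in> coord_space A"
  by (simp add: coord_space_iff lookup_sum)

lemmas coord_space_intros = coord_space_zero coord_space_add coord_space_diff coord_space_uminus
  coord_space_scale coord_space_sum

lemma coord_space_mono: "x \<in> coord_space A \<Longrightarrow> A \<subseteq> B \<Longrightarrow> x \<in> coord_space B"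
  by (auto simp: coord_space_def)

lemma coord_space_Int: "x \<in> coord_space A \<Longrightarrow> x \<in> coord_space B \<Longrightarrow> x \<in> coord_space (A \<inter> B)"
  by (auto simp: coord_space_def)

lemma basis_in_coord_space [simp]: "basis i \<in> coord_space A \<longleftrightarrow> i \<in> A"
  by (auto simp: coord_space_def)

lemma subspace_coord_space: "module.subspace pscale (coord_space A)"
  by (auto simp: subspace_iff[OF vector_space_pscale] coord_space_intros)

definition restrict_to :: "'i set \<Rightarrow> ('i \<Rightarrow>\<^sub>0 'k::field) \<Rightarrow> ('i \<Rightarrow>\<^sub>0 'k)" where
  "restrict_to A x = Abs_poly_mapping (\<lambda>i. if i \<in> A then lookup x i else 0)"

lemma lookup_restrict_to [simp]: "lookup (restrict_to A x) i = (if i \<in> A then lookup x i else 0)"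
proof -
  have "finite {i. (if i \<in> A then lookup x i else 0) \<noteq> 0}"
    by (rule finite_subset[of _ "keys x"]) (auto simp: in_keys_iff)
  then show ?thesis by (simp add: restrict_to_def)
qed

lemma linear_restrict_to: "linear_on S pscale pscale (restrict_to A)"
  by (auto simp: linear_on_def lookup_add intro!: poly_mapping_eqI)

lemma coord_space_Un:
  assumes "x \<in> coord_space (A \<union> B)"
  obtains u v where "u \<in> coord_space A" "v \<in> coord_space B" "x = u + v"
proof
  show "restrict_to A x \<in> coord_space A" "x - restrict_to A x \<in> coord_space B"
    using assms by (auto simp: coord_space_iff lookup_minus)
qed simp

lemma coord_space_induct [consumes 1, case_names zero scale add]:
  assumes x: "x \<in> coord_space A" and "P 0"
    and "\<And>c i. i \<in> A \<Longrightarrow> P (pscale c (basis i))"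
    and "\<And>x y. x \<in> coord_space A \<Longrightarrow> y \<in> coord_space A \<Longrightarrow> P x \<Longrightarrow> P y \<Longrightarrow> P (x + y)"
  shows "P x"
proof -
  have "x \<in> coord_space A \<longrightarrow> P x"
  proof (induction "card (keys x)" arbitrary: x rule: less_induct)
    case (less x)
    show ?case
    proof (cases "x = 0")
      case False
      then obtain i where "lookup x i \<noteq> 0" by (metis poly_mapping_eqI lookup_zero)
      then have i: "i \<in> keys x" by (simp add: in_keys_iff)
      define y where "y = x - pscale (lookup x i) (basis i)"
      have y: "lookup y l = (if l = i then 0 else lookup x l)" for l
        by (simp add: y_def lookup_minus lookup_single when_def)
      then have "keys y \<subset> keys x" using i by (auto simp: in_keys_iff split: if_splits)
      then have k: "card (keys y) < card (keys x)" by (simp add: psubset_card_mono)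
      show ?thesis
      proof
        assume x: "x \<in> coord_space A"
        have yA: "y \<in> coord_space A" using x y by (auto simp: coord_space_iff)
        have iA: "i \<in> A" using i x by (auto simp: coord_space_def)
        have "P (y + pscale (lookup x i) (basis i))"
          using less[OF k] yA iA by (intro assms(3,4)) (auto intro: coord_space_scale)
        then show "P x" by (simp add: y_def)
      qed
    qed (simp add: assms(2))
  qed
  then show ?thesis using x by blast
qed

definition lin_ext :: "('k::field \<Rightarrow> 'b \<Rightarrow> 'b) \<Rightarrow> ('i \<Rightarrow> 'b) \<Rightarrow> ('i \<Rightarrow>\<^sub>0 'k) \<Rightarrow> 'b::ab_group_add" where
  "lin_ext t g x = (\<Sum>i\<in>keys x. t (lookup x i) (g i))"

context
  fixes t :: "'k::field \<Rightarrow> 'b \<Rightarrow> 'b::ab_group_add"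
  assumes t: "vector_space t"
begin

interpretation vector_space t by (rule t)

lemma lin_ext_superset: "finite A \<Longrightarrow> keys x \<subseteq> A \<Longrightarrow> lin_ext t g x = (\<Sum>i\<in>A. t (lookup x i) (g i))"
  unfolding lin_ext_def by (rule sum.mono_neutral_left) (auto simp: in_keys_iff)

lemma linear_lin_ext: "linear_on UNIV pscale t (lin_ext t g)"
proof -
  have "lin_ext t g (x + y) = lin_ext t g x + lin_ext t g y" for x y
  proof -
    let ?A = "keys x \<union> keys y"
    have "keys (x + y) \<subseteq> ?A" by (rule keys_add)
    then show ?thesis using lin_ext_superset[of ?A "x + y"] lin_ext_superset[of ?A x] lin_ext_superset[of ?A y]
      by (simp add: lookup_add scale_left_distrib sum.distrib)
  qed
  moreover have "lin_ext t g (pscale c x) = t c (lin_ext t g x)" for c x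
  proof -
    have "keys (pscale c x) \<subseteq> keys x" by (auto simp: in_keys_iff)
    then show ?thesis using lin_ext_superset[of "keys x" "pscale c x"]
      by (simp add: lin_ext_def scale_sum_right)
  qed
  ultimately show ?thesis by (simp add: linear_on_def)
qed

lemma lin_ext_basis [simp]: "lin_ext t g (basis i) = g i"
  by (simp add: lin_ext_def)

lemma linear_coord_space_into:
  assumes "linear_on (coord_space A) pscale t f" "\<And>i. i \<in> A \<Longrightarrow> f (basis i) \<in> S" "module.subspace t S"
    and "x \<in> coord_space A"
  shows "f x \<in> S"
proof -
  have 0: "f 0 = 0" by (rule linear_on_zero[OF vector_space_pscale t subspace_coord_space assms(1)])
  show ?thesis using assms(4)
  proof (induction rule: coord_space_induct)
    case zero
    then show ?case using 0 assms(3) subspace_0 by simp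
  next
    case (scale c i)
    then show ?case using assms(2)[OF scale] linear_onD(2)[OF assms(1)] subspace_scale[OF assms(3)] by simp
  next
    case (add x y)
    then show ?case using linear_onD(1)[OF assms(1)] subspace_add[OF assms(3)] by simp
  qed
qed

lemma linear_coord_space_eq:
  assumes "linear_on (coord_space A) pscale t f" "linear_on (coord_space A) pscale t g"
    "\<And>i. i \<in> A \<Longrightarrow> f (basis i) = g (basis i)" "x \<in> coord_space A"
  shows "f x = g x"
proof -
  have "linear_on (coord_space A) pscale t (\<lambda>x. f x - g x)"
    using assms(1,2) by (auto simp: linear_on_def scale_right_diff_distrib)
  from linear_coord_space_into[OF this _ subspace_zero[OF t] assms(4)] assms(3)
  have "f x - g x \<in> {0}" by simp
  then show ?thesis by simp
qed

end

section \<open>Linear maps between spaces of finitely supported functions\<close>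

abbreviation lin :: "(('i \<Rightarrow>\<^sub>0 'k::field) \<Rightarrow> ('j \<Rightarrow>\<^sub>0 'k)) \<Rightarrow> bool" where
  "lin \<equiv> linear_on UNIV pscale pscale"

lemma lin_add: "lin f \<Longrightarrow> f (x + y) = f x + f y"
  by (simp add: linear_on_def)

lemma lin_scale: "lin f \<Longrightarrow> f (pscale c x) = pscale c (f x)"
  by (simp add: linear_on_def)

lemma lin_zero: "lin f \<Longrightarrow> f 0 = 0"
  by (rule linear_on_zero[OF vector_space_pscale vector_space_pscale subspace_UNIV[OF vector_space_pscale]])

lemma lin_uminus: "lin f \<Longrightarrow> f (- x) = - f x"
  by (rule linear_on_uminus[OF vector_space_pscale vector_space_pscale]) auto

lemma lin_diff: "lin f \<Longrightarrow> f (x - y) = f x - f y"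
  by (rule linear_on_diff[OF vector_space_pscale vector_space_pscale subspace_UNIV[OF vector_space_pscale]]) auto

lemma lin_sum: "lin f \<Longrightarrow> f (sum g T) = (\<Sum>t\<in>T. f (g t))"
  by (induction T rule: infinite_finite_induct) (auto simp: lin_zero lin_add)

lemmas lin_simps = lin_add lin_scale lin_zero lin_uminus lin_diff lin_sum

lemma pscale_distrib: "pscale c (x + y) = pscale c x + pscale c y"
  "pscale c (x - y) = pscale c x - pscale c y" "pscale c (- x) = - pscale c x"
  "pscale c (sum g T) = (\<Sum>t\<in>T. pscale c (g t))"
  by (auto intro!: poly_mapping_eqI simp: lookup_add lookup_minus algebra_simps lookup_sum sum_distrib_left)

lemma linI: "(\<And>x y. f (x + y) = f x + f y) \<Longrightarrow> (\<And>c x. f (pscale c x) = pscale c (f x)) \<Longrightarrow> lin f"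
  by (simp add: linear_on_def)

lemma lin_comp: "lin f \<Longrightarrow> lin g \<Longrightarrow> lin (\<lambda>x. g (f x))"
  by (simp add: linear_on_def)

lemma lin_minus: "lin f \<Longrightarrow> lin g \<Longrightarrow> lin (\<lambda>x. f x - g x)"
  by (auto intro!: linI simp: lin_simps pscale_distrib)

lemma lin_plus: "lin f \<Longrightarrow> lin g \<Longrightarrow> lin (\<lambda>x. f x + g x)"
  by (auto intro!: linI simp: lin_simps pscale_distrib)

lemma lin_neg: "lin f \<Longrightarrow> lin (\<lambda>x. - f x)"
  by (auto intro!: linI simp: lin_simps pscale_distrib)

lemma lin_setsum: "(\<And>t. t \<in> T \<Longrightarrow> lin (f t)) \<Longrightarrow> lin (\<lambda>x. \<Sum>t\<in>T. f t x)"
  by (auto intro!: linI simp: lin_simps pscale_distrib sum.distrib)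

lemma lin_id: "lin (\<lambda>x. x)"
  by (simp add: linear_on_def)

lemma lin_const_zero: "lin (\<lambda>x. 0)"
  by (auto intro!: linI poly_mapping_eqI)

abbreviation ext :: "('i \<Rightarrow> ('j \<Rightarrow>\<^sub>0 'k::field)) \<Rightarrow> ('i \<Rightarrow>\<^sub>0 'k) \<Rightarrow> ('j \<Rightarrow>\<^sub>0 'k)" where
  "ext \<equiv> lin_ext pscale"

lemma lin_ext: "lin (ext g)"
  by (rule linear_lin_ext[OF vector_space_pscale])

lemma ext_basis [simp]: "ext g (basis i) = g i"
  by (rule lin_ext_basis[OF vector_space_pscale])

lemma lin_into:
  "lin f \<Longrightarrow> (\<And>i. i \<in> A \<Longrightarrow> f (basis i) \<in> coord_space B) \<Longrightarrow> x \<in> coord_space A \<Longrightarrow> f x \<in> coord_space B"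
  by (rule linear_coord_space_into[OF vector_space_pscale _ _ subspace_coord_space, where A = A])
    (auto intro: linear_on_subset)

lemma lin_eq:
  "lin f \<Longrightarrow> lin g \<Longrightarrow> (\<And>i. i \<in> A \<Longrightarrow> f (basis i) = g (basis i)) \<Longrightarrow> x \<in> coord_space A \<Longrightarrow> f x = g x"
  by (rule linear_coord_space_eq[OF vector_space_pscale, where A = A])
    (auto intro: linear_on_subset)

subsection \<open>Filtered free complexes and their contractions\<close>

record ('i, 'n) index =
  gens :: "'i set"
  gdeg :: "'i \<Rightarrow> int"
  mdeg :: "'i \<Rightarrow> int ^ 'n"

text \<open>With \<open>I = gens X\<close>, the space of finitely supported functions on \<open>below X S d z\<close> is the component in
  grade \<open>z\<close> of the \<open>d\<close>-th module of the complex, localised at the variables in \<open>S\<close>.\<close>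

definition below :: "('i, 'n::finite) index \<Rightarrow> 'n set \<Rightarrow> int \<Rightarrow> int ^ 'n \<Rightarrow> 'i set" where
  "below X S d z = {i \<in> gens X. gdeg X i = d \<and> (\<forall>l. l \<notin> S \<longrightarrow> mdeg X i $ l \<le> z $ l)}"

text \<open>The quotient of \<open>below X S d z\<close> by this part has a basis of the generators
  that are at most \<open>z\<close> in the coordinates outside \<open>S\<close> and exceed
  \<open>z\<close> in all coordinates of \<open>S\<close>. It interpolates between \<open>F\<close>
  (\<open>S = {}\<close>) and, up to double duals, \<nu>F\<langle>\<epsilon>\<rangle>
  (\<open>S = UNIV\<close>); each contraction moves one coordinate into \<open>S\<close>.\<close>

definition below_smaller :: "('i, 'n::finite) index \<Rightarrow> 'n set \<Rightarrow> int \<Rightarrow> int ^ 'n \<Rightarrow> 'i set" where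
  "below_smaller X S d z = {i \<in> below X S d z. \<exists>l\<in>S. mdeg X i $ l \<le> z $ l}"

text \<open>A map of degree \<open>m\<close> respecting the filtrations by the coordinates outside
  \<open>S\<close>, that is, a map of the modules localised at \<open>S\<close>. Comparing each
  basis vector with its own degree controls all grades (\<open>filt_map_below\<close>).\<close>

definition filt_map :: "('i, 'n::finite) index \<Rightarrow> ('j, 'n) index \<Rightarrow> 'n set \<Rightarrow> int \<Rightarrow>
    (('i \<Rightarrow>\<^sub>0 'k::field) \<Rightarrow> ('j \<Rightarrow>\<^sub>0 'k)) \<Rightarrow> bool" where
  "filt_map X Y S m T \<longleftrightarrow> lin T \<and>
     (\<forall>i\<in>gens X. T (basis i) \<in> coord_space (below Y S (gdeg X i + m) (mdeg X i)))"

text \<open>The maps that vanish on the subquotients. Identities between maps of subquotients are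
  expressed by saying that the difference of the two sides is \<open>filt_null\<close>.\<close>

definition filt_null :: "('i, 'n::finite) index \<Rightarrow> ('j, 'n) index \<Rightarrow> 'n set \<Rightarrow> int \<Rightarrow>
    (('i \<Rightarrow>\<^sub>0 'k::field) \<Rightarrow> ('j \<Rightarrow>\<^sub>0 'k)) \<Rightarrow> bool" where
  "filt_null X Y S m T \<longleftrightarrow> lin T \<and>
     (\<forall>i\<in>gens X. T (basis i) \<in> coord_space (below_smaller Y S (gdeg X i + m) (mdeg X i)))"

lemma below_smaller_subset: "below_smaller X S d z \<subseteq> below X S d z"
  by (auto simp: below_smaller_def)

lemma below_subset_smaller: "j \<in> S' \<Longrightarrow> j \<notin> S \<Longrightarrow> S \<subseteq> S' \<Longrightarrow> below X S d z \<subseteq> below_smaller X S' d z"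
  unfolding below_smaller_def below_def by blast

lemma filt_mapD: "filt_map X Y S m T \<Longrightarrow> lin T" "filt_null X Y S m T \<Longrightarrow> lin T"
  by (simp_all add: filt_map_def filt_null_def)

lemma below_trans:
  assumes "k \<in> below Y S (gdeg X i + m) (mdeg X i)" "i \<in> below X S' d z"
  shows "k \<in> below Y (S \<union> S') (d + m) z"
  using assms unfolding below_def by (simp; meson order_trans)

text \<open>The coordinate \<open>l\<close> that makes \<open>i\<close> small must be one whose
  filtration the map respects. This is the reason for \<open>S \<inter> S' = {}\<close>, and later
  for lists of distinct coordinates.\<close>

lemma below_smaller_trans:
  assumes k: "k \<in> below Y S (gdeg X i + m) (mdeg X i)" and i: "i \<in> below_smaller X S' d z" "S \<inter> S' = {}"
  shows "k \<in> below_smaller Y (S \<union> S') (d + m) z"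
proof -
  obtain l where l: "l \<in> S'" "mdeg X i $ l \<le> z $ l" using i by (auto simp: below_smaller_def)
  have "l \<notin> S" using l i by blast
  then have "mdeg Y k $ l \<le> mdeg X i $ l" using k by (simp add: below_def)
  then have "mdeg Y k $ l \<le> z $ l" using l(2) by simp
  moreover have "k \<in> below Y (S \<union> S') (d + m) z"
    by (rule below_trans[OF k subsetD[OF below_smaller_subset i(1)]])
  ultimately show ?thesis using l(1) unfolding below_smaller_def by blast
qed

lemma below_smaller_trans':
  assumes k: "k \<in> below_smaller Y S (gdeg X i + m) (mdeg X i)" and i: "i \<in> below X S' d z" "S \<inter> S' = {}"
  shows "k \<in> below_smaller Y (S \<union> S') (d + m) z"
proof -
  obtain l where l: "l \<in> S" "mdeg Y k $ l \<le> mdeg X i $ l" using k by (auto simp: below_smaller_def)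
  have "l \<notin> S'" using l i by blast
  then have "mdeg X i $ l \<le> z $ l" using i by (simp add: below_def)
  then have "mdeg Y k $ l \<le> z $ l" using l(2) by simp
  moreover have "k \<in> below Y (S \<union> S') (d + m) z"
    by (rule below_trans[OF subsetD[OF below_smaller_subset k] i(1)])
  ultimately show ?thesis using l(1) unfolding below_smaller_def by blast
qed

lemma below_gens: "i \<in> below X S d z \<Longrightarrow> i \<in> gens X" "i \<in> below_smaller X S' d z \<Longrightarrow> i \<in> gens X"
  by (simp_all add: below_def below_smaller_def)

lemma filt_map_below:
  assumes T: "filt_map X Y S m T" and x: "x \<in> coord_space (below X S' d z)"
  shows "T x \<in> coord_space (below Y (S \<union> S') (d + m) z)"
proof (rule lin_into[OF filt_mapD(1)[OF T] _ x])
  fix i assume i: "i \<in> below X S' d z"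
  have "T (basis i) \<in> coord_space (below Y S (gdeg X i + m) (mdeg X i))"
    using T below_gens(1)[OF i] by (simp add: filt_map_def)
  then show "T (basis i) \<in> coord_space (below Y (S \<union> S') (d + m) z)"
    by (rule coord_space_mono) (rule subsetI, erule below_trans[OF _ i])
qed

lemma filt_map_below_smaller:
  assumes T: "filt_map X Y S m T" and x: "x \<in> coord_space (below_smaller X S' d z)" and S: "S \<inter> S' = {}"
  shows "T x \<in> coord_space (below_smaller Y (S \<union> S') (d + m) z)"
proof (rule lin_into[OF filt_mapD(1)[OF T] _ x])
  fix i assume i: "i \<in> below_smaller X S' d z"
  have "T (basis i) \<in> coord_space (below Y S (gdeg X i + m) (mdeg X i))"
    using T below_gens(2)[OF i] by (simp add: filt_map_def)
  then show "T (basis i) \<in> coord_space (below_smaller Y (S \<union> S') (d + m) z)"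
    by (rule coord_space_mono) (rule subsetI, erule below_smaller_trans[OF _ i S])
qed

lemma filt_null_below:
  assumes T: "filt_null X Y S m T" and x: "x \<in> coord_space (below X S' d z)" and S: "S \<inter> S' = {}"
  shows "T x \<in> coord_space (below_smaller Y (S \<union> S') (d + m) z)"
proof (rule lin_into[OF filt_mapD(2)[OF T] _ x])
  fix i assume i: "i \<in> below X S' d z"
  have "T (basis i) \<in> coord_space (below_smaller Y S (gdeg X i + m) (mdeg X i))"
    using T below_gens(1)[OF i] by (simp add: filt_null_def)
  then show "T (basis i) \<in> coord_space (below_smaller Y (S \<union> S') (d + m) z)"
    by (rule coord_space_mono) (rule subsetI, erule below_smaller_trans'[OF _ i S])
qed

lemma filt_map_comp:
  assumes "filt_map X Y S m T" "filt_map Y Z S' m' T'"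
  shows "filt_map X Z (S \<union> S') (m + m') (\<lambda>x. T' (T x))"
  unfolding filt_map_def
proof (intro conjI ballI)
  show "lin (\<lambda>x. T' (T x))" using assms by (auto simp: filt_map_def intro: lin_comp)
  fix i assume "i \<in> gens X"
  then have "T (basis i) \<in> coord_space (below Y S (gdeg X i + m) (mdeg X i))"
    using assms by (simp add: filt_map_def)
  from filt_map_below[OF assms(2) this]
  show "T' (T (basis i)) \<in> coord_space (below Z (S \<union> S') (gdeg X i + (m + m')) (mdeg X i))"
    by (simp add: Un_commute add.assoc)
qed

lemma filt_map_null_comp:
  assumes "filt_null X Y S m T" "filt_map Y Z S' m' T'" "S \<inter> S' = {}"
  shows "filt_null X Z (S \<union> S') (m + m') (\<lambda>x. T' (T x))"
  unfolding filt_null_def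
proof (intro conjI ballI)
  show "lin (\<lambda>x. T' (T x))" using assms by (auto simp: filt_map_def filt_null_def intro: lin_comp)
  fix i assume "i \<in> gens X"
  then have "T (basis i) \<in> coord_space (below_smaller Y S (gdeg X i + m) (mdeg X i))"
    using assms by (simp add: filt_null_def)
  from filt_map_below_smaller[OF assms(2) this] assms(3)
  show "T' (T (basis i)) \<in> coord_space (below_smaller Z (S \<union> S') (gdeg X i + (m + m')) (mdeg X i))"
    by (simp add: Un_commute Int_commute add.assoc)
qed

text \<open>A map that respects the \<open>j\<close>-th filtration does not raise the
  \<open>j\<close>-th coordinate, so its values are small as soon as \<open>j\<close> is among the
  inverted variables. This is the mechanism that kills the error terms of iterated
  contractions.\<close>

lemma filt_map_imp_null:
  assumes "filt_map X Y S m T" "S \<subseteq> S'" "j \<in> S'" "j \<notin> S"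
  shows "filt_null X Y S' m T"
  unfolding filt_null_def
proof (intro conjI ballI)
  fix i assume "i \<in> gens X"
  then have "T (basis i) \<in> coord_space (below Y S (gdeg X i + m) (mdeg X i))"
    using assms(1) by (simp add: filt_map_def)
  then show "T (basis i) \<in> coord_space (below_smaller Y S' (gdeg X i + m) (mdeg X i))"
    by (rule coord_space_mono[OF _ below_subset_smaller[OF assms(3,4,2)]])
qed (rule filt_mapD(1)[OF assms(1)])

lemma filt_null_plus: "filt_null X Y S m T \<Longrightarrow> filt_null X Y S m T' \<Longrightarrow> filt_null X Y S m (\<lambda>x. T x + T' x)"
  by (simp add: filt_null_def lin_plus coord_space_add)

lemma filt_null_minus: "filt_null X Y S m T \<Longrightarrow> filt_null X Y S m T' \<Longrightarrow> filt_null X Y S m (\<lambda>x. T x - T' x)"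
  by (simp add: filt_null_def lin_minus coord_space_diff)

lemma filt_map_plus: "filt_map X Y S m T \<Longrightarrow> filt_map X Y S m T' \<Longrightarrow> filt_map X Y S m (\<lambda>x. T x + T' x)"
  by (simp add: filt_map_def lin_plus coord_space_add)

lemma filt_map_neg: "filt_map X Y S m T \<Longrightarrow> filt_map X Y S m (\<lambda>x. - T x)"
  by (simp add: filt_map_def lin_neg coord_space_uminus)

lemma filt_map_id: "filt_map X X {} 0 (\<lambda>x. x)"
  by (simp add: filt_map_def lin_id below_def)

locale filtered_complex =
  fixes X :: "('i, 'n::finite) index" and D :: "('i \<Rightarrow>\<^sub>0 'k::field) \<Rightarrow> ('i \<Rightarrow>\<^sub>0 'k)"
  assumes filt_D: "filt_map X X {} (- 1) D"
    and D_D_basis: "\<And>i. i \<in> gens X \<Longrightarrow> D (D (basis i)) = 0"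
begin

lemma lin_D: "lin D"
  using filt_D by (simp add: filt_map_def)

lemma D_D:
  assumes "x \<in> coord_space (gens X)"
  shows "D (D x) = 0"
  using lin_eq[OF lin_comp[OF lin_D lin_D] lin_const_zero _ assms] D_D_basis by simp

lemma D_below: "x \<in> coord_space (below X S d z) \<Longrightarrow> D x \<in> coord_space (below X S (d - 1) z)"
  using filt_map_below[OF filt_D] by fastforce

definition contraction :: "'n \<Rightarrow> (('i \<Rightarrow>\<^sub>0 'k) \<Rightarrow> ('i \<Rightarrow>\<^sub>0 'k)) \<Rightarrow> bool" where
  "contraction j h \<longleftrightarrow> filt_map X X {j} 1 h \<and> (\<forall>i\<in>gens X. D (h (basis i)) + h (D (basis i)) = basis i)"

text \<open>Interpolates between a contraction of a single complex of vector spaces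
  (\<open>J = {j}\<close>, all other coordinates bounded by \<open>z\<close>) and a
  \<open>contraction\<close> (\<open>J = UNIV\<close>). Coordinates outside \<open>J\<close> are
  only kept below \<open>z\<close>; those in \<open>J\<close> other than \<open>j\<close> have their
  filtration respected. On generators that are not below \<open>z\<close> outside \<open>J\<close>,
  the values of \<open>h\<close> are arbitrary.\<close>

definition partial_contraction :: "'n \<Rightarrow> 'n set \<Rightarrow> int ^ 'n \<Rightarrow> (('i \<Rightarrow>\<^sub>0 'k) \<Rightarrow> ('i \<Rightarrow>\<^sub>0 'k)) \<Rightarrow> bool" where
  "partial_contraction j J z h \<longleftrightarrow> lin h \<and> (\<forall>i\<in>gens X. (\<forall>l. l \<notin> J \<longrightarrow> mdeg X i $ l \<le> z $ l) \<longrightarrow>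
     h (basis i) \<in> coord_space {k \<in> gens X. gdeg X k = gdeg X i + 1 \<and>
        (\<forall>l. l \<notin> J \<longrightarrow> mdeg X k $ l \<le> z $ l) \<and> (\<forall>l\<in>J - {j}. mdeg X k $ l \<le> mdeg X i $ l)} \<and>
     D (h (basis i)) + h (D (basis i)) = basis i)"

lemma partial_contraction_base:
  assumes acyclic: "\<And>d x. x \<in> coord_space (below X {j} d z) \<Longrightarrow> D x = 0 \<Longrightarrow>
      \<exists>y\<in>coord_space (below X {j} (d + 1) z). D y = x"
  shows "\<exists>h. partial_contraction j {j} z h"
proof -
  let ?V = "\<lambda>d. coord_space (below X {j} d z)"
  have "\<exists>g. lin g \<and> range g \<subseteq> ?V (d + 1) \<and> (\<forall>v\<in>D ` ?V (d + 1). D (g v) = v)" for d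
    by (rule right_inverse_on[OF vector_space_pscale vector_space_pscale lin_D subspace_coord_space])
  then obtain g where g: "\<And>d. lin (g d)" "\<And>d. range (g d) \<subseteq> ?V (d + 1)"
    "\<And>d v. v \<in> D ` ?V (d + 1) \<Longrightarrow> D (g d v) = v" by metis
  have Dg: "D (g d x) = x" if "x \<in> ?V d" "D x = 0" for d x
    using acyclic[OF that] g(3) by blast
  \<comment> \<open>The chosen \<open>g\<close> inverts \<open>D\<close> only on cycles. The element
    \<open>x - g (D x)\<close> is the cycle part of \<open>x\<close>, so applying \<open>g\<close>
    to it gives a contraction.\<close>
  define h where "h = ext (\<lambda>i. g (gdeg X i) (basis i - g (gdeg X i - 1) (D (basis i))))"
  have gens: "x \<in> coord_space (gens X)" if "x \<in> ?V d" for x d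
    using that by (rule coord_space_mono) (auto simp: below_def)
  have gD: "g d x \<in> ?V (d + 1)" for d x using g(2) by blast
  have gD': "g (d - 1) x \<in> ?V d" for d x using gD[of "d - 1"] by simp
  have h: "h x = g d (x - g (d - 1) (D x))" if "x \<in> ?V d" for d x
  proof (rule lin_eq[OF _ _ _ that])
    show "lin h" unfolding h_def by (rule lin_ext)
    show "lin (\<lambda>x. g d (x - g (d - 1) (D x)))"
      by (intro lin_comp[OF _ g(1)] lin_minus lin_id lin_comp[OF lin_D g(1)])
  qed (simp add: h_def below_def)
  have "partial_contraction j {j} z h" unfolding partial_contraction_def
  proof (intro conjI ballI impI)
    show "lin h" by (simp add: h_def lin_ext)
    fix i assume i: "i \<in> gens X" "\<forall>l. l \<notin> {j} \<longrightarrow> mdeg X i $ l \<le> z $ l"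
    let ?d = "gdeg X i"
    have iV: "basis i \<in> ?V ?d" using i by (simp add: below_def)
    have "h (basis i) \<in> ?V (?d + 1)" using h[OF iV] gD by simp
    then show "h (basis i) \<in> coord_space {k \<in> gens X. gdeg X k = gdeg X i + 1 \<and>
        (\<forall>l. l \<notin> {j} \<longrightarrow> mdeg X k $ l \<le> z $ l) \<and> (\<forall>l\<in>{j} - {j}. mdeg X k $ l \<le> mdeg X i $ l)}"
      by (rule coord_space_mono) (auto simp: below_def)
    have DV: "D (basis i) \<in> ?V (?d - 1)" using D_below[OF iV] .
    have DD: "D (D (basis i)) = 0" using D_D_basis i by simp
    have DgD: "D (g (?d - 1) (D (basis i))) = D (basis i)" by (rule Dg[OF DV DD])
    have "h (D (basis i)) = g (?d - 1) (D (basis i))"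
      using h[OF DV] DD by (simp add: lin_zero[OF g(1)])
    moreover have "D (h (basis i)) = basis i - g (?d - 1) (D (basis i))"
      unfolding h[OF iV] by (rule Dg[OF coord_space_diff[OF iV gD']]) (simp add: lin_diff[OF lin_D] DgD)
    ultimately show "D (h (basis i)) + h (D (basis i)) = basis i" by simp
  qed
  then show ?thesis by blast
qed

text \<open>For each bound \<open>t\<close> on the \<open>j\<close>-th coordinate there is a
  contraction \<open>h t\<close>, and these are unrelated to each other. Applying to each generator
  the contraction for its own \<open>j\<close>-degree respects the new filtration but is no
  contraction. Homotopies between consecutive \<open>h t\<close> repair this, as in a mapping
  telescope.\<close>

lemma partial_contraction_step:
  assumes IH: "\<And>z. \<exists>h. partial_contraction j0 J z h" and j0: "j0 \<in> J" and j: "j \<notin> J"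
  shows "\<exists>h. partial_contraction j0 (insert j J) z h"
proof -
  define low where "low i \<longleftrightarrow> i \<in> gens X \<and> (\<forall>l. l \<notin> insert j J \<longrightarrow> mdeg X i $ l \<le> z $ l)" for i
  define U where "U t = {i. low i \<and> mdeg X i $ j \<le> t}" for t
  \<comment> \<open>The range allowed for the image of \<open>basis i\<close> under a map of degree
    \<open>m\<close>: the filtrations in \<open>J\<close> except \<open>j0\<close> are respected,
    while the \<open>j\<close>-th coordinate is bounded by the free parameter
    \<open>t\<close>.\<close>
  define Q where "Q m i t = {k. low k \<and> gdeg X k = gdeg X i + m \<and>
      (\<forall>l\<in>J - {j0}. mdeg X k $ l \<le> mdeg X i $ l) \<and> mdeg X k $ j \<le> t}" for m i t
  let ?b = "\<lambda>i. mdeg X i $ j"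
  have QU: "Q m i t \<subseteq> U t" for m i t by (auto simp: Q_def U_def)
  have QQ: "Q m' k t \<subseteq> Q (m + m') i t" if "k \<in> Q m i a" for m m' k i a t
    using that unfolding Q_def by (simp add: subset_iff; meson order_trans)
  have Qt: "Q m i a \<subseteq> Q m i b" if "a \<le> b" for m i a b using that by (auto simp: Q_def)
  have Ut: "U a \<subseteq> U b" if "a \<le> b" for a b using that by (auto simp: U_def)
  have "\<exists>h. partial_contraction j0 J (\<chi> l. if l = j then t else z $ l) h" for t by (rule IH)
  then obtain h where "\<And>t. partial_contraction j0 J (\<chi> l. if l = j then t else z $ l) (h t)" by metis
  note h = this[unfolded partial_contraction_def]
  have lin_h: "lin (h t)" for t using h by blast
  have iff: "(\<forall>l. l \<notin> J \<longrightarrow> mdeg X i $ l \<le> (\<chi> l. if l = j then t else z $ l) $ l) \<longleftrightarrow>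
      (\<forall>l. l \<notin> insert j J \<longrightarrow> mdeg X i $ l \<le> z $ l) \<and> mdeg X i $ j \<le> t" for i t
    using j by auto
  have hQ: "h t (basis i) \<in> coord_space (Q 1 i t)" if "i \<in> U t" for i t
  proof -
    have "h t (basis i) \<in> coord_space {k \<in> gens X. gdeg X k = gdeg X i + 1 \<and>
        (\<forall>l. l \<notin> J \<longrightarrow> mdeg X k $ l \<le> (\<chi> l. if l = j then t else z $ l) $ l) \<and> (\<forall>l\<in>J - {j0}. mdeg X k $ l \<le> mdeg X i $ l)}"
      using h[of t] that iff unfolding U_def low_def by blast
    then show ?thesis unfolding iff by (rule coord_space_mono) (auto simp: Q_def low_def)
  qed
  have Dh: "D (h t (basis i)) + h t (D (basis i)) = basis i" if "i \<in> U t" for i t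
    using h[of t] that iff unfolding U_def low_def by blast
  have DQ: "D (basis i) \<in> coord_space (Q (- 1) i (?b i))" if "low i" for i
  proof -
    have "D (basis i) \<in> coord_space (below X {} (gdeg X i - 1) (mdeg X i))"
      using filt_D that by (simp add: filt_map_def low_def)
    then show ?thesis
      by (rule coord_space_mono) (use that in \<open>simp add: below_def Q_def low_def subset_iff; meson order_trans\<close>)
  qed
  have mapQ: "f x \<in> coord_space (Q (m + m') i t)"
    if "lin f" "x \<in> coord_space (Q m i a)" "\<And>k. k \<in> U a \<Longrightarrow> f (basis k) \<in> coord_space (Q m' k t)"
    for f x m m' i a t
    using that(1) _ that(2)
  proof (rule lin_into)
    fix k assume k: "k \<in> Q m i a"
    show "f (basis k) \<in> coord_space (Q (m + m') i t)"
      by (rule coord_space_mono[OF that(3) QQ[OF k]]) (use k QU in blast)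
  qed
  have DU: "D x \<in> coord_space (U t)" if "x \<in> coord_space (U t)" for x t
  proof (rule lin_into[OF lin_D _ that])
    fix i assume "i \<in> U t"
    then show "D (basis i) \<in> coord_space (U t)"
      using DQ[of i] QU[of "- 1" i "?b i"] Ut[of "?b i" t] by (auto simp: U_def intro: coord_space_mono)
  qed
  have hU: "h t x \<in> coord_space (U t)" if "x \<in> coord_space (U t)" for x t
    by (rule lin_into[OF lin_h _ that]) (use hQ QU in \<open>blast intro: coord_space_mono\<close>)
  have DhU: "D (h t x) + h t (D x) = x" if "x \<in> coord_space (U t)" for x t
    by (rule lin_eq[OF lin_plus[OF lin_comp[OF lin_h lin_D] lin_comp[OF lin_D lin_h]] lin_id _ that])
      (rule Dh)
  \<comment> \<open>The composite of two contractions is a homotopy between them: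
    \<open>D k - k D = h t - h (t + 1)\<close> on \<open>U t\<close>, where both contract.\<close>
  define k where "k = (\<lambda>t x. h (t + 1) (h t x))"
  have lin_k: "lin (k t)" for t unfolding k_def by (rule lin_comp[OF lin_h lin_h])
  have Dk: "D (k t x) - k t (D x) = h t x - h (t + 1) x" if x: "x \<in> coord_space (U t)" for t x
  proof -
    have "h t x \<in> coord_space (U (t + 1))" using hU[OF x] by (rule coord_space_mono) (simp add: Ut)
    from DhU[OF this] have 1: "D (h (t + 1) (h t x)) = h t x - h (t + 1) (D (h t x))" by (simp add: algebra_simps)
    have 2: "D (h t x) = x - h t (D x)" using DhU[OF x] by (simp add: algebra_simps)
    show ?thesis unfolding k_def 1 2 by (simp add: lin_simps[OF lin_h])
  qed
  have kQ: "k t (basis i) \<in> coord_space (Q 2 i (t + 1))" if i: "i \<in> U t" for i t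
  proof -
    have "h (t + 1) (h t (basis i)) \<in> coord_space (Q (1 + 1) i (t + 1))"
      by (rule mapQ[OF lin_h hQ[OF i]]) (use hQ Ut[of t "t + 1"] in auto)
    then show ?thesis by (simp add: k_def)
  qed
  \<comment> \<open>The bound on the \<open>j\<close>-th coordinate of \<open>k t\<close> is
    \<open>t + 1\<close>, because the outer factor is \<open>h (t + 1)\<close>. With the half-open
    range the sum up to \<open>b\<close> stays below \<open>b\<close>.\<close>
  define kk where "kk = (\<lambda>a b x. \<Sum>t\<in>{a..<b}. k t x)"
  have lin_kk: "lin (kk a b)" for a b unfolding kk_def by (rule lin_setsum) (rule lin_k)
  have kk_add: "kk a b x + kk b c x = kk a c x" if "a \<le> b" "b \<le> c" for a b c x
    unfolding kk_def using that by (subst sum.union_disjoint[symmetric]) (auto simp: ivl_disj_un)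
  have kkQ: "kk a b (basis i) \<in> coord_space (Q 2 i b)" if i: "i \<in> U a" for a b i
    unfolding kk_def
  proof (rule coord_space_sum)
    fix t assume "t \<in> {a..<b}"
    then have t: "a \<le> t" "t + 1 \<le> b" by auto
    show "k t (basis i) \<in> coord_space (Q 2 i b)"
      by (rule coord_space_mono[OF kQ[OF subsetD[OF Ut[OF t(1)] i]] Qt[OF t(2)]])
  qed
  have Dkk: "D (kk a b x) - kk a b (D x) = h a x - h b x" if "a \<le> b" and x: "x \<in> coord_space (U a)" for a b x
    using that(1)
  proof (induction b rule: int_ge_induct)
    case base
    then show ?case by (simp add: kk_def lin_zero[OF lin_D])
  next
    case (step b)
    have "x \<in> coord_space (U b)" using x Ut[OF step(1)] by (rule coord_space_mono)
    from Dk[OF this] have "D (k b x) - k b (D x) = h b x - h (b + 1) x" .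
    moreover have "kk a (b + 1) y = kk a b y + k b y" for y
    proof -
      have "{a..<b + 1} = insert b {a..<b}" using step(1) by auto
      then show ?thesis by (simp add: kk_def add.commute)
    qed
    ultimately show ?case using step(2) by (simp add: lin_add[OF lin_D] add_diff_add)
  qed
  \<comment> \<open>On each generator \<open>T b\<close> is the homotopy from the contraction for
    its own \<open>j\<close>-degree to \<open>h b\<close>.\<close>
  define T where "T b = ext (\<lambda>i. kk (?b i) b (basis i))" for b
  have lin_T: "lin (T b)" for b by (simp add: T_def lin_ext)
  have TQ: "T b (basis i) \<in> coord_space (Q 2 i b)" if "i \<in> U b" for b i
    using kkQ[of i "?b i" b] that by (simp add: T_def U_def)
  have T_diff: "T b x = T a x + kk a b x" if "a \<le> b" "x \<in> coord_space (U a)" for a b x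
  proof (rule lin_eq[OF lin_T lin_plus[OF lin_T lin_kk] _ that(2)])
    fix i assume "i \<in> U a"
    then show "T b (basis i) = T a (basis i) + kk a b (basis i)"
      using kk_add[of "?b i" a b] that(1) by (simp add: T_def U_def)
  qed
  \<comment> \<open>The first term respects the \<open>j\<close>-th filtration and the second one
    corrects it to a contraction. On each \<open>U b\<close> both produce the same correction
    \<open>R b\<close>, which cancels (\<open>H1\<close>, \<open>H2\<close>) and leaves
    \<open>H = h b + D T b - T b D\<close>. The added commutator does not change
    \<open>D H + H D\<close>, so \<open>H\<close> contracts because \<open>h b\<close> does.\<close>
  define H where "H = ext (\<lambda>i. h (?b i) (basis i) - T (?b i) (D (basis i)))"
  define R where "R b = ext (\<lambda>i. kk (?b i) b (D (basis i)))" for b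
  have lin_R: "lin (R b)" for b by (simp add: R_def lin_ext)
  have DbU: "D (basis i) \<in> coord_space (U (?b i))" if "low i" for i
    using DQ[OF that] QU by (rule coord_space_mono)
  have H1: "ext (\<lambda>i. h (?b i) (basis i)) x = h b x + D (T b x) - R b x" if "x \<in> coord_space (U b)" for x b
  proof (rule lin_eq[OF lin_ext lin_minus[OF lin_plus[OF lin_h lin_comp[OF lin_T lin_D]] lin_R] _ that])
    fix i assume i: "i \<in> U b"
    have "basis i \<in> coord_space (U (?b i))" using i by (simp add: U_def)
    from Dkk[OF _ this, of b] i
    show "ext (\<lambda>i. h (?b i) (basis i)) (basis i) = h b (basis i) + D (T b (basis i)) - R b (basis i)"
      by (simp add: T_def R_def U_def algebra_simps)
  qed
  have H2: "ext (\<lambda>i. T (?b i) (D (basis i))) x = T b (D x) - R b x" if "x \<in> coord_space (U b)" for x b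
  proof (rule lin_eq[OF lin_ext lin_minus[OF lin_comp[OF lin_D lin_T] lin_R] _ that])
    fix i assume i: "i \<in> U b"
    then show "ext (\<lambda>i. T (?b i) (D (basis i))) (basis i) = T b (D (basis i)) - R b (basis i)"
      using T_diff[OF _ DbU, of i b] by (simp add: R_def U_def)
  qed
  have H: "H x = ext (\<lambda>i. h (?b i) (basis i)) x - ext (\<lambda>i. T (?b i) (D (basis i))) x" for x
  proof (rule lin_eq[OF _ lin_minus[OF lin_ext lin_ext], of _ UNIV])
    show "lin H" by (simp add: H_def lin_ext)
  qed (simp_all add: H_def coord_space_def)
  have "partial_contraction j0 (insert j J) z H" unfolding partial_contraction_def
  proof (intro conjI ballI impI)
    show "lin H" by (simp add: H_def lin_ext)
    fix i assume "i \<in> gens X" "\<forall>l. l \<notin> insert j J \<longrightarrow> mdeg X i $ l \<le> z $ l"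
    then have i: "low i" by (simp add: low_def)
    then have iU: "i \<in> U (?b i)" by (simp add: U_def)
    have "T (?b i) (D (basis i)) \<in> coord_space (Q (- 1 + 2) i (?b i))"
      by (rule mapQ[OF lin_T DQ[OF i] TQ])
    then have "H (basis i) \<in> coord_space (Q 1 i (?b i))"
      using hQ[OF iU] by (simp add: H_def coord_space_diff)
    then show "H (basis i) \<in> coord_space {k \<in> gens X. gdeg X k = gdeg X i + 1 \<and>
        (\<forall>l. l \<notin> insert j J \<longrightarrow> mdeg X k $ l \<le> z $ l) \<and> (\<forall>l\<in>insert j J - {j0}. mdeg X k $ l \<le> mdeg X i $ l)}"
      by (rule coord_space_mono) (use j0 j in \<open>auto simp: Q_def low_def\<close>)
    have "D (D (basis i)) = 0" using i D_D_basis by (simp add: low_def)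
    then have "H (D (basis i)) = h (?b i) (D (basis i)) + D (T (?b i) (D (basis i)))"
      unfolding H H1[OF DbU[OF i]] H2[OF DbU[OF i]] by (simp add: lin_zero[OF lin_T])
    moreover have "D (H (basis i)) = D (h (?b i) (basis i)) - D (T (?b i) (D (basis i)))"
      by (simp add: H_def lin_diff[OF lin_D])
    ultimately show "D (H (basis i)) + H (D (basis i)) = basis i" using Dh[OF iU] by simp
  qed
  then show ?thesis by blast
qed

lemma contraction_exists:
  assumes acyclic: "\<And>d z x. x \<in> coord_space (below X {j} d z) \<Longrightarrow> D x = 0 \<Longrightarrow>
      \<exists>y\<in>coord_space (below X {j} (d + 1) z). D y = x"
  shows "\<exists>h. contraction j h"
proof -
  have "\<exists>h. partial_contraction j (insert j J) z h" if "finite J" for J z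
    using that
  proof (induction J arbitrary: z rule: finite_induct)
    case empty
    show ?case by (rule partial_contraction_base) (rule acyclic)
  next
    case (insert l J)
    show ?case
    proof (cases "l = j")
      case False
      then have "\<exists>h. partial_contraction j (insert l (insert j J)) z h"
        using insert by (intro partial_contraction_step[of j "insert j J" l]) auto
      then show ?thesis by (simp add: insert_commute)
    qed (use insert in simp)
  qed
  \<comment> \<open>For \<open>J = UNIV\<close> no coordinate is bounded by the grade any more, so
    the grade 0 is an arbitrary choice.\<close>
  from this[of UNIV 0] obtain h where "partial_contraction j UNIV 0 h" by auto
  then have "contraction j h"
    unfolding contraction_def partial_contraction_def filt_map_def below_def
    by (auto elim!: coord_space_mono)
  then show ?thesis by blast
qed

end

subsection \<open>Iterated contractions\<close>

definition sg :: "nat \<Rightarrow> 'a::ab_group_add \<Rightarrow> 'a" where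
  "sg n x = (if even n then x else - x)"

lemma sg_Suc [simp]: "sg (Suc n) x = - sg n x" and sg_0 [simp]: "sg 0 x = x"
  by (auto simp: sg_def)

lemma sg_sg [simp]: "sg n (sg n x) = x"
  by (simp add: sg_def)

lemma sg_add: "sg n (x + y) = sg n x + sg n y" and sg_uminus: "sg n (- x) = - sg n x"
  and sg_diff: "sg n (x - y) = sg n x - sg n y" and sg_zero [simp]: "sg n 0 = 0"
  by (auto simp: sg_def)

lemma lin_sg: "lin f \<Longrightarrow> f (sg n x) = sg n (f x)"
  by (simp add: sg_def lin_uminus)

lemma lin_sg': "lin f \<Longrightarrow> lin (\<lambda>x. sg n (f x))"
  by (cases "even n") (simp_all add: sg_def lin_neg)

primrec hcomp :: "('n \<Rightarrow> 'a \<Rightarrow> 'a) \<Rightarrow> 'n list \<Rightarrow> 'a \<Rightarrow> 'a" where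
  "hcomp h [] = (\<lambda>x. x)"
| "hcomp h (j # js) = (\<lambda>x. h j (hcomp h js x))"

lemma filt_null_cong:
  assumes "filt_null X Y S m T" "lin T'" "\<And>i. i \<in> gens X \<Longrightarrow> T' (basis i) = T (basis i)"
  shows "filt_null X Y S m T'"
  using assms by (simp add: filt_null_def)

lemma filt_map_gens:
  assumes T: "filt_map X Y S m T" and x: "x \<in> coord_space (gens X)"
  shows "T x \<in> coord_space (gens Y)"
proof (rule lin_into[OF filt_mapD(1)[OF T] _ x])
  fix i assume "i \<in> gens X"
  then have "T (basis i) \<in> coord_space (below Y S (gdeg X i + m) (mdeg X i))"
    using T by (simp add: filt_map_def)
  then show "T (basis i) \<in> coord_space (gens Y)"
    by (rule coord_space_mono) (auto simp: below_def)
qed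

text \<open>The subquotients compared by one contraction: its source and target, modulo smaller grades, are
  the sub- and quotient object of \<open>below X (insert j S)\<close> modulo \<open>below_mid X S j\<close>, which the
  contraction preserves.\<close>

definition below_mid :: "('i, 'n::finite) index \<Rightarrow> 'n set \<Rightarrow> 'n \<Rightarrow> int \<Rightarrow> int ^ 'n \<Rightarrow> 'i set" where
  "below_mid X S j d z = {i \<in> below X (insert j S) d z. \<exists>l\<in>S. mdeg X i $ l \<le> z $ l}"

text \<open>\<open>R \<subseteq> {j}\<close> covers the differential (\<open>R = {}\<close>) and the
  contraction (\<open>R = {j}\<close>). The coordinate witnessing smallness lies in
  \<open>S\<close>, hence differs from \<open>j\<close> and is respected by both.\<close>

lemma below_mid_map:
  assumes T: "filt_map X Y R m T" and R: "R \<subseteq> {j}" and j: "j \<notin> S"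
    and x: "x \<in> coord_space (below_mid X S j d z)"
  shows "T x \<in> coord_space (below_mid Y S j (d + m) z)"
proof (rule lin_into[OF filt_mapD(1)[OF T] _ x])
  fix i assume i: "i \<in> below_mid X S j d z"
  then obtain l where l: "l \<in> S" "mdeg X i $ l \<le> z $ l" and ib: "i \<in> below X (insert j S) d z"
    by (auto simp: below_mid_def)
  have "below Y R (gdeg X i + m) (mdeg X i) \<subseteq> below_mid Y S j (d + m) z"
  proof
    fix k assume k: "k \<in> below Y R (gdeg X i + m) (mdeg X i)"
    have "R \<union> insert j S = insert j S" using R by auto
    then have "k \<in> below Y (insert j S) (d + m) z" using below_trans[OF k ib] by simp
    moreover have "l \<notin> R" using l R j by auto
    then have "mdeg Y k $ l \<le> z $ l" using k l by (auto simp: below_def intro: order_trans)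
    ultimately show "k \<in> below_mid Y S j (d + m) z" using l unfolding below_mid_def by blast
  qed
  moreover have "T (basis i) \<in> coord_space (below Y R (gdeg X i + m) (mdeg X i))"
    using T below_gens(1)[OF ib] by (simp add: filt_map_def)
  ultimately show "T (basis i) \<in> coord_space (below_mid Y S j (d + m) z)"
    by (auto intro: coord_space_mono)
qed

text \<open>Together with \<open>below_mid_Int\<close> this is the second isomorphism theorem in
  terms of index sets: the subquotient for \<open>S\<close> embeds into
  \<open>below X (insert j S)\<close> modulo \<open>below_mid X S j\<close>, and the cokernel is the
  subquotient for \<open>insert j S\<close>.\<close>

lemma below_mid_Un: "j \<notin> S \<Longrightarrow> below_smaller X (insert j S) d z = below_mid X S j d z \<union> below X S d z"
  unfolding below_mid_def below_smaller_def below_def by (rule set_eqI) (auto; blast)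

lemma below_mid_Int: "j \<notin> S \<Longrightarrow> below_mid X S j d z \<inter> below X S d z = below_smaller X S d z"
  unfolding below_mid_def below_smaller_def below_def by blast

lemma below_smaller_mid: "below_smaller X S d z \<subseteq> below_mid X S j d z"
  unfolding below_mid_def below_smaller_def below_def by blast

section \<open>Homology of the subquotients under a single contraction\<close>

context filtered_complex
begin

text \<open>\<open>cyc\<close> and \<open>bd\<close> are the preimages, in the complex itself, of
  the cycles and boundaries of the quotient of \<open>below\<close> by \<open>below_smaller\<close>.
  Working with preimages avoids quotient spaces.\<close>

definition cyc :: "'n set \<Rightarrow> int \<Rightarrow> int ^ 'n \<Rightarrow> ('i \<Rightarrow>\<^sub>0 'k) set" where
  "cyc S d z = {x \<in> coord_space (below X S d z). D x \<in> coord_space (below_smaller X S (d - 1) z)}"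

definition bd :: "'n set \<Rightarrow> int \<Rightarrow> int ^ 'n \<Rightarrow> ('i \<Rightarrow>\<^sub>0 'k) set" where
  "bd S d z = {x. \<exists>y\<in>coord_space (below X S (d + 1) z). x - D y \<in> coord_space (below_smaller X S d z)}"

lemma bdI: "y \<in> coord_space (below X S (d + 1) z) \<Longrightarrow> u \<in> coord_space (below_smaller X S d z) \<Longrightarrow>
    x = D y + u \<Longrightarrow> x \<in> bd S d z"
  unfolding bd_def by (intro CollectI bexI[of _ y]) simp_all

lemma bd_add: "x \<in> bd S d z \<Longrightarrow> x' \<in> bd S d z \<Longrightarrow> x + x' \<in> bd S d z"
proof -
  assume "x \<in> bd S d z" "x' \<in> bd S d z"
  then obtain y y' where y: "y \<in> coord_space (below X S (d + 1) z)" "x - D y \<in> coord_space (below_smaller X S d z)"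
    "y' \<in> coord_space (below X S (d + 1) z)" "x' - D y' \<in> coord_space (below_smaller X S d z)"
    by (auto simp: bd_def)
  show ?thesis
    by (rule bdI[OF coord_space_add[OF y(1,3)] coord_space_add[OF y(2,4)]]) (simp add: lin_add[OF lin_D])
qed

lemma contraction_eq:
  assumes "contraction j h" "x \<in> coord_space (gens X)"
  shows "D (h x) = x - h (D x)" "h (D x) = x - D (h x)"
proof -
  have h: "lin h" using assms(1) by (simp add: contraction_def filt_map_def)
  have "D (h x) + h (D x) = x"
    by (rule lin_eq[OF lin_plus[OF lin_comp[OF h lin_D] lin_comp[OF lin_D h]] lin_id _ assms(2)])
      (use assms(1) in \<open>simp add: contraction_def\<close>)
  then show "D (h x) = x - h (D x)" "h (D x) = x - D (h x)" by (simp_all add: algebra_simps)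
qed

lemma below_in_gens: "x \<in> coord_space (below X S d z) \<Longrightarrow> x \<in> coord_space (gens X)"
  by (rule coord_space_mono) (auto simp: below_def)

context
  fixes j h S
  assumes h: "contraction j h" and j: "j \<notin> S"
begin

lemma filt_h: "filt_map X X {j} 1 h"
  using h by (simp add: contraction_def)

lemma h_below: "x \<in> coord_space (below X S d z) \<Longrightarrow> h x \<in> coord_space (below X (insert j S) (d + 1) z)"
  using filt_map_below[OF filt_h] by fastforce

lemma h_below': "x \<in> coord_space (below X (insert j S) d z) \<Longrightarrow> h x \<in> coord_space (below X (insert j S) (d + 1) z)"
  using filt_map_below[OF filt_h, of x "insert j S"] by simp

lemma h_smaller: "x \<in> coord_space (below_smaller X S d z) \<Longrightarrow>
    h x \<in> coord_space (below_smaller X (insert j S) (d + 1) z)"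
  using filt_map_below_smaller[OF filt_h, of x S] j by simp

lemma h_mid: "x \<in> coord_space (below_mid X S j d z) \<Longrightarrow> h x \<in> coord_space (below_mid X S j (d + 1) z)"
  by (rule below_mid_map[OF filt_h _ j]) auto

lemma D_mid: "x \<in> coord_space (below_mid X S j d z) \<Longrightarrow> D x \<in> coord_space (below_mid X S j (d - 1) z)"
  using below_mid_map[OF filt_D _ j] by fastforce

lemma lin_h: "lin h"
  using filt_h by (simp add: filt_map_def)

text \<open>In \<open>D (h x) = x - h (D x)\<close> both terms are small for
  \<open>insert j S\<close>: \<open>x\<close> because its \<open>j\<close>-th coordinate is still at
  most that of \<open>z\<close>, and \<open>h (D x)\<close> because \<open>h\<close> sends small
  elements to small ones.\<close>

lemma contraction_cyc:
  assumes "x \<in> cyc S d z"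
  shows "h x \<in> cyc (insert j S) (d + 1) z"
proof -
  have x: "x \<in> coord_space (below X S d z)" and Dx: "D x \<in> coord_space (below_smaller X S (d - 1) z)"
    using assms by (auto simp: cyc_def)
  have "x \<in> coord_space (below_smaller X (insert j S) d z)"
    using x by (rule coord_space_mono) (simp add: below_mid_Un[OF j])
  moreover have "h (D x) \<in> coord_space (below_smaller X (insert j S) d z)"
    using h_smaller[OF Dx] by simp
  ultimately show ?thesis
    using h_below[OF x] contraction_eq(1)[OF h below_in_gens[OF x]] by (simp add: cyc_def coord_space_diff)
qed

lemma contraction_bd:
  assumes "x \<in> bd S d z"
  shows "h x \<in> bd (insert j S) (d + 1) z"
proof -
  obtain y where y: "y \<in> coord_space (below X S (d + 1) z)" "x - D y \<in> coord_space (below_smaller X S d z)"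
    using assms by (auto simp: bd_def)
  have "h x = h (D y + (x - D y))" by simp
  also have "\<dots> = D (- h y) + (y + h (x - D y))"
    by (simp only: lin_add[OF lin_h] contraction_eq(2)[OF h below_in_gens[OF y(1)]] lin_uminus[OF lin_D])
      (simp add: algebra_simps)
  finally have *: "h x = D (- h y) + (y + h (x - D y))" .
  have "y \<in> coord_space (below_smaller X (insert j S) (d + 1) z)"
    using y(1) by (rule coord_space_mono) (simp add: below_mid_Un[OF j])
  then show ?thesis
    by (intro bdI[OF coord_space_uminus[OF h_below[OF y(1)]] _ *] coord_space_add h_smaller y(2))
qed

text \<open>Splitting \<open>h x - D b\<close> into a part \<open>u\<close> in the middle term and a
  part \<open>v\<close> in \<open>below X S\<close> and applying \<open>D\<close> gives
  \<open>x - D v = D u + h (D x)\<close>. The left side lies in \<open>below X S\<close> and the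
  right side in \<open>below_mid X S j\<close>, so it lies in their intersection and is
  small.\<close>

lemma contraction_inj:
  assumes x: "x \<in> cyc S d z" and hx: "h x \<in> bd (insert j S) (d + 1) z"
  shows "x \<in> bd S d z"
proof -
  have xb: "x \<in> coord_space (below X S d z)" and Dx: "D x \<in> coord_space (below_smaller X S (d - 1) z)"
    using x by (auto simp: cyc_def)
  obtain b where b: "b \<in> coord_space (below X (insert j S) (d + 1 + 1) z)"
    "h x - D b \<in> coord_space (below_smaller X (insert j S) (d + 1) z)"
    using hx by (auto simp: bd_def)
  obtain u v where u: "u \<in> coord_space (below_mid X S j (d + 1) z)"
    and v: "v \<in> coord_space (below X S (d + 1) z)" and uv: "h x - D b = u + v"
    using b(2) unfolding below_mid_Un[OF j] by (rule coord_space_Un)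
  have "D (h x - D b) = D (u + v)" by (simp add: uv)
  then have "D (h x) = D u + D v"
    by (simp add: lin_simps[OF lin_D] D_D[OF below_in_gens[OF b(1)]])
  then have "x - D v = D u + h (D x)"
    using contraction_eq(1)[OF h below_in_gens[OF xb]] by (simp add: algebra_simps)
  moreover have "D u \<in> coord_space (below_mid X S j d z)" using D_mid[OF u] by simp
  moreover have "h (D x) \<in> coord_space (below_mid X S j d z)"
    using h_mid[OF coord_space_mono[OF Dx below_smaller_mid]] by simp
  ultimately have 1: "x - D v \<in> coord_space (below_mid X S j d z)" by (simp add: coord_space_add)
  have 2: "x - D v \<in> coord_space (below X S d z)" using xb D_below[OF v] by (simp add: coord_space_diff)
  have "x - D v \<in> coord_space (below_smaller X S d z)"
    using coord_space_Int[OF 1 2] by (simp add: below_mid_Int[OF j])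
  then show ?thesis using v by (auto simp: bd_def)
qed

text \<open>The preimage is the connecting map, up to small elements: split
  \<open>D b = u + v\<close> along \<open>below_mid X S j\<close> and \<open>below X S\<close> and
  take \<open>v\<close>. Then \<open>b - h v = D (h b) + h u\<close>, where \<open>h u\<close> is
  small since \<open>h\<close> preserves the middle term.\<close>

lemma contraction_surj:
  assumes b: "b \<in> cyc (insert j S) (d + 1) z"
  shows "\<exists>x\<in>cyc S d z. b - h x \<in> bd (insert j S) (d + 1) z"
proof -
  have bb: "b \<in> coord_space (below X (insert j S) (d + 1) z)"
    and "D b \<in> coord_space (below_smaller X (insert j S) d z)"
    using b by (auto simp: cyc_def)
  then obtain u v where u: "u \<in> coord_space (below_mid X S j d z)"
    and v: "v \<in> coord_space (below X S d z)" and uv: "D b = u + v"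
    unfolding below_mid_Un[OF j] by (elim coord_space_Un)
  have "D u + D v = 0" using D_D[OF below_in_gens[OF bb]] uv by (simp add: lin_simps[OF lin_D])
  then have Dv: "D v = - D u" by (simp add: eq_neg_iff_add_eq_0 add.commute)
  have "D v \<in> coord_space (below_mid X S j (d - 1) z)" unfolding Dv using D_mid[OF u] by (rule coord_space_uminus)
  from coord_space_Int[OF this D_below[OF v]] have "v \<in> cyc S d z"
    using v by (simp add: below_mid_Int[OF j] cyc_def)
  moreover have "b - h v = D (h b) + h u"
    using contraction_eq(1)[OF h below_in_gens[OF bb]] by (simp add: uv lin_add[OF lin_h])
  then have "b - h v \<in> bd (insert j S) (d + 1) z"
  proof (rule bdI[rotated 2])
    show "h b \<in> coord_space (below X (insert j S) (d + 1 + 1) z)" by (rule h_below'[OF bb])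
    show "h u \<in> coord_space (below_smaller X (insert j S) (d + 1) z)"
      unfolding below_mid_Un[OF j] by (rule coord_space_mono[OF h_mid[OF u]]) simp
  qed
  ultimately show ?thesis by blast
qed

end

section \<open>Composites of contractions in distinct coordinates\<close>

context
  fixes h assumes h: "\<And>j. contraction j (h j)"
begin

lemma filt_hcomp: "filt_map X X (set js) (int (length js)) (hcomp h js)"
proof (induction js)
  case (Cons j js)
  have "filt_map X X {j} 1 (h j)" using h by (simp add: contraction_def)
  from filt_map_comp[OF Cons this] show ?case by (simp add: add.commute)
qed (simp add: filt_map_id)

lemma lin_hcomp: "lin (hcomp h js)"
  using filt_hcomp by (simp add: filt_map_def)

text \<open>Inductively \<open>D (h j (H x)) = H x - h j (D (H x))\<close>. The extra term
  \<open>H x\<close> is null because \<open>H\<close> still respects the coordinate \<open>j\<close>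
  (\<open>filt_map_imp_null\<close>), so up to null maps each new factor anticommutes with
  \<open>D\<close> and contributes one sign.\<close>

lemma D_hcomp:
  "distinct js \<Longrightarrow> filt_null X X (set js) (int (length js) - 1)
    (\<lambda>x. D (hcomp h js x) - sg (length js) (hcomp h js (D x)))"
proof (induction js)
  case Nil
  then show ?case by (simp add: filt_null_def lin_const_zero)
next
  case (Cons j js)
  let ?H = "hcomp h js" and ?n = "length js"
  let ?N = "\<lambda>x. D (?H x) - sg ?n (?H (D x))"
  have lh: "lin (h j)" using h by (simp add: contraction_def filt_map_def)
  have j: "j \<notin> set js" and N: "filt_null X X (set js) (int ?n - 1) ?N" using Cons by auto
  have fh: "filt_map X X {j} 1 (h j)" using h by (simp add: contraction_def)
  have "filt_null X X (set (j # js)) (int ?n) (\<lambda>x. ?H x - h j (?N x))"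
  proof (rule filt_null_minus)
    show "filt_null X X (set (j # js)) (int ?n) ?H" by (rule filt_map_imp_null[OF filt_hcomp]) (use j in auto)
    show "filt_null X X (set (j # js)) (int ?n) (\<lambda>x. h j (?N x))"
      using filt_map_null_comp[OF N fh] j by simp
  qed
  then have "filt_null X X (set (j # js)) (int (length (j # js)) - 1) (\<lambda>x. ?H x - h j (?N x))" by simp
  then show ?case
  proof (rule filt_null_cong)
    show "lin (\<lambda>x. D (hcomp h (j # js) x) - sg (length (j # js)) (hcomp h (j # js) (D x)))"
      by (intro lin_minus lin_sg' lin_comp[OF lin_hcomp lin_D] lin_comp[OF lin_D lin_hcomp])
    fix i assume "i \<in> gens X"
    then have "?H (basis i) \<in> coord_space (gens X)" by (intro filt_map_gens[OF filt_hcomp]) simp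
    from contraction_eq(1)[OF h this, of j]
    show "D (hcomp h (j # js) (basis i)) - sg (length (j # js)) (hcomp h (j # js) (D (basis i))) =
      ?H (basis i) - h j (?N (basis i))"
      by (simp add: lin_diff[OF lh] lin_sg[OF lh])
  qed
qed

lemma hcomp_cyc: "distinct js \<Longrightarrow> set js \<inter> S = {} \<Longrightarrow> x \<in> cyc S d z \<Longrightarrow>
    hcomp h js x \<in> cyc (set js \<union> S) (d + int (length js)) z"
proof (induction js)
  case (Cons j js)
  then have "hcomp h js x \<in> cyc (set js \<union> S) (d + int (length js)) z" by auto
  from contraction_cyc[OF h _ this, of j] Cons(2,3) show ?case by (simp add: algebra_simps)
qed simp

lemma hcomp_inj: "distinct js \<Longrightarrow> set js \<inter> S = {} \<Longrightarrow> x \<in> cyc S d z \<Longrightarrow>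
    hcomp h js x \<in> bd (set js \<union> S) (d + int (length js)) z \<Longrightarrow> x \<in> bd S d z"
proof (induction js)
  case (Cons j js)
  then have c: "hcomp h js x \<in> cyc (set js \<union> S) (d + int (length js)) z" by (intro hcomp_cyc) auto
  have "hcomp h js x \<in> bd (set js \<union> S) (d + int (length js)) z"
    by (rule contraction_inj[OF h _ c, of j]) (use Cons(2-) in \<open>auto simp: algebra_simps\<close>)
  then show ?case using Cons by auto
qed simp

lemma hcomp_surj: "distinct js \<Longrightarrow> set js \<inter> S = {} \<Longrightarrow> b \<in> cyc (set js \<union> S) (d + int (length js)) z \<Longrightarrow>
    \<exists>x\<in>cyc S d z. b - hcomp h js x \<in> bd (set js \<union> S) (d + int (length js)) z"
proof (induction js arbitrary: b)
  case Nil
  have "b - b \<in> bd S d z" by (rule bdI[of 0 _ _ _ 0]) (simp_all add: lin_zero[OF lin_D])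
  then show ?case using Nil by (intro bexI[of _ b]) simp_all
next
  case (Cons j js)
  let ?S = "set js \<union> S" and ?d = "d + int (length js)"
  have j: "j \<notin> ?S" using Cons by auto
  have "b \<in> cyc (insert j ?S) (?d + 1) z" using Cons(4) by (simp add: algebra_simps)
  from contraction_surj[OF h j this] obtain y where y: "y \<in> cyc ?S ?d z" "b - h j y \<in> bd (insert j ?S) (?d + 1) z"
    by blast
  obtain x where x: "x \<in> cyc S d z" "y - hcomp h js x \<in> bd ?S ?d z" using Cons(1)[OF _ _ y(1)] Cons(2,3) by auto
  have lh: "lin (h j)" using h by (simp add: contraction_def filt_map_def)
  have "h j (y - hcomp h js x) \<in> bd (insert j ?S) (?d + 1) z" by (rule contraction_bd[OF h j x(2)])
  from bd_add[OF y(2) this] have "b - hcomp h (j # js) x \<in> bd (insert j ?S) (?d + 1) z"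
    by (simp add: lin_diff[OF lh])
  then show ?case using x(1) by (auto simp: algebra_simps)
qed

end

end

text \<open>Naturality up to homotopy: exchanging \<open>f\<close> with one contraction costs the homotopy \<open>g j \<circ> f \<circ> h j\<close>.\<close>

lemma hcomp_homotopy:
  fixes X :: "('i, 'n::finite) index" and Y :: "('j, 'n) index" and D :: "('i \<Rightarrow>\<^sub>0 'k::field) \<Rightarrow> ('i \<Rightarrow>\<^sub>0 'k)"
  assumes D: "filtered_complex X D" and E: "filtered_complex Y E"
    and h: "\<And>j. filtered_complex.contraction X D j (h j)"
    and g: "\<And>j. filtered_complex.contraction Y E j (g j)"
    and f: "filt_map X Y {} 0 f" and fD: "\<And>i. i \<in> gens X \<Longrightarrow> E (f (basis i)) = f (D (basis i))"
  shows "distinct js \<Longrightarrow> \<exists>K. filt_map X Y (set js) (int (length js) + 1) K \<and>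
    filt_null X Y (set js) (int (length js))
      (\<lambda>x. hcomp g js (f x) - f (hcomp h js x) - (E (K x) + sg (length js) (K (D x))))"
proof (induction js)
  case Nil
  have "lin E" using E by (simp add: filtered_complex.lin_D)
  then show ?case
    by (auto simp: filt_map_def filt_null_def lin_const_zero lin_zero intro!: exI[of _ "\<lambda>x. 0"])
next
  case (Cons j js)
  interpret X: filtered_complex X D by fact
  interpret Y: filtered_complex Y E by fact
  let ?n = "length js" and ?F = "hcomp h js" and ?G = "hcomp g js"
  have lf: "lin f" using f by (simp add: filt_map_def)
  have lh: "lin (h j)" for j using h[of j] by (simp add: X.contraction_def filt_map_def)
  have lg: "lin (g j)" for j using g[of j] by (simp add: Y.contraction_def filt_map_def)
  note lE = Y.lin_D and lD = X.lin_D
  have j: "j \<notin> set js" using Cons by auto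
  obtain K where K: "filt_map X Y (set js) (int ?n + 1) K" and
    N: "filt_null X Y (set js) (int ?n) (\<lambda>x. ?G (f x) - f (?F x) - (E (K x) + sg ?n (K (D x))))"
    (is "filt_null _ _ _ _ ?N") using Cons by auto
  have lK: "lin K" using K by (simp add: filt_map_def)
  let ?M = "\<lambda>x. D (?F x) - sg ?n (?F (D x))"
  have M: "filt_null X X (set js) (int ?n - 1) ?M" by (rule X.D_hcomp[OF h]) (use Cons in auto)
  define k where "k = (\<lambda>x. g j (f (h j x)))"
  have fg: "filt_map Y Y {j} 1 (g j)" using g by (simp add: Y.contraction_def)
  have fh: "filt_map X X {j} 1 (h j)" using h by (simp add: X.contraction_def)
  have k: "filt_map X Y {j} 2 k"
    using filt_map_comp[OF filt_map_comp[OF fh f] fg] by (simp add: k_def)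
  have lk: "lin k" using k by (simp add: filt_map_def)
  have fD': "E (f x) = f (D x)" if "x \<in> coord_space (gens X)" for x
    by (rule lin_eq[OF lin_comp[OF lf lE] lin_comp[OF lD lf] fD that])
  have fX: "?F x \<in> coord_space (gens X)" if "x \<in> coord_space (gens X)" for x
    by (rule filt_map_gens[OF X.filt_hcomp[OF h] that])
  have Ek: "g j (f y) - f (h j y) = - E (k y) + k (D y)" if y: "y \<in> coord_space (gens X)" for y
  proof -
    have hy: "h j y \<in> coord_space (gens X)" by (rule filt_map_gens[OF fh y])
    have "E (k y) = f (h j y) - g j (E (f (h j y)))"
      unfolding k_def by (rule Y.contraction_eq(1)[OF g filt_map_gens[OF f hy]])
    also have "E (f (h j y)) = f (D (h j y))" by (rule fD'[OF hy])
    also have "D (h j y) = y - h j (D y)" by (rule X.contraction_eq(1)[OF h y])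
    finally show ?thesis by (simp add: k_def lin_diff[OF lf] lin_diff[OF lg])
  qed
  \<comment> \<open>Obtained by applying \<open>g j\<close> to the inductive homotopy and exchanging
    \<open>g j\<close> and \<open>f\<close> by \<open>Ek\<close>. Moving \<open>E\<close> past
    \<open>g j\<close> leaves the bare term \<open>K\<close>, moving \<open>D\<close> past
    \<open>?F\<close> leaves \<open>k (?M x)\<close>, and the inductive error becomes
    \<open>g j (?N x)\<close>. All three are null, \<open>K\<close> because it still respects the
    coordinate \<open>j\<close>.\<close>
  define K' where "K' = (\<lambda>x. - (g j (K x) + k (?F x)))"
  have "filt_map X Y (set (j # js)) (int (length (j # js)) + 1) (\<lambda>x. g j (K x))"
    using filt_map_comp[OF K fg] by (simp add: algebra_simps)
  moreover have "filt_map X Y (set (j # js)) (int (length (j # js)) + 1) (\<lambda>x. k (?F x))"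
    using filt_map_comp[OF X.filt_hcomp[OF h] k, of js] by (simp add: algebra_simps)
  ultimately have K': "filt_map X Y (set (j # js)) (int (length (j # js)) + 1) K'"
    unfolding K'_def by (intro filt_map_neg filt_map_plus)
  have "filt_null X Y (set (j # js)) (int (length (j # js))) (\<lambda>x. k (?M x) + K x + g j (?N x))"
  proof (intro filt_null_plus)
    show "filt_null X Y (set (j # js)) (int (length (j # js))) (\<lambda>x. k (?M x))"
      using filt_map_null_comp[OF M k] j by (simp add: algebra_simps)
    show "filt_null X Y (set (j # js)) (int (length (j # js))) K"
      using filt_map_imp_null[OF K, of "set (j # js)" j] j by (auto simp: algebra_simps)
    show "filt_null X Y (set (j # js)) (int (length (j # js))) (\<lambda>x. g j (?N x))"
      using filt_map_null_comp[OF N fg] j by (simp add: algebra_simps)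
  qed
  then have "filt_null X Y (set (j # js)) (int (length (j # js)))
      (\<lambda>x. hcomp g (j # js) (f x) - f (hcomp h (j # js) x) - (E (K' x) + sg (length (j # js)) (K' (D x))))"
  proof (rule filt_null_cong)
    have lK': "lin K'" using K' by (simp add: filt_map_def)
    show "lin (\<lambda>x. hcomp g (j # js) (f x) - f (hcomp h (j # js) x) - (E (K' x) + sg (length (j # js)) (K' (D x))))"
      by (intro lin_minus lin_plus lin_sg' lin_comp[OF lf Y.lin_hcomp[OF g]] lin_comp[OF X.lin_hcomp[OF h] lf]
        lin_comp[OF lK' lE] lin_comp[OF lD lK'])
    fix i assume "i \<in> gens X"
    then have x: "basis i \<in> coord_space (gens X)" by simp
    let ?x = "basis i :: 'i \<Rightarrow>\<^sub>0 'k"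
    have 1: "g j (?G (f ?x)) = g j (f (?F ?x)) + g j (E (K ?x)) + sg ?n (g j (K (D ?x))) + g j (?N ?x)"
      by (simp add: lin_simps[OF lg] lin_sg[OF lg])
    have 2: "g j (f (?F ?x)) = f (h j (?F ?x)) - E (k (?F ?x)) + k (D (?F ?x))"
      using Ek[OF fX[OF x]] by (simp add: algebra_simps)
    have 3: "g j (E (K ?x)) = K ?x - E (g j (K ?x))"
      by (rule Y.contraction_eq(2)[OF g filt_map_gens[OF K x]])
    have 4: "k (D (?F ?x)) = sg ?n (k (?F (D ?x))) + k (?M ?x)"
      by (simp add: lin_simps[OF lk] lin_sg[OF lk])
    show "hcomp g (j # js) (f ?x) - f (hcomp h (j # js) ?x) - (E (K' ?x) + sg (length (j # js)) (K' (D ?x))) =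
      k (?M ?x) + K ?x + g j (?N ?x)"
      unfolding hcomp.simps 1 2 3 4 K'_def
      by (simp add: lin_simps[OF lE] sg_add sg_uminus sg_diff del: lin_simps(1)[OF lk])
  qed
  with K' show ?case by blast
qed

subsection \<open>Persistence modules\<close>

lemma pers_moduleD:
  assumes "pers_module s M"
  shows "module.subspace s (space M z)"
    "z \<le> w \<Longrightarrow> linear_on (space M z) s s (trans M z w)"
    "z \<le> w \<Longrightarrow> x \<in> space M z \<Longrightarrow> trans M z w x \<in> space M w"
    "x \<in> space M z \<Longrightarrow> trans M z z x = x"
    "z \<le> w \<Longrightarrow> w \<le> u \<Longrightarrow> x \<in> space M z \<Longrightarrow> trans M w u (trans M z w x) = trans M z u x"
  using assms by (simp_all add: pers_module_def image_subset_iff)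

lemma pers_module_closed:
  assumes "vector_space s" "pers_module s M"
  shows "0 \<in> space M z" "x \<in> space M z \<Longrightarrow> y \<in> space M z \<Longrightarrow> x + y \<in> space M z"
    "x \<in> space M z \<Longrightarrow> s c x \<in> space M z" "x \<in> space M z \<Longrightarrow> y \<in> space M z \<Longrightarrow> x - y \<in> space M z"
  using pers_moduleD(1)[OF assms(2), of z] subspace_minus[OF assms(1) pers_moduleD(1)[OF assms(2), of z]]
  by (auto simp: subspace_iff[OF assms(1)])

lemma pmod_homD:
  assumes "pmod_hom s t M N f"
  shows "linear_on (space M z) s t (f z)" "x \<in> space M z \<Longrightarrow> f z x \<in> space N z"
    "z \<le> w \<Longrightarrow> x \<in> space M z \<Longrightarrow> f w (trans M z w x) = trans N z w (f z x)"
  using assms by (simp_all add: pmod_hom_def image_subset_iff)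

lemma vec_add_le [simp]:
  fixes x y z :: "int ^ 'n"
  shows "z + x \<le> z + y \<longleftrightarrow> x \<le> y" "x + z \<le> y + z \<longleftrightarrow> x \<le> y" "- x \<le> - y \<longleftrightarrow> y \<le> x"
  by (simp_all add: less_eq_vec_def)

lemma pers_module_shift: "pers_module s M \<Longrightarrow> pers_module s (pmod_shift z M)"
  by (simp add: pers_module_def pmod_shift_def)

lemma pers_module_free_gen: "pers_module (*) (free_gen z :: ('n::finite, 'k::field) pmod)"
  unfolding pers_module_def free_gen_def linear_on_def
  by (auto simp: subspace_iff[OF vector_space_field] intro: order_trans)

lemma pmod_hom_comp:
  "pmod_hom s t M N f \<Longrightarrow> pmod_hom t u N P g \<Longrightarrow> pmod_hom s u M P (\<lambda>z x. g z (f z x))"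
  unfolding pmod_hom_def by (auto intro: linear_on_comp simp: image_subset_iff)

section \<open>Duals, internal Hom and the Nakayama functor\<close>

lemma subspace_dual: "module.subspace (fun_scale (*)) (space (dual s M) z)"
  unfolding subspace_iff[OF vector_space_fun[OF vector_space_field]]
  by (auto simp: dual_def linear_on_def fun_scale_def algebra_simps)

lemma pers_module_dual:
  fixes s :: "'k::field \<Rightarrow> 'v \<Rightarrow> 'v::ab_group_add" and M :: "('n::finite, 'v) pmod"
  assumes "vector_space s" "pers_module s M"
  shows "pers_module (fun_scale (*)) (dual s M)"
  unfolding pers_module_def
proof (intro conjI allI impI ballI)
  note M = pers_moduleD[OF assms(2)] pers_module_closed[OF assms]
  show "module.subspace (fun_scale (*)) (space (dual s M) z)" for z by (rule subspace_dual)
  fix z w :: "int ^ 'n" assume zw: "z \<le> w"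
  then have wz: "- w \<le> - z" by simp
  show "linear_on (space (dual s M) z) (fun_scale (*)) (fun_scale (*)) (trans (dual s M) z w)"
    by (auto simp: linear_on_def dual_def fun_scale_def fun_eq_iff)
  show "trans (dual s M) z w ` space (dual s M) z \<subseteq> space (dual s M) w"
    using linear_onD[OF M(2)[OF wz]] M(3)[OF wz] M(7,8)
    by (auto simp: dual_def linear_on_def)
  fix u x assume wu: "w \<le> u" and x: "x \<in> space (dual s M) z"
  then have "- u \<le> - w" by simp
  then show "trans (dual s M) w u (trans (dual s M) z w x) = trans (dual s M) z u x"
    using M(5)[OF _ wz] M(3) by (auto simp: dual_def fun_eq_iff)
next
  fix z x assume "x \<in> space (dual s M) z"
  then show "trans (dual s M) z z x = x"
    using pers_moduleD(4)[OF assms(2)] by (auto simp: dual_def fun_eq_iff)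
qed

lemma subspace_Hom:
  assumes "vector_space s" "vector_space t" "pers_module s M" "pers_module t N"
  shows "module.subspace (fun_scale (fun_scale t)) (space (Hom s t M N) z)"
proof -
  interpret t: vector_space t by fact
  note N = pers_module_closed[OF assms(2) pers_module_shift[OF assms(4)], where z1 = z]
  note L = pers_moduleD(2)[OF pers_module_shift[OF assms(4)], where z1 = z]
  have Z: "w \<le> u \<Longrightarrow> trans (pmod_shift z N) w u 0 = 0" for w u
    by (rule linear_on_zero[OF assms(2,2) pers_moduleD(1)[OF pers_module_shift[OF assms(4)]] L])
  show ?thesis
    unfolding subspace_iff[OF vector_space_fun[OF vector_space_fun[OF assms(2)]]]
    using N linear_onD[OF L] Z
    by (auto simp: Hom_def pmod_hom_def linear_on_def fun_scale_def image_subset_iff algebra_simps)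
qed

lemma pers_module_Hom:
  fixes s :: "'k::field \<Rightarrow> 'v \<Rightarrow> 'v::ab_group_add" and t :: "'k \<Rightarrow> 'w \<Rightarrow> 'w::ab_group_add"
    and M :: "('n::finite, 'v) pmod" and N :: "('n, 'w) pmod"
  assumes "vector_space s" "vector_space t" "pers_module s M" "pers_module t N"
  shows "pers_module (fun_scale (fun_scale t)) (Hom s t M N)"
  unfolding pers_module_def
proof (intro conjI allI impI ballI)
  interpret t: vector_space t by fact
  note M = pers_moduleD[OF assms(3)] pers_module_closed[OF assms(1,3)]
  note N = pers_moduleD[OF assms(4)] pers_module_closed[OF assms(2,4)]
  show "module.subspace (fun_scale (fun_scale t)) (space (Hom s t M N) z)" for z
    by (rule subspace_Hom[OF assms])
  fix z w :: "int ^ 'n" assume zw: "z \<le> w"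
  then have zw': "z + u \<le> w + u" for u by simp
  show "linear_on (space (Hom s t M N) z) (fun_scale (fun_scale t)) (fun_scale (fun_scale t)) (trans (Hom s t M N) z w)"
    using linear_onD[OF N(2)[OF zw']]
    by (auto simp: linear_on_def Hom_def fun_scale_def fun_eq_iff pmod_hom_def pmod_shift_def image_subset_iff)
  show "trans (Hom s t M N) z w ` space (Hom s t M N) z \<subseteq> space (Hom s t M N) w"
  proof (rule image_subsetI)
    fix h assume "h \<in> space (Hom s t M N) z"
    then have h: "pmod_hom s t M (pmod_shift z N) h" by (simp add: Hom_def)
    note h = pmod_homD[OF h]
    have "pmod_hom s t M (pmod_shift w N) (trans (Hom s t M N) z w h)"
      unfolding pmod_hom_def
    proof (intro conjI allI impI ballI)
      fix u
      show "linear_on (space M u) s t (trans (Hom s t M N) z w h u)"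
        using linear_onD[OF h(1)] linear_onD[OF N(2)[OF zw']] h(2) M(7,8)
        by (auto simp: linear_on_def Hom_def pmod_shift_def)
      show "trans (Hom s t M N) z w h u ` space M u \<subseteq> space (pmod_shift w N) u"
        using h(2) N(3)[OF zw'] by (auto simp: Hom_def pmod_shift_def)
      fix v x assume uv: "u \<le> v" and x: "x \<in> space M u"
      have hx: "h u x \<in> space N (z + u)" using h(2)[OF x] by (simp add: pmod_shift_def)
      have "trans N (z + v) (w + v) (trans N (z + u) (z + v) (h u x)) =
          trans N (w + u) (w + v) (trans N (z + u) (w + u) (h u x))"
        using uv zw' hx by (simp add: N(5))
      then show "trans (Hom s t M N) z w h v (trans M u v x) =
          trans (pmod_shift w N) u v (trans (Hom s t M N) z w h u x)"
        using x M(3)[OF uv x] h(3)[OF uv x] by (simp add: Hom_def pmod_shift_def)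
    qed
    then show "trans (Hom s t M N) z w h \<in> space (Hom s t M N) w" by (auto simp: Hom_def)
  qed
  fix u h assume wu: "w \<le> u" and h: "h \<in> space (Hom s t M N) z"
  have "w + v \<le> u + v" for v using wu by simp
  then show "trans (Hom s t M N) w u (trans (Hom s t M N) z w h) = trans (Hom s t M N) z u h"
    using h zw' by (auto simp: Hom_def fun_eq_iff N(5) pmod_hom_def pmod_shift_def image_subset_iff)
next
  fix z h assume "h \<in> space (Hom s t M N) z"
  then show "trans (Hom s t M N) z z h = h"
    using pers_moduleD(4)[OF assms(4)]
    by (auto simp: Hom_def fun_eq_iff pmod_hom_def pmod_shift_def image_subset_iff)
qed

lemma Hom_precomp_space:
  assumes "vector_space s" "pers_module s M" "pmod_hom s s M M' f" "h \<in> space (Hom s t M' N) z"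
  shows "Hom_precomp M f h \<in> space (Hom s t M N) z"
proof -
  have h: "pmod_hom s t M' (pmod_shift z N) h" using assms(4) by (simp add: Hom_def)
  have "pmod_hom s t M (pmod_shift z N) (\<lambda>w x. h w (f w x))" by (rule pmod_hom_comp[OF assms(3) h])
  then have "pmod_hom s t M (pmod_shift z N) (Hom_precomp M f h)"
    using pers_moduleD(3)[OF assms(2)] pers_module_closed(2,3)[OF assms(1,2)]
    by (auto simp: pmod_hom_def Hom_precomp_def linear_on_def image_subset_iff)
  then show ?thesis by (auto simp: Hom_def Hom_precomp_def)
qed

abbreviation Hom_free :: "('k::field \<Rightarrow> 'v \<Rightarrow> 'v) \<Rightarrow> ('n::finite, 'v::ab_group_add) pmod \<Rightarrow> ('n, int ^ 'n \<Rightarrow> 'v \<Rightarrow> 'k) pmod"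
  where "Hom_free s M \<equiv> Hom s (*) M (free_gen 0)"

abbreviation hom_scale :: "'k::field \<Rightarrow> (int ^ 'n \<Rightarrow> 'v \<Rightarrow> 'k) \<Rightarrow> int ^ 'n \<Rightarrow> 'v \<Rightarrow> 'k" where
  "hom_scale \<equiv> fun_scale (fun_scale (*))"

lemma vector_space_hom_scale: "vector_space hom_scale"
  by (intro vector_space_fun vector_space_field)

lemma vector_space_nu_scale: "vector_space nu_scale"
  by (intro vector_space_fun vector_space_field)

lemma pers_module_Hom_free: "vector_space s \<Longrightarrow> pers_module s M \<Longrightarrow> pers_module hom_scale (Hom_free s M)"
  by (intro pers_module_Hom vector_space_field pers_module_free_gen)

lemma pers_module_nu: "vector_space s \<Longrightarrow> pers_module s M \<Longrightarrow> pers_module nu_scale (nu s M)"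
  unfolding nu_def by (intro pers_module_dual vector_space_hom_scale pers_module_Hom_free)

lemma nu_space: "\<phi> \<in> space (nu s M) z \<longleftrightarrow>
    linear_on (space (Hom_free s M) (- z)) hom_scale (*) \<phi> \<and> (\<forall>h. h \<notin> space (Hom_free s M) (- z) \<longrightarrow> \<phi> h = 0)"
  by (simp add: nu_def dual_def)

lemma nu_trans: "trans (nu s M) z w \<phi> =
    (\<lambda>h. if h \<in> space (Hom_free s M) (- w) then \<phi> (trans (Hom_free s M) (- w) (- z) h) else 0)"
  by (simp add: nu_def dual_def)

lemma nu_map_apply: "nu_map s M M' f z \<phi> =
    (\<lambda>h. if h \<in> space (Hom_free s M') (- z) then \<phi> (Hom_precomp M f h) else 0)"
  by (simp add: nu_map_def dual_map_def)

lemma pmod_hom_nu_map: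
  fixes s :: "'k::field \<Rightarrow> 'v \<Rightarrow> 'v::ab_group_add" and M M' :: "('n::finite, 'v) pmod"
  assumes s: "vector_space s" and M: "pers_module s M" and M': "pers_module s M'" and f: "pmod_hom s s M M' f"
  shows "pmod_hom nu_scale nu_scale (nu s M) (nu s M') (nu_map s M M' f)"
  unfolding pmod_hom_def
proof (intro conjI allI impI ballI)
  fix z
  note H = pers_module_closed[OF vector_space_hom_scale pers_module_Hom_free[OF s M']]
  have pre: "Hom_precomp M f h \<in> space (Hom_free s M) w" if "h \<in> space (Hom_free s M') w" for h w
    by (rule Hom_precomp_space[OF s M f that])
  show "linear_on (space (nu s M) z) nu_scale nu_scale (nu_map s M M' f z)"
    by (auto simp: linear_on_def nu_map_apply fun_scale_def fun_eq_iff)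
  show "nu_map s M M' f z ` space (nu s M) z \<subseteq> space (nu s M') z"
  proof (rule image_subsetI)
    fix \<phi> assume "\<phi> \<in> space (nu s M) z"
    then have \<phi>: "linear_on (space (Hom_free s M) (- z)) hom_scale (*) \<phi>" by (simp add: nu_space)
    have "Hom_precomp M f (h + h') = Hom_precomp M f h + Hom_precomp M f h'"
      "Hom_precomp M f (hom_scale c h) = hom_scale c (Hom_precomp M f h)" for c and h h' :: "int ^ 'n \<Rightarrow> 'v \<Rightarrow> 'k"
      by (auto simp: Hom_precomp_def fun_eq_iff fun_scale_def)
    then show "nu_map s M M' f z \<phi> \<in> space (nu s M') z"
      using linear_onD[OF \<phi>] H(2,3) pre by (simp add: nu_space nu_map_apply linear_on_def)
  qed
  fix w \<phi> assume zw: "z \<le> w" and \<phi>: "\<phi> \<in> space (nu s M) z"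
  have wz: "- w \<le> - z" using zw by simp
  have "Hom_precomp M f (trans (Hom_free s M') (- w) (- z) h) =
      trans (Hom_free s M) (- w) (- z) (Hom_precomp M f h)" for h
    using pmod_homD(2)[OF f] by (auto simp: Hom_precomp_def Hom_def fun_eq_iff)
  then show "nu_map s M M' f w (trans (nu s M) z w \<phi>) = trans (nu s M') z w (nu_map s M M' f z \<phi>)"
    using pers_moduleD(3)[OF pers_module_Hom_free[OF s M'] wz] pre
    by (intro HOL.ext) (simp add: nu_map_apply nu_trans)
qed

lemma nu_map_comp:
  fixes s :: "'k::field \<Rightarrow> 'v \<Rightarrow> 'v::ab_group_add" and M M' :: "('n::finite, 'v) pmod"
  assumes "vector_space s" "pers_module s M" "pers_module s M'" "pmod_hom s s M M' f" "pmod_hom s s M' M'' g"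
  shows "nu_map s M' M'' g z (nu_map s M M' f z \<phi>) = nu_map s M M'' (\<lambda>w x. g w (f w x)) z \<phi>"
proof -
  have "Hom_precomp M f (Hom_precomp M' g h) = Hom_precomp M (\<lambda>w x. g w (f w x)) h" for h :: "int ^ 'n \<Rightarrow> 'v \<Rightarrow> 'k"
    using pmod_homD(2)[OF assms(4)] by (auto simp: Hom_precomp_def fun_eq_iff)
  then show ?thesis
    using Hom_precomp_space[OF assms(1,3,5), where t = "(*)" and N = "free_gen 0"]
    by (intro HOL.ext) (simp add: nu_map_apply)
qed

lemma nu_map_cong:
  fixes s :: "'k::field \<Rightarrow> 'v \<Rightarrow> 'v::ab_group_add" and M M' :: "('n::finite, 'v) pmod"
  assumes "\<And>w x. x \<in> space M w \<Longrightarrow> f w x = g w x"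
  shows "nu_map s M M' f = nu_map s M M' g"
proof -
  have "Hom_precomp M f h = Hom_precomp M g h" for h :: "int ^ 'n \<Rightarrow> 'v \<Rightarrow> 'k"
    using assms by (auto simp: Hom_precomp_def fun_eq_iff)
  then show ?thesis by (intro HOL.ext) (simp add: nu_map_apply)
qed

lemma nu_map_zero:
  assumes "vector_space s" "pers_module s M'" "pers_module s M" "\<phi> \<in> space (nu s M) z"
  shows "nu_map s M M' (\<lambda>w x. 0) z \<phi> = 0"
proof -
  have "Hom_precomp M (\<lambda>w x. 0) h = 0" if h: "h \<in> space (Hom_free s M') (- z)" for h
  proof -
    have "pmod_hom s (*) M' (pmod_shift (- z) (free_gen 0)) h" using h by (simp add: Hom_def)
    then have "h w 0 = 0" for w
      using linear_on_zero[OF assms(1) vector_space_field pers_moduleD(1)[OF assms(2)]] pmod_homD(1) by blast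
    then show ?thesis by (auto simp: Hom_precomp_def fun_eq_iff)
  qed
  moreover have "\<phi> 0 = 0"
    using assms(4) linear_on_zero[OF vector_space_hom_scale vector_space_field
        pers_moduleD(1)[OF pers_module_Hom_free[OF assms(1,3)]]] unfolding nu_space by blast
  ultimately show ?thesis by (intro HOL.ext) (simp add: nu_map_apply)
qed

subsection \<open>Complexes\<close>

lemma complexD:
  assumes "complex s C"
  shows "pers_module s (obj C d)" "pmod_hom s s (obj C d) (obj C (d - 1)) (diff C d)"
    "x \<in> space (obj C d) z \<Longrightarrow> diff C (d - 1) z (diff C d z x) = 0"
  using assms by (simp_all add: complex_def)

lemma chain_mapD:
  assumes "chain_map s t C D f"
  shows "pmod_hom s t (obj C d) (obj D d) (f d)"
    "x \<in> space (obj C d) z \<Longrightarrow> f (d - 1) z (diff C d z x) = diff D d z (f d z x)"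
  using assms by (simp_all add: chain_map_def)

lemma equiv_homologous:
  assumes u: "vector_space u" "module.subspace u (boundaries E d z)"
  shows "equiv (cycles E d z) (homologous E d z)"
proof (rule equivI)
  note 0 = u(2)[unfolded subspace_iff[OF u(1)]] and B = subspace_minus[OF u]
  show "refl_on (cycles E d z) (homologous E d z)" using 0 by (auto simp: refl_on_def homologous_def)
  show "Relation.sym (homologous E d z)"
    using B[OF conjunct1[OF 0]] by (auto simp: Relation.sym_def homologous_def) (metis minus_diff_eq)
  show "Relation.trans (homologous E d z)"
    using 0 by (auto simp: Relation.trans_def homologous_def) (metis diff_add_cancel add_diff_eq)
  show "homologous E d z \<subseteq> cycles E d z \<times> cycles E d z" by (auto simp: homologous_def)
qed

text \<open>The induced map on classes is additive, so injectivity need only be tested on the class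
  of zero. All later quasi-isomorphisms are checked on cycles through this rule, without quotient
  sets.\<close>

lemma quasi_isoI:
  assumes s: "vector_space s" and t: "vector_space t" and C: "complex s C" and D: "complex t D"
    and f: "chain_map s t C D f"
    and inj: "\<And>d z x. x \<in> cycles C d z \<Longrightarrow> f d z x \<in> boundaries D d z \<Longrightarrow> x \<in> boundaries C d z"
    and surj: "\<And>d z y. y \<in> cycles D d z \<Longrightarrow> \<exists>x\<in>cycles C d z. y - f d z x \<in> boundaries D d z"
  shows "quasi_iso s t C D f"
  unfolding quasi_iso_def
proof (intro conjI allI f)
  fix d z
  have bdD: "module.subspace t (boundaries D d z)"
    unfolding boundaries_def
    using subspace_linear_image[OF t t pers_moduleD(1)[OF complexD(1)[OF D]]] pmod_homD(1)[OF complexD(2)[OF D]] by blast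
  have bdC: "module.subspace s (boundaries C d z)"
    unfolding boundaries_def
    using subspace_linear_image[OF s s pers_moduleD(1)[OF complexD(1)[OF C]]] pmod_homD(1)[OF complexD(2)[OF C]] by blast
  note eC = equiv_homologous[OF s bdC] and eD = equiv_homologous[OF t bdD]
  have fcyc: "f d z x \<in> cycles D d z" if "x \<in> cycles C d z" for x
  proof -
    have x: "x \<in> space (obj C d) z" "diff C d z x = 0" using that by (auto simp: cycles_def)
    have "f (d - 1) z 0 = 0"
      by (rule linear_on_zero[OF s t pers_moduleD(1)[OF complexD(1)[OF C]] pmod_homD(1)[OF chain_mapD(1)[OF f]]])
    then show ?thesis using chain_mapD(2)[OF f x(1)] pmod_homD(2)[OF chain_mapD(1)[OF f] x(1)] x(2)
      by (simp add: cycles_def)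
  qed
  have fdiff: "f d z (x - y) = f d z x - f d z y" if "x \<in> space (obj C d) z" "y \<in> space (obj C d) z" for x y
    using linear_on_diff[OF s t pers_moduleD(1)[OF complexD(1)[OF C]] pmod_homD(1)[OF chain_mapD(1)[OF f]] that] .
  have fbd: "f d z b \<in> boundaries D d z" if b: "b \<in> boundaries C d z" for b
  proof -
    obtain y where y: "y \<in> space (obj C (d + 1)) z" "b = diff C (d + 1) z y" using b by (auto simp: boundaries_def)
    have "f d z b = diff D (d + 1) z (f (d + 1) z y)" using chain_mapD(2)[OF f y(1)] y(2) by simp
    then show ?thesis using pmod_homD(2)[OF chain_mapD(1)[OF f] y(1)] by (auto simp: boundaries_def)
  qed
  have cyc_diff: "x - y \<in> cycles C d z" if "x \<in> cycles C d z" "y \<in> cycles C d z" for x y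
    using that linear_on_diff[OF s s pers_moduleD(1)[OF complexD(1)[OF C]] pmod_homD(1)[OF complexD(2)[OF C]]]
      pers_module_closed(4)[OF s complexD(1)[OF C]] by (auto simp: cycles_def)
  have hom: "(f d z x, f d z y) \<in> homologous D d z \<longleftrightarrow> (x, y) \<in> homologous C d z"
    if x: "x \<in> cycles C d z" and y: "y \<in> cycles C d z" for x y
  proof -
    have "f d z (x - y) = f d z x - f d z y" using x y by (intro fdiff) (auto simp: cycles_def)
    then show ?thesis
      using fcyc[OF x] fcyc[OF y] fbd[of "x - y"] inj[OF cyc_diff[OF x y]] x y by (auto simp: homologous_def)
  qed
  have img: "homology_map D f d z (homologous C d z `` {x}) = homologous D d z `` {f d z x}" if x: "x \<in> cycles C d z" for x
  proof -
    have "homologous D d z `` {f d z y} = homologous D d z `` {f d z x}" if "(x, y) \<in> homologous C d z" for y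
    proof -
      have "y \<in> cycles C d z" using that by (simp add: homologous_def)
      then have "(f d z x, f d z y) \<in> homologous D d z" using hom x that by blast
      then show ?thesis using equiv_class_eq[OF eD] by blast
    qed
    moreover have "(x, x) \<in> homologous C d z" using equiv_class_self[OF eC x] by blast
    ultimately show ?thesis unfolding homology_map_def by blast
  qed
  show "bij_betw (homology_map D f d z) (homology C d z) (homology D d z)"
    unfolding bij_betw_def
  proof
    show "inj_on (homology_map D f d z) (homology C d z)"
    proof (rule inj_onI)
      fix A B assume "A \<in> homology C d z" "B \<in> homology C d z" and eq: "homology_map D f d z A = homology_map D f d z B"
      then obtain x y where x: "x \<in> cycles C d z" "A = homologous C d z `` {x}"
        and y: "y \<in> cycles C d z" "B = homologous C d z `` {y}" by (auto simp: homology_def quotient_def)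
      have "homologous D d z `` {f d z x} = homologous D d z `` {f d z y}" using eq img x y by simp
      then have "(f d z x, f d z y) \<in> homologous D d z" using eq_equiv_class[OF _ eD fcyc[OF y(1)]] by blast
      then have "(x, y) \<in> homologous C d z" using hom x y by blast
      then show "A = B" using equiv_class_eq[OF eC] x y by blast
    qed
    show "homology_map D f d z ` homology C d z = homology D d z"
    proof
      show "homology_map D f d z ` homology C d z \<subseteq> homology D d z"
        using img fcyc by (auto simp: homology_def quotient_def)
      show "homology D d z \<subseteq> homology_map D f d z ` homology C d z"
      proof
        fix B assume "B \<in> homology D d z"
        then obtain y where y: "y \<in> cycles D d z" "B = homologous D d z `` {y}" by (auto simp: homology_def quotient_def)
        obtain x where x: "x \<in> cycles C d z" "y - f d z x \<in> boundaries D d z" using surj[OF y(1)] by blast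
        have "(y, f d z x) \<in> homologous D d z" using y x fcyc by (simp add: homologous_def)
        then have "B = homology_map D f d z (homologous C d z `` {x})"
          using equiv_class_eq[OF eD] img[OF x(1)] y(2) by simp
        moreover have "homologous C d z `` {x} \<in> homology C d z" using x(1) by (auto simp: homology_def quotient_def)
        ultimately show "B \<in> homology_map D f d z ` homology C d z" by blast
      qed
    qed
  qed
qed

subsection \<open>Presentations of free complexes\<close>

lemma linear_on_inv_into:
  assumes s: "vector_space s" and S: "module.subspace s S" and f: "linear_on S s t f" "inj_on f S"
  shows "linear_on (f ` S) t s (inv_into S f)"
  unfolding linear_on_def
proof (intro conjI ballI allI)
  have c: "x \<in> S \<Longrightarrow> y \<in> S \<Longrightarrow> x + y \<in> S" "x \<in> S \<Longrightarrow> s c x \<in> S" for x y c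
    using S by (simp_all add: subspace_iff[OF s])
  fix a b c assume "a \<in> f ` S" "b \<in> f ` S"
  then obtain x y where "x \<in> S" "y \<in> S" "a = f x" "b = f y" by blast
  then show "inv_into S f (a + b) = inv_into S f a + inv_into S f b"
    using inv_into_f_f[OF f(2) c(1)[of x y]] by (simp add: linear_onD(1)[OF f(1)] inv_into_f_f[OF f(2)])
next
  have c: "x \<in> S \<Longrightarrow> s c x \<in> S" for x c
    using S by (simp_all add: subspace_iff[OF s])
  fix a c assume "a \<in> f ` S"
  then obtain x where "x \<in> S" "a = f x" by blast
  then show "inv_into S f (t c a) = s c (inv_into S f a)"
    using inv_into_f_f[OF f(2) c[of x]] by (simp add: linear_onD(2)[OF f(1), symmetric] inv_into_f_f[OF f(2)])
qed

text \<open>The colimit of the free module \<open>obj F d\<close> is the space of finitely supported functions on the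
  generators of degree \<open>d\<close>, and \<open>io d z\<close> is the map from the component in grade \<open>z\<close> to it.\<close>

locale presentation =
  fixes s :: "'k::field \<Rightarrow> 'v \<Rightarrow> 'v::ab_group_add" and F :: "('n::finite, 'v) cpx"
    and X :: "('i, 'n) index" and io :: "int \<Rightarrow> int ^ 'n \<Rightarrow> 'v \<Rightarrow> ('i \<Rightarrow>\<^sub>0 'k)"
  assumes vs: "vector_space s" and cF: "complex s F"
    and io_lin: "linear_on (space (obj F d) z) s pscale (io d z)"
    and io_bij: "bij_betw (io d z) (space (obj F d) z) (coord_space (below X {} d z))"
    and io_trans: "z \<le> w \<Longrightarrow> x \<in> space (obj F d) z \<Longrightarrow> io d w (trans (obj F d) z w x) = io d z x"
begin

lemma F_sub: "module.subspace s (space (obj F d) z)"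
  by (rule pers_moduleD(1)[OF complexD(1)[OF cF]])

lemma io_in: "x \<in> space (obj F d) z \<Longrightarrow> io d z x \<in> coord_space (below X {} d z)"
  using io_bij by (rule bij_betw_apply)

lemma io_zero: "io d z 0 = 0"
  by (rule linear_on_zero[OF vs vector_space_pscale F_sub io_lin])

lemma io_inj: "x \<in> space (obj F d) z \<Longrightarrow> y \<in> space (obj F d) z \<Longrightarrow> io d z x = io d z y \<Longrightarrow> x = y"
  using bij_betw_imp_inj_on[OF io_bij] by (rule inj_onD)

lemma io_surj:
  assumes "v \<in> coord_space (below X {} d z)"
  obtains x where "x \<in> space (obj F d) z" "v = io d z x"
  using assms bij_betw_imp_surj_on[OF io_bij[of d z]] by blast

definition gen :: "'i \<Rightarrow> 'v" where
  "gen i = inv_into (space (obj F (gdeg X i)) (mdeg X i)) (io (gdeg X i) (mdeg X i)) (basis i)"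

lemma gen:
  assumes "i \<in> gens X"
  shows "gen i \<in> space (obj F (gdeg X i)) (mdeg X i)" "io (gdeg X i) (mdeg X i) (gen i) = basis i"
proof -
  have "basis i \<in> io (gdeg X i) (mdeg X i) ` space (obj F (gdeg X i)) (mdeg X i)"
    unfolding bij_betw_imp_surj_on[OF io_bij] using assms by (simp add: below_def)
  then show "gen i \<in> space (obj F (gdeg X i)) (mdeg X i)" "io (gdeg X i) (mdeg X i) (gen i) = basis i"
    unfolding gen_def by (rule inv_into_into, rule f_inv_into_f)
qed

text \<open>The universal property of the colimit: a family \<open>h\<close> compatible with the
  structure maps factors through the colimit, and the factor is determined by its values on the
  generators. It serves both for maps between presented complexes and for turning homomorphisms into
  functionals.\<close>

lemma lin_ext_io:
  assumes t: "vector_space t" and h: "\<And>z. linear_on (space (obj F d) z) s t (h z)"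
    and nat: "\<And>z w x. z \<le> w \<Longrightarrow> x \<in> space (obj F d) z \<Longrightarrow> h w (trans (obj F d) z w x) = h z x"
    and x: "x \<in> space (obj F d) z"
  shows "lin_ext t (\<lambda>i. h (mdeg X i) (gen i)) (io d z x) = h z x"
proof -
  let ?V = "coord_space (below X {} d z)" and ?S = "space (obj F d) z"
  let ?inv = "inv_into ?S (io d z)"
  have img: "io d z ` ?S = ?V" by (rule bij_betw_imp_surj_on[OF io_bij])
  have inj: "inj_on (io d z) ?S" by (rule bij_betw_imp_inj_on[OF io_bij])
  have "linear_on ?V pscale s ?inv" using linear_on_inv_into[OF vs F_sub io_lin inj] img by simp
  moreover have "?inv ` ?V \<subseteq> ?S" using img by (metis image_subsetI inv_into_into)
  ultimately have l: "linear_on ?V pscale t (\<lambda>v. h z (?inv v))" using linear_on_comp[OF _ h] by blast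
  have "lin_ext t (\<lambda>i. h (mdeg X i) (gen i)) (io d z x) = h z (?inv (io d z x))"
  proof (rule linear_coord_space_eq[OF t linear_on_subset[OF linear_lin_ext[OF t]] l _ io_in[OF x]])
    fix i assume i: "i \<in> below X {} d z"
    then have i': "i \<in> gens X" "gdeg X i = d" "mdeg X i \<le> z" by (auto simp: below_def less_eq_vec_def)
    let ?x = "trans (obj F d) (mdeg X i) z (gen i)"
    have g: "gen i \<in> space (obj F d) (mdeg X i)" "io d (mdeg X i) (gen i) = basis i" using gen[OF i'(1)] i'(2) by auto
    have "?x \<in> ?S" by (rule pers_moduleD(3)[OF complexD(1)[OF cF] i'(3) g(1)])
    moreover have "io d z ?x = basis i" using io_trans[OF i'(3) g(1)] g(2) by simp
    ultimately have "?inv (basis i) = ?x" using inv_into_f_f[OF inj] by metis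
    then show "lin_ext t (\<lambda>i. h (mdeg X i) (gen i)) (basis i) = h z (?inv (basis i))"
      using nat[OF i'(3) g(1)] by (simp add: lin_ext_basis[OF t])
  qed simp
  then show ?thesis using inv_into_f_f[OF inj x] by simp
qed

end

lemma lin_ext_cong: "(\<And>i. i \<in> keys x \<Longrightarrow> g i = g' i) \<Longrightarrow> lin_ext t g x = lin_ext t g' x"
  by (simp add: lin_ext_def)

text \<open>The map of colimits induced by \<phi>, prescribed on generators only;
  \<open>induced_io\<close> shows that it restricts to \<phi> in every grade. The differential is
  the case \<open>m = - 1\<close>, a chain map the case \<open>m = 0\<close>.\<close>

definition (in presentation) induced ::
    "('i, 'n) index \<Rightarrow> (int \<Rightarrow> int ^ 'n \<Rightarrow> 'v \<Rightarrow> ('i \<Rightarrow>\<^sub>0 'k)) \<Rightarrow> int \<Rightarrow> (int \<Rightarrow> int ^ 'n \<Rightarrow> 'v \<Rightarrow> 'v) \<Rightarrow>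
      ('i \<Rightarrow>\<^sub>0 'k) \<Rightarrow> ('i \<Rightarrow>\<^sub>0 'k)" where
  "induced Y io' m \<phi> = ext (\<lambda>i. io' (gdeg X i + m) (mdeg X i) (\<phi> (gdeg X i) (mdeg X i) (gen i)))"

locale presentation_pair = F: presentation s F X io + G: presentation s G Y io'
  for s :: "'k::field \<Rightarrow> 'v \<Rightarrow> 'v::ab_group_add" and F :: "('n::finite, 'v) cpx" and G :: "('n, 'v) cpx"
    and X Y :: "('i, 'n) index" and io io' +
  fixes m :: int and \<phi> :: "int \<Rightarrow> int ^ 'n \<Rightarrow> 'v \<Rightarrow> 'v"
  assumes hom: "\<And>d. pmod_hom s s (obj F d) (obj G (d + m)) (\<phi> d)"
begin

abbreviation T :: "('i \<Rightarrow>\<^sub>0 'k) \<Rightarrow> ('i \<Rightarrow>\<^sub>0 'k)" where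
  "T \<equiv> F.induced Y io' m \<phi>"

lemma induced_io:
  assumes x: "x \<in> space (obj F d) z"
  shows "T (io d z x) = io' (d + m) z (\<phi> d z x)"
proof -
  have "T (io d z x) = lin_ext pscale (\<lambda>i. io' (d + m) (mdeg X i) (\<phi> d (mdeg X i) (F.gen i))) (io d z x)"
    unfolding F.induced_def
    by (rule lin_ext_cong) (use F.io_in[OF x] in \<open>auto simp: coord_space_def below_def\<close>)
  also have "\<dots> = io' (d + m) z (\<phi> d z x)"
  proof (rule F.lin_ext_io[OF vector_space_pscale _ _ x])
    show "linear_on (space (obj F d) w) s pscale (\<lambda>x. io' (d + m) w (\<phi> d w x))" for w
      using linear_on_comp[OF pmod_homD(1)[OF hom] G.io_lin] pmod_homD(2)[OF hom] by blast
    fix w u y assume "w \<le> u" "y \<in> space (obj F d) w"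
    then show "io' (d + m) u (\<phi> d u (trans (obj F d) w u y)) = io' (d + m) w (\<phi> d w y)"
      using pmod_homD(2,3)[OF hom] G.io_trans by simp
  qed
  finally show ?thesis .
qed

lemma filt_induced: "filt_map X Y {} m T"
  unfolding filt_map_def
proof (intro conjI ballI)
  show "lin T" unfolding F.induced_def by (rule lin_ext)
  fix i assume "i \<in> gens X"
  note g = F.gen[OF this]
  have "T (basis i) = io' (gdeg X i + m) (mdeg X i) (\<phi> (gdeg X i) (mdeg X i) (F.gen i))"
    using induced_io[OF g(1)] g(2) by simp
  then show "T (basis i) \<in> coord_space (below Y {} (gdeg X i + m) (mdeg X i))"
    using G.io_in pmod_homD(2)[OF hom g(1)] by simp
qed

end

context presentation
begin

definition D :: "('i \<Rightarrow>\<^sub>0 'k) \<Rightarrow> ('i \<Rightarrow>\<^sub>0 'k)" where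
  "D = induced X io (- 1) (diff F)"

lemma pair_diff: "presentation_pair s F F X X io io (- 1) (diff F)"
  by unfold_locales (use complexD(2)[OF cF] in simp)

lemma D_io: "x \<in> space (obj F d) z \<Longrightarrow> D (io d z x) = io (d - 1) z (diff F d z x)"
  using presentation_pair.induced_io[OF pair_diff] by (simp add: D_def)

sublocale filtered_complex X D
proof
  show "filt_map X X {} (- 1) D" using presentation_pair.filt_induced[OF pair_diff] by (simp add: D_def)
  fix i assume "i \<in> gens X"
  note g = gen[OF this]
  have "D (D (basis i)) = D (io (gdeg X i - 1) (mdeg X i) (diff F (gdeg X i) (mdeg X i) (gen i)))"
    using D_io[OF g(1)] g(2) by simp
  also have "\<dots> = io (gdeg X i - 1 - 1) (mdeg X i) (diff F (gdeg X i - 1) (mdeg X i) (diff F (gdeg X i) (mdeg X i) (gen i)))"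
    by (rule D_io[OF pmod_homD(2)[OF complexD(2)[OF cF] g(1)]])
  finally show "D (D (basis i)) = 0" using complexD(3)[OF cF g(1)] io_zero by simp
qed

lemma io_cycles: "x \<in> cycles F d z \<longleftrightarrow> x \<in> space (obj F d) z \<and> D (io d z x) = 0"
proof (cases "x \<in> space (obj F d) z")
  case True
  have "diff F d z x \<in> space (obj F (d - 1)) z" by (rule pmod_homD(2)[OF complexD(2)[OF cF] True])
  then show ?thesis
    using io_inj[of "diff F d z x" "d - 1" z 0] subspace_iff[OF vs] F_sub True
    by (auto simp: cycles_def D_io io_zero)
qed (simp add: cycles_def)

end

text \<open>Tagging a generator with its degree makes the index sets of all degrees disjoint. The
  injection \<open>enc\<close> then places them in a prescribed type, since the type of the indices
  determines the ambient type of the auxiliary complex \<open>disc\<close>.\<close>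

lemma free_presentation:
  fixes enc :: "int \<times> ((int ^ 'n::finite) \<times> 'v::ab_group_add) \<Rightarrow> 'i" and s :: "'k::field \<Rightarrow> 'v \<Rightarrow> 'v"
  assumes s: "vector_space s" and F: "complex s F" and free: "\<And>d. free_module s (obj F d)" and enc: "inj enc"
  shows "\<exists>X io. presentation s F (X :: ('i, 'n) index) io"
proof -
  obtain I :: "int \<Rightarrow> ((int ^ 'n) \<times> 'v) set" and deg
    where "\<And>d. pmod_iso s (fun_scale (*)) (obj F d) (direct_sum (I d) (\<lambda>i. free_gen (deg d i)))"
    using free unfolding free_module_def by metis
  then obtain f where f: "\<And>d. pmod_hom s (fun_scale (*)) (obj F d) (direct_sum (I d) (\<lambda>i. free_gen (deg d i))) (f d)"
    and bij: "\<And>d z. bij_betw (f d z) (space (obj F d) z) (space (direct_sum (I d) (\<lambda>i. free_gen (deg d i))) z)"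
    unfolding pmod_iso_def by metis
  note cF = complexD(1)[OF F]
  define dec where "dec = inv enc"
  have dec [simp]: "dec (enc p) = p" for p by (simp add: dec_def enc)
  define X :: "('i, 'n) index" where
    "X = \<lparr>gens = {enc (d, i) |d i. i \<in> I d}, gdeg = (\<lambda>y. fst (dec y)), mdeg = (\<lambda>y. deg (fst (dec y)) (snd (dec y)))\<rparr>"
  define A where "A d = (\<lambda>i. enc (d, i)) ` I d" for d
  define io :: "int \<Rightarrow> int ^ 'n \<Rightarrow> 'v \<Rightarrow> ('i \<Rightarrow>\<^sub>0 'k)" where
    "io d z x = Abs_poly_mapping (\<lambda>y. if y \<in> A d then f d z x (snd (dec y)) else 0)" for d z x
  have below: "below X {} d z = {enc (d, i) |i. i \<in> I d \<and> deg d i \<le> z}" for d z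
    by (force simp: below_def X_def less_eq_vec_def)
  have lookup_io: "lookup (io d z x) y = (if y \<in> A d then f d z x (snd (dec y)) else 0)"
    if "x \<in> space (obj F d) z" for d z x y
  proof -
    have "finite {i. f d z x i \<noteq> 0}"
      using pmod_homD(2)[OF f that] by (simp add: direct_sum_def)
    then have "finite {y. (if y \<in> A d then f d z x (snd (dec y)) else 0) \<noteq> 0}"
      by (rule finite_surj[of _ _ "\<lambda>i. enc (d, i)"]) (auto simp: A_def)
    then show ?thesis by (simp add: io_def)
  qed
  have enc_A: "enc (d, i) \<in> A d \<longleftrightarrow> i \<in> I d" for d i
    by (auto simp: A_def inj_eq[OF enc])
  have "presentation s F X io"
  proof (rule presentation.intro[OF s F])
    fix d z
    note L = linear_onD[OF pmod_homD(1)[OF f]] and C = pers_module_closed[OF s cF]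
    show "linear_on (space (obj F d) z) s pscale (io d z)"
      by (auto simp: linear_on_def lookup_io lookup_add L C(2,3) fun_scale_def intro!: poly_mapping_eqI)
    show "bij_betw (io d z) (space (obj F d) z) (coord_space (below X {} d z))"
      unfolding bij_betw_def
    proof
      show "inj_on (io d z) (space (obj F d) z)"
      proof (rule inj_onI)
        fix x y assume x: "x \<in> space (obj F d) z" and y: "y \<in> space (obj F d) z" and eq: "io d z x = io d z y"
        have "f d z x i = f d z y i" for i
        proof (cases "i \<in> I d")
          case True
          then show ?thesis using lookup_io[OF x, of "enc (d, i)"] lookup_io[OF y, of "enc (d, i)"] eq
            by (simp add: enc_A)
        next
          case False
          then show ?thesis using pmod_homD(2)[OF f x] pmod_homD(2)[OF f y] by (cases i) (simp add: direct_sum_def)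
        qed
        then have "f d z x = f d z y" by (rule HOL.ext)
        then show "x = y" by (rule inj_onD[OF bij_betw_imp_inj_on[OF bij] _ x y])
      qed
      show "io d z ` space (obj F d) z = coord_space (below X {} d z)"
      proof
        show "io d z ` space (obj F d) z \<subseteq> coord_space (below X {} d z)"
        proof (rule image_subsetI)
          fix x assume x: "x \<in> space (obj F d) z"
          have fx: "i \<in> I d \<Longrightarrow> \<not> deg d i \<le> z \<Longrightarrow> f d z x i = 0" for i
            using pmod_homD(2)[OF f x] by (force simp: direct_sum_def free_gen_def)
          show "io d z x \<in> coord_space (below X {} d z)"
            unfolding coord_space_iff
          proof (intro allI impI)
            fix y assume y: "y \<notin> below X {} d z"
            show "lookup (io d z x) y = 0"
            proof (cases "y \<in> A d")
              case True
              then obtain i where i: "i \<in> I d" "y = enc (d, i)" by (auto simp: A_def)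
              then have "\<not> deg d i \<le> z" using y unfolding below by blast
              then show ?thesis using fx[OF i(1)] lookup_io[OF x] by (simp add: i(2))
            qed (simp add: lookup_io[OF x])
          qed
        qed
        show "coord_space (below X {} d z) \<subseteq> io d z ` space (obj F d) z"
        proof
          fix v :: "'i \<Rightarrow>\<^sub>0 'k" assume v: "v \<in> coord_space (below X {} d z)"
          define c where "c i = (if i \<in> I d then lookup v (enc (d, i)) else 0)" for i
          have "finite {i. c i \<noteq> 0}"
          proof (rule finite_subset)
            show "{i. c i \<noteq> 0} \<subseteq> (\<lambda>y. snd (dec y)) ` keys v"
            proof
              fix i assume "i \<in> {i. c i \<noteq> 0}"
              then have "enc (d, i) \<in> keys v" by (simp add: c_def in_keys_iff split: if_splits)
              then show "i \<in> (\<lambda>y. snd (dec y)) ` keys v" by (rule rev_image_eqI) simp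
            qed
          qed simp
          moreover have "c i \<in> space (free_gen (deg d i)) z" if "i \<in> I d" for i
          proof (cases "deg d i \<le> z")
            case False
            then have "enc (d, i) \<notin> below X {} d z" unfolding below by (auto simp: inj_eq[OF enc])
            then show ?thesis using v False by (simp add: c_def coord_space_iff free_gen_def)
          qed (simp add: free_gen_def)
          ultimately have "c \<in> space (direct_sum (I d) (\<lambda>i. free_gen (deg d i))) z"
            by (simp add: direct_sum_def c_def)
          then obtain x where x: "x \<in> space (obj F d) z" "c = f d z x"
            using bij_betw_imp_surj_on[OF bij] by blast
          have "v = io d z x"
          proof (rule poly_mapping_eqI)
            fix y
            show "lookup v y = lookup (io d z x) y"
            proof (cases "y \<in> A d")
              case True
              then show ?thesis using lookup_io[OF x(1), of y] by (auto simp: A_def x(2)[symmetric] c_def)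
            next
              case False
              then have "y \<notin> below X {} d z" by (auto simp: below A_def)
              then show ?thesis using v lookup_io[OF x(1), of y] False by (simp add: coord_space_iff)
            qed
          qed
          then show "v \<in> io d z ` space (obj F d) z" using x(1) by blast
        qed
      qed
    qed
    fix w x assume zw: "z \<le> w" and x: "x \<in> space (obj F d) z"
    have fx: "i \<in> I d \<Longrightarrow> \<not> deg d i \<le> z \<Longrightarrow> f d z x i = 0" for i
      using pmod_homD(2)[OF f x] by (force simp: direct_sum_def free_gen_def)
    have "i \<in> I d \<Longrightarrow> f d w (trans (obj F d) z w x) i = f d z x i" for i
      using pmod_homD(3)[OF f zw x] fx by (simp add: direct_sum_def free_gen_def)
    then show "io d w (trans (obj F d) z w x) = io d z x"
      using lookup_io[OF x] lookup_io[OF pers_moduleD(3)[OF cF zw x]]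
      by (auto intro!: poly_mapping_eqI simp: A_def)
  qed
  then show ?thesis by blast
qed

subsection \<open>Acyclicity of localisations\<close>

text \<open>\<open>homology_dim\<close> is a truncated difference, so its vanishing only says that
  the cycles have at most the dimension of the boundaries. As the boundaries are contained in the
  finite dimensional space of cycles, this forces equality: a basis of the former, extended to one
  of the latter, does not grow.\<close>

lemma boundaries_eq_cycles:
  assumes s: "vector_space s" and F: "complex s F" and fin: "fin_dim s (space (obj F d) z)"
    and 0: "homology_dim s F d z = 0"
  shows "boundaries F d z = cycles F d z"
proof -
  interpret vector_space s by fact
  have sub: "boundaries F d z \<subseteq> cycles F d z"
    using pmod_homD(2)[OF complexD(2)[OF F], of _ "d + 1"] complexD(3)[OF F, of _ "d + 1"]
    by (auto simp: boundaries_def cycles_def)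
  obtain B where B: "finite B" "space (obj F d) z \<subseteq> span B" using fin by (auto simp: fin_dim_def)
  have cB: "cycles F d z \<subseteq> span B" using B by (auto simp: cycles_def)
  obtain E where E: "E \<subseteq> boundaries F d z" "independent E" "boundaries F d z \<subseteq> span E"
    using maximal_independent_subset by blast
  obtain C where C: "E \<subseteq> C" "C \<subseteq> cycles F d z" "independent C" "cycles F d z \<subseteq> span C"
    using maximal_independent_subset_extend[of E "cycles F d z"] E sub by blast
  have finC: "finite C" using independent_span_bound[OF B(1) C(3)] C(2) cB by auto
  have "dim (boundaries F d z) = card E" using basis_card_eq_dim[OF E(1,3,2)] by simp
  moreover have "dim (cycles F d z) = card C" using basis_card_eq_dim[OF C(2,4,3)] by simp
  ultimately have "card C \<le> card E" using 0 by (simp add: homology_dim_def)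
  then have "C = E" using card_seteq[OF finC C(1)] by simp
  have "module.subspace s (boundaries F d z)"
    unfolding boundaries_def
    using subspace_linear_image[OF s s pers_moduleD(1)[OF complexD(1)[OF F]]] pmod_homD(1)[OF complexD(2)[OF F], of "d + 1"] by simp
  then have "span E \<subseteq> boundaries F d z" using span_minimal[OF E(1)] by blast
  then show ?thesis using sub C(4) \<open>C = E\<close> by blast
qed

lemma finite_homology_support:
  assumes "homology_finite_total_dim s F d"
  shows "finite {z. homology_dim s F d z \<noteq> 0}"
proof (rule ccontr)
  let ?f = "\<lambda>z. real (homology_dim s F d z)"
  assume "infinite {z. homology_dim s F d z \<noteq> 0}"
  \<comment> \<open>More grades than the total dimension; each contributes at least 1, as the
    dimensions are natural numbers.\<close>
  from infinite_arbitrarily_large[OF this] obtain B where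
    B: "finite B" "card B = Suc (nat \<lceil>infsum ?f UNIV\<rceil>)" "B \<subseteq> {z. homology_dim s F d z \<noteq> 0}" by blast
  have "real (card B) = sum (\<lambda>_. 1) B" by simp
  also have "\<dots> \<le> sum ?f B" using B(3) by (intro sum_mono) (auto simp: Suc_le_eq subset_iff)
  also have "\<dots> \<le> infsum ?f UNIV"
    using assms B(1) unfolding homology_finite_total_dim_def by (intro finite_sum_le_infsum) auto
  finally show False using B(2) by linarith
qed

text \<open>A cycle of the localisation involves finitely many generators and the support of the
  homology is finite, so some value \<open>t\<close> of the \<open>j\<close>-th coordinate lies
  strictly above both. The cycle already lives in the grade \<open>W t\<close>, where the homology
  vanishes, and a bounding chain found there also counts in the localisation.\<close>

lemma (in presentation) localisation_acyclic:
  assumes P: "free_complex_finite_homology s F"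
    and x: "x \<in> coord_space (below X {j} d z)" "D x = 0"
  shows "\<exists>y\<in>coord_space (below X {j} (d + 1) z). D y = x"
proof -
  define W where "W t = (\<chi> l. if l = j then t else z $ l)" for t
  let ?E = "{w. homology_dim s F d w \<noteq> 0}"
  have "finite ((\<lambda>w. w $ j) ` ?E \<union> (\<lambda>i. mdeg X i $ j) ` keys x)"
    using finite_homology_support[of s F d] P unfolding free_complex_finite_homology_def
    by (intro finite_UnI finite_imageI) simp_all
  from bdd_above_finite[OF this] obtain b where
    b: "\<And>u. u \<in> (\<lambda>w. w $ j) ` ?E \<union> (\<lambda>i. mdeg X i $ j) ` keys x \<Longrightarrow> u \<le> b"
    unfolding bdd_above_def by blast
  define t where "t = b + 1"
  have t: "u < t" if "u \<in> (\<lambda>w. w $ j) ` ?E \<union> (\<lambda>i. mdeg X i $ j) ` keys x" for u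
    using b[OF that] by (simp add: t_def)
  have "W t $ j = t" by (simp add: W_def)
  then have 0: "homology_dim s F d (W t) = 0" using t[of t] by force
  have "x \<in> coord_space (below X {} d (W t))"
    using x(1) t unfolding coord_space_def below_def W_def by (fastforce simp: subset_iff)
  then obtain x' where x': "x' \<in> space (obj F d) (W t)" "x = io d (W t) x'" by (rule io_surj)
  then have "x' \<in> cycles F d (W t)" using x(2) by (simp add: io_cycles)
  moreover have "fin_dim s (space (obj F d) (W t))" using P by (simp add: free_complex_finite_homology_def pfd_def)
  ultimately have "x' \<in> boundaries F d (W t)" using boundaries_eq_cycles[OF vs cF _ 0] by blast
  then obtain y where y: "y \<in> space (obj F (d + 1)) (W t)" "x' = diff F (d + 1) (W t) y"
    by (auto simp: boundaries_def)
  have "io (d + 1) (W t) y \<in> coord_space (below X {j} (d + 1) z)"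
    using io_in[OF y(1)] by (rule coord_space_mono) (auto simp: below_def W_def)
  moreover have "D (io (d + 1) (W t) y) = x" using D_io[OF y(1)] x'(2) y(2) by simp
  ultimately show ?thesis by blast
qed

subsection \<open>Evaluation into the Nakayama functor\<close>

lemma fun_scale_apply: "fun_scale s c f x = s c (f x)"
  by (simp add: fun_scale_def)

abbreviation eps :: "int ^ 'n::finite" where
  "eps \<equiv> \<chi> i. 1"

context presentation
begin

text \<open>The functional on the colimit given by a homomorphism into a shift of
  \<open>free_gen 0\<close>. All components of the target are subspaces of the field, and where its
  structure maps are zero \<open>h\<close> vanishes anyway, so \<open>h\<close> is a compatible
  family (\<open>hv_io\<close>).\<close>

definition hv :: "(int ^ 'n \<Rightarrow> 'v \<Rightarrow> 'k) \<Rightarrow> ('i \<Rightarrow>\<^sub>0 'k) \<Rightarrow> 'k" where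
  "hv h = lin_ext (*) (\<lambda>i. h (mdeg X i) (gen i))"

abbreviation homs :: "int \<Rightarrow> int ^ 'n \<Rightarrow> (int ^ 'n \<Rightarrow> 'v \<Rightarrow> 'k) set" where
  "homs d z \<equiv> space (Hom_free s (obj F d)) (- (eps + z))"

text \<open>The canonical map to the double dual, in the grade \<open>eps + z\<close> of \<nu>: the
  members of \<open>homs d z\<close> correspond to functionals on the quotient of
  \<open>below X UNIV d z\<close> by \<open>below_smaller X UNIV d z\<close>. The value 0 off
  \<open>homs d z\<close> follows the convention for elements of a dual.\<close>

definition ev :: "int \<Rightarrow> int ^ 'n \<Rightarrow> ('i \<Rightarrow>\<^sub>0 'k) \<Rightarrow> ('n, 'k, 'v) nu_space" where
  "ev d z y = (\<lambda>h. if h \<in> homs d z then hv h y else 0)"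

lemma below_UNIV: "below X UNIV d z = {i \<in> gens X. gdeg X i = d}"
  by (simp add: below_def)

lemma lin_hv: "linear_on UNIV pscale (*) (hv h)"
  unfolding hv_def by (rule linear_lin_ext[OF vector_space_field])

lemma hv_lin: "hv h (x + y) = hv h x + hv h y" "hv h (pscale c x) = c * hv h x" "hv h 0 = 0"
  "hv h (x - y) = hv h x - hv h y"
  using lin_hv linear_on_zero[OF vector_space_pscale vector_space_field subspace_UNIV[OF vector_space_pscale] lin_hv]
    linear_on_diff[OF vector_space_pscale vector_space_field subspace_UNIV[OF vector_space_pscale] lin_hv]
  by (simp_all add: linear_on_def)

lemma hv_sum: "hv h (sum f A) = (\<Sum>a\<in>A. hv h (f a))"
  by (induction A rule: infinite_finite_induct) (simp_all add: hv_lin)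

lemma hv_hom_lin: "hv (h + h') y = hv h y + hv h' y" "hv (hom_scale c h) y = c * hv h y"
  unfolding hv_def lin_ext_def
  by (simp_all add: distrib_left sum.distrib sum_distrib_left fun_scale_def mult.left_commute)

lemma hv_basis: "hv h (basis i) = h (mdeg X i) (gen i)"
  unfolding hv_def by (rule lin_ext_basis[OF vector_space_field])

text \<open>The reason for the shift by \<epsilon>: over the integers \<open>1 + a \<le> b\<close>
  is the negation of \<open>b \<le> a\<close>, so \<open>eps + z \<le> w\<close> means that
  \<open>w\<close> is small in no coordinate.\<close>

lemma eps_le: "eps + z \<le> w \<longleftrightarrow> (\<forall>l. \<not> w $ l \<le> z $ l)" for z w :: "int ^ 'n"
proof -
  have "1 + a \<le> b \<longleftrightarrow> \<not> b \<le> a" for a b :: int by auto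
  then show ?thesis by (simp add: less_eq_vec_def)
qed

lemma eps_le': "0 \<le> - (eps + z) + w \<longleftrightarrow> eps + z \<le> w" for z w :: "int ^ 'n"
proof -
  have "0 \<le> - (1 + a) + b \<longleftrightarrow> 1 + a \<le> b" for a b :: int by auto
  then show ?thesis by (simp add: less_eq_vec_def)
qed

lemma homs_iff: "h \<in> homs d z \<longleftrightarrow> (\<forall>w. linear_on (space (obj F d) w) s (*) (h w)) \<and>
    (\<forall>w x. x \<notin> space (obj F d) w \<or> \<not> eps + z \<le> w \<longrightarrow> h w x = 0) \<and>
    (\<forall>w u. w \<le> u \<longrightarrow> (\<forall>x\<in>space (obj F d) w. h u (trans (obj F d) w u x) = (if eps + z \<le> w then h w x else 0)))"
  (is "?L \<longleftrightarrow> ?A \<and> ?B \<and> ?C")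
proof
  assume ?L
  then have h: "pmod_hom s (*) (obj F d) (pmod_shift (- (eps + z)) (free_gen 0)) h"
    and o: "\<And>w x. x \<notin> space (obj F d) w \<Longrightarrow> h w x = 0" by (auto simp: Hom_def)
  have "h w x = 0" if "x \<in> space (obj F d) w" "\<not> eps + z \<le> w" for w x
    using pmod_homD(2)[OF h that(1)] that(2) unfolding pmod_shift_def free_gen_def by (simp only: eps_le' pmod.simps if_False singleton_iff)
  then have ?B using o by blast
  moreover have ?A using pmod_homD(1)[OF h] by blast
  moreover have ?C
  proof (intro allI impI ballI)
    fix w u x assume "w \<le> u" "x \<in> space (obj F d) w"
    from pmod_homD(3)[OF h this]
    show "h u (trans (obj F d) w u x) = (if eps + z \<le> w then h w x else 0)"
      unfolding pmod_shift_def free_gen_def by (simp only: eps_le' pmod.simps)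
  qed
  ultimately show "?A \<and> ?B \<and> ?C" by blast
next
  assume R: "?A \<and> ?B \<and> ?C"
  have "pmod_hom s (*) (obj F d) (pmod_shift (- (eps + z)) (free_gen 0)) h"
    unfolding pmod_hom_def
  proof (intro conjI allI impI ballI)
    fix w
    show "linear_on (space (obj F d) w) s (*) (h w)" using R by blast
    show "h w ` space (obj F d) w \<subseteq> space (pmod_shift (- (eps + z)) (free_gen 0)) w"
      using R unfolding pmod_shift_def free_gen_def by (auto simp only: eps_le' pmod.simps split: if_splits)
    fix u x assume "w \<le> u" "x \<in> space (obj F d) w"
    then have "h u (trans (obj F d) w u x) = (if eps + z \<le> w then h w x else 0)" using R by blast
    then show "h u (trans (obj F d) w u x) = trans (pmod_shift (- (eps + z)) (free_gen 0)) w u (h w x)"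
      unfolding pmod_shift_def free_gen_def by (simp only: eps_le' pmod.simps)
  qed
  then show ?L using R by (auto simp: Hom_def)
qed

lemma hv_io:
  assumes h: "h \<in> homs d z" and x: "x \<in> space (obj F d) w"
  shows "hv h (io d w x) = h w x"
  unfolding hv_def
proof (rule lin_ext_io[OF vector_space_field _ _ x])
  note H = h[unfolded homs_iff]
  show "linear_on (space (obj F d) u) s (*) (h u)" for u using H by blast
  fix u v y assume "u \<le> v" "y \<in> space (obj F d) u"
  then have "h v (trans (obj F d) u v y) = (if eps + z \<le> u then h u y else 0)" using H by blast
  also have "\<dots> = h u y" using H by simp
  finally show "h v (trans (obj F d) u v y) = h u y" .
qed

lemma hv_smaller:
  assumes h: "h \<in> homs d z" and y: "y \<in> coord_space (below_smaller X UNIV d z)"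
  shows "hv h y = 0"
proof -
  have "hv h y \<in> {0}"
  proof (rule linear_coord_space_into[OF vector_space_field linear_on_subset[OF lin_hv] _ subspace_zero[OF vector_space_field] y])
    fix i assume i: "i \<in> below_smaller X UNIV d z"
    then have "\<not> eps + z \<le> mdeg X i" by (auto simp: eps_le below_smaller_def)
    then show "hv h (basis i) \<in> {0}" using h unfolding homs_iff by (simp add: hv_basis)
  qed simp
  then show ?thesis by simp
qed

text \<open>The converse of \<open>hv_smaller\<close>: every functional that kills the small
  elements comes from a homomorphism. Vanishing on small elements is exactly what the zero
  components of the target, in grades not above \<open>eps + z\<close>, demand.\<close>

lemma homs_realise:
  assumes \<psi>: "linear_on UNIV pscale (*) \<psi>" and 0: "\<And>y. y \<in> coord_space (below_smaller X UNIV d z) \<Longrightarrow> \<psi> y = 0"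
  shows "\<exists>h\<in>homs d z. \<forall>v\<in>coord_space (below X UNIV d z). hv h v = \<psi> v"
proof -
  define h where "h w x = (if x \<in> space (obj F d) w \<and> eps + z \<le> w then \<psi> (io d w x) else 0)" for w x
  note C = pers_module_closed[OF vs complexD(1)[OF cF]]
  have van: "\<psi> (io d w x) = 0" if x: "x \<in> space (obj F d) w" and w: "\<not> eps + z \<le> w" for w x
  proof (rule 0)
    obtain l where l: "w $ l \<le> z $ l" using w by (auto simp: eps_le)
    show "io d w x \<in> coord_space (below_smaller X UNIV d z)"
      using io_in[OF x]
    proof (rule coord_space_mono, intro subsetI)
      fix i assume "i \<in> below X {} d w"
      then have i: "i \<in> gens X" "gdeg X i = d" "mdeg X i $ l \<le> w $ l" by (auto simp: below_def)
      then have "mdeg X i $ l \<le> z $ l" using l by linarith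
      then show "i \<in> below_smaller X UNIV d z" using i by (auto simp: below_def below_smaller_def)
    qed
  qed
  have h: "h \<in> homs d z"
    unfolding homs_iff
  proof (intro conjI allI impI ballI)
    fix w
    have "linear_on (space (obj F d) w) s (*) (\<lambda>x. \<psi> (io d w x))"
      by (rule linear_on_comp[OF io_lin \<psi>]) simp
    then show "linear_on (space (obj F d) w) s (*) (h w)"
      using C(2,3) by (auto simp: linear_on_def h_def)
    fix u x assume wu: "w \<le> u" and x: "x \<in> space (obj F d) w"
    have "trans (obj F d) w u x \<in> space (obj F d) u" by (rule pers_moduleD(3)[OF complexD(1)[OF cF] wu x])
    then show "h u (trans (obj F d) w u x) = (if eps + z \<le> w then h w x else 0)"
      using io_trans[OF wu x] van[OF x] order_trans[OF _ wu] x by (auto simp: h_def)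
  qed (auto simp: h_def)
  have "hv h v = \<psi> v" if v: "v \<in> coord_space (below X UNIV d z)" for v
  proof (rule linear_coord_space_eq[OF vector_space_field linear_on_subset[OF lin_hv] linear_on_subset[OF \<psi>] _ v])
    fix i assume "i \<in> below X UNIV d z"
    then have i: "i \<in> gens X" "gdeg X i = d" by (auto simp: below_UNIV)
    have g: "gen i \<in> space (obj F d) (mdeg X i)" "io d (mdeg X i) (gen i) = basis i" using gen[OF i(1)] i(2) by auto
    show "hv h (basis i) = \<psi> (basis i)" using g van[OF g(1)] by (simp add: hv_basis h_def)
  qed auto
  with h show ?thesis by blast
qed

lemma pers_homs: "pers_module hom_scale (Hom_free s (obj F d))"
  by (rule pers_module_Hom_free[OF vs complexD(1)[OF cF]])

lemma homs_closed: "0 \<in> homs d z" "h \<in> homs d z \<Longrightarrow> h' \<in> homs d z \<Longrightarrow> h + h' \<in> homs d z"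
  "h \<in> homs d z \<Longrightarrow> hom_scale c h \<in> homs d z"
  using pers_module_closed[OF vector_space_hom_scale pers_homs] by blast+

lemma ev_in: "ev d z y \<in> space (nu s (obj F d)) (eps + z)"
  unfolding nu_space linear_on_def using homs_closed by (auto simp: ev_def hv_hom_lin)

lemma linear_ev: "linear_on S pscale nu_scale (ev d z)"
  by (auto simp: linear_on_def ev_def hv_lin fun_eq_iff fun_scale_def)

lemma ev_lin: "ev d z (x + y) = ev d z x + ev d z y" "ev d z (- x) = - ev d z x" "ev d z 0 = 0"
  "ev d z (x - y) = ev d z x - ev d z y"
  using linear_onD(1)[OF linear_ev, of _ UNIV]
    linear_on_zero[OF vector_space_pscale vector_space_nu_scale subspace_UNIV[OF vector_space_pscale] linear_ev]
    linear_on_uminus[OF vector_space_pscale vector_space_nu_scale linear_ev, of _ UNIV]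
    linear_on_diff[OF vector_space_pscale vector_space_nu_scale subspace_UNIV[OF vector_space_pscale] linear_ev]
  by simp_all

lemma ev_smaller: "y \<in> coord_space (below_smaller X UNIV d z) \<Longrightarrow> ev d z y = 0"
  by (auto simp: ev_def hv_smaller fun_eq_iff)

lemma ev_trans:
  assumes zw: "z \<le> w"
  shows "trans (nu s (obj F d)) (eps + z) (eps + w) (ev d z y) = ev d w y"
proof (rule HOL.ext)
  fix h
  show "trans (nu s (obj F d)) (eps + z) (eps + w) (ev d z y) h = ev d w y h"
  proof (cases "h \<in> homs d w")
    case True
    let ?h = "trans (Hom_free s (obj F d)) (- (eps + w)) (- (eps + z)) h"
    have "- (eps + w) \<le> - (eps + z)" using zw by (simp only: vec_add_le)
    from pers_moduleD(3)[OF pers_homs this True] have in_homs: "?h \<in> homs d z" .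
    have "?h = h"
    proof (intro HOL.ext)
      fix u x
      have "?h u x = (if x \<in> space (obj F d) u then (if eps + w \<le> u then h u x else 0) else 0)"
        unfolding Hom_def free_gen_def by (simp only: eps_le' pmod.simps)
      then show "?h u x = h u x" using True unfolding homs_iff by auto
    qed
    then show ?thesis using True in_homs by (simp add: nu_trans ev_def)
  qed (simp add: nu_trans ev_def)
qed

end

lemma (in presentation_pair) ev_map:
  assumes y: "y \<in> coord_space (below X UNIV d z)"
  shows "nu_map s (obj F d) (obj G (d + m)) (\<phi> d) (eps + z) (F.ev d z y) = G.ev (d + m) z (T y)"
proof (rule HOL.ext)
  fix h
  show "nu_map s (obj F d) (obj G (d + m)) (\<phi> d) (eps + z) (F.ev d z y) h = G.ev (d + m) z (T y) h"
  proof (cases "h \<in> G.homs (d + m) z")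
    case True
    have pre: "Hom_precomp (obj F d) (\<phi> d) h \<in> F.homs d z"
      by (rule Hom_precomp_space[OF F.vs complexD(1)[OF F.cF] hom True])
    have "F.hv (Hom_precomp (obj F d) (\<phi> d) h) y = G.hv h (T y)"
    proof (rule linear_coord_space_eq[OF vector_space_field linear_on_subset[OF F.lin_hv] _ _ y])
      show "linear_on (coord_space (below X UNIV d z)) pscale (*) (\<lambda>y. G.hv h (T y))"
        by (rule linear_on_comp[OF linear_on_subset[OF filt_mapD(1)[OF filt_induced]] G.lin_hv]) auto
      fix i assume "i \<in> below X UNIV d z"
      then have i: "i \<in> gens X" "gdeg X i = d" by (auto simp: F.below_UNIV)
      have g: "F.gen i \<in> space (obj F d) (mdeg X i)" "io d (mdeg X i) (F.gen i) = basis i" using F.gen[OF i(1)] i(2) by auto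
      show "F.hv (Hom_precomp (obj F d) (\<phi> d) h) (basis i) = G.hv h (T (basis i))"
        unfolding g(2)[symmetric] induced_io[OF g(1)] G.hv_io[OF True pmod_homD(2)[OF hom g(1)]]
        using g by (simp add: F.hv_basis Hom_precomp_def)
    qed auto
    then show ?thesis using True pre by (simp add: nu_map_apply F.ev_def G.ev_def)
  qed (simp add: nu_map_apply G.ev_def)
qed

context presentation
begin

lemma ev_diff:
  assumes "y \<in> coord_space (below X UNIV d z)"
  shows "nu_map s (obj F d) (obj F (d - 1)) (diff F d) (eps + z) (ev d z y) = ev (d - 1) z (D y)"
  using presentation_pair.ev_map[OF pair_diff assms] by (simp add: D_def)

lemma precomp_in:
  assumes "h \<in> homs (d - 1) z"
  shows "Hom_precomp (obj F d) (diff F d) h \<in> homs d z"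
  by (rule Hom_precomp_space[OF vs complexD(1)[OF cF] complexD(2)[OF cF] assms])

lemma precomp_in':
  assumes "h \<in> homs d z"
  shows "Hom_precomp (obj F (d + 1)) (diff F (d + 1)) h \<in> homs (d + 1) z"
  using precomp_in[of h "d + 1"] assms by simp

lemma precomp_eqI:
  assumes h: "h \<in> homs d z" and \<psi>: "\<And>v. v \<in> coord_space (below X UNIV d z) \<Longrightarrow> hv h v = hv h' (D v)"
    and h': "h' \<in> homs (d - 1) z"
  shows "Hom_precomp (obj F d) (diff F d) h' = h"
proof (intro HOL.ext)
  fix w x
  show "Hom_precomp (obj F d) (diff F d) h' w x = h w x"
  proof (cases "x \<in> space (obj F d) w")
    case True
    have "io d w x \<in> coord_space (below X UNIV d z)"
      using io_in[OF True] by (rule coord_space_mono) (auto simp: below_def)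
    then have "h w x = hv h' (D (io d w x))" using \<psi> hv_io[OF h True] by simp
    also have "\<dots> = h' w (diff F d w x)"
      using D_io[OF True] hv_io[OF h' pmod_homD(2)[OF complexD(2)[OF cF] True]] by simp
    finally show ?thesis using True by (simp add: Hom_precomp_def)
  next
    case False
    then show ?thesis using h unfolding homs_iff by (simp add: Hom_precomp_def)
  qed
qed

lemma hv_precomp:
  assumes h: "h \<in> homs d z" and v: "v \<in> coord_space (below X UNIV (d + 1) z)"
  shows "hv (Hom_precomp (obj F (d + 1)) (diff F (d + 1)) h) v = hv h (D v)"
proof -
  have "ev d z (D v) h = nu_map s (obj F (d + 1)) (obj F d) (diff F (d + 1)) (eps + z) (ev (d + 1) z v) h"
    using ev_diff[OF v] by simp
  then show ?thesis using h precomp_in'[OF h] by (simp add: ev_def nu_map_apply)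
qed

section \<open>Homology of the double dual\<close>

lemma subspace_bd: "module.subspace pscale (bd S d z)"
  unfolding subspace_iff[OF vector_space_pscale]
proof (intro conjI ballI allI)
  show "0 \<in> bd S d z" by (rule bdI[of 0 _ _ _ 0]) (simp_all add: lin_zero[OF lin_D])
  fix c x assume "x \<in> bd S d z"
  then obtain y where y: "y \<in> coord_space (below X S (d + 1) z)" "x - D y \<in> coord_space (below_smaller X S d z)"
    by (auto simp: bd_def)
  show "pscale c x \<in> bd S d z"
    by (rule bdI[OF coord_space_scale[OF y(1)] coord_space_scale[OF y(2), of c]])
      (simp add: lin_scale[OF lin_D] pscale_distrib)
qed (rule bd_add)

lemma subspace_cyc: "module.subspace pscale (cyc S d z)"
  unfolding subspace_iff[OF vector_space_pscale] cyc_def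
  by (auto simp: coord_space_add coord_space_scale lin_simps[OF lin_D])

lemma smaller_bd: "y \<in> coord_space (below_smaller X S d z) \<Longrightarrow> y \<in> bd S d z"
  by (rule bdI[of 0 _ _ _ y]) (simp_all add: lin_zero[OF lin_D])

text \<open>If \<open>y\<close> were no boundary, some functional would kill \<open>bd\<close> but
  not \<open>y\<close>: a coordinate of the complement of a projection onto \<open>bd\<close>.
  Killing \<open>bd\<close>, it is realised by a homomorphism \<open>h\<close> whose composite with
  the differential is 0. Hence a boundary in \<nu> pairs to 0 with \<open>h\<close>, whereas
  \<open>ev d z y\<close> pairs to a nonzero value.\<close>

lemma ev_inj:
  assumes y: "y \<in> cyc UNIV d z" and \<Phi>: "\<Phi> \<in> space (nu s (obj F (d + 1))) (eps + z)"
    and eq: "nu_map s (obj F (d + 1)) (obj F d) (diff F (d + 1)) (eps + z) \<Phi> = ev d z y"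
  shows "y \<in> bd UNIV d z"
proof (rule ccontr)
  assume ny: "y \<notin> bd UNIV d z"
  obtain p where p: "lin p" "range p \<subseteq> bd UNIV d z" "\<And>v. v \<in> bd UNIV d z \<Longrightarrow> p v = v"
    using projection_onto[OF vector_space_pscale subspace_bd[of UNIV d z]] by blast
  have "y - p y \<noteq> 0" using ny p(2) by (metis eq_iff_diff_eq_0 range_subsetD)
  then obtain k where k: "lookup (y - p y) k \<noteq> 0" by (metis poly_mapping_eqI lookup_zero)
  define \<psi> where "\<psi> v = lookup (v - p v) k" for v
  have \<psi>: "linear_on UNIV pscale (*) \<psi>"
    by (auto simp: linear_on_def \<psi>_def lookup_add lookup_minus lin_simps[OF p(1)] algebra_simps)
  have \<psi>0: "\<psi> v = 0" if "v \<in> bd UNIV d z" for v using p(3)[OF that] by (simp add: \<psi>_def)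
  from homs_realise[OF \<psi> \<psi>0[OF smaller_bd]] obtain h where
    h: "h \<in> homs d z" "\<forall>v\<in>coord_space (below X UNIV d z). hv h v = \<psi> v" by blast
  have "Hom_precomp (obj F (d + 1)) (diff F (d + 1)) h = 0"
  proof (rule precomp_eqI[of _ "d + 1" z])
    show "0 \<in> homs (d + 1) z" by (rule homs_closed)
    show "h \<in> homs (d + 1 - 1) z" using h(1) by simp
    fix v :: "'i \<Rightarrow>\<^sub>0 'k" assume v: "v \<in> coord_space (below X UNIV (d + 1) z)"
    have "D v \<in> coord_space (below X UNIV d z)" using D_below[OF v] by simp
    moreover have "D v \<in> bd UNIV d z" by (rule bdI[OF v, of 0]) simp_all
    ultimately have "hv h (D v) = 0" using h(2) \<psi>0[of "D v"] by simp
    moreover have "hv 0 v = 0" by (simp add: hv_def lin_ext_def)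
    ultimately show "hv 0 v = hv h (D v)" by simp
  qed
  moreover have "\<Phi> 0 = 0"
    using \<Phi> linear_on_zero[OF vector_space_hom_scale vector_space_field pers_moduleD(1)[OF pers_homs]]
    unfolding nu_space by blast
  ultimately have "ev d z y h = 0" using eq[symmetric] h(1) by (simp add: nu_map_apply)
  then have "\<psi> y = 0" using h y by (simp add: ev_def cyc_def)
  then show False using k by (simp add: \<psi>_def)
qed

text \<open>Dualising over a field is exact: a functional that vanishes on the cycles of the
  quotient complex factors through its differential.\<close>

lemma homs_cocycle_exact:
  assumes h: "h \<in> homs d z" and 0: "\<And>y. y \<in> cyc UNIV d z \<Longrightarrow> hv h y = 0"
  shows "\<exists>h'\<in>homs (d - 1) z. Hom_precomp (obj F d) (diff F d) h' = h"
proof -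
  \<comment> \<open>Erasing the coordinates in \<open>below_smaller\<close> models the passage to
    the quotient, so that the kernel of \<open>?r \<circ> D\<close> on \<open>?V\<close> consists of
    elements of \<open>cyc\<close>.\<close>
  let ?r = "restrict_to (- below_smaller X UNIV (d - 1) z) :: ('i \<Rightarrow>\<^sub>0 'k) \<Rightarrow> _"
  let ?V = "coord_space (below X UNIV d z) :: ('i \<Rightarrow>\<^sub>0 'k) set"
  have lr: "lin ?r" by (rule linear_restrict_to)
  have "hv h x = 0" if x: "x \<in> ?V" and r: "?r (D x) = 0" for x
  proof (rule 0)
    have "lookup (D x) i = 0" if "i \<notin> below_smaller X UNIV (d - 1) z" for i
      using arg_cong[OF r, of "\<lambda>v. lookup v i"] that by simp
    then have "D x \<in> coord_space (below_smaller X UNIV (d - 1) z)" by (simp add: coord_space_iff)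
    then show "x \<in> cyc UNIV d z" using x by (simp add: cyc_def)
  qed
  then have "\<exists>\<theta>. linear_on UNIV pscale (*) \<theta> \<and> (\<forall>x\<in>?V. \<theta> (?r (D x)) = hv h x)"
    by (intro factor_through[OF vector_space_pscale vector_space_pscale vector_space_field subspace_coord_space
      linear_on_subset[OF lin_comp[OF lin_D lr] subset_UNIV] linear_on_subset[OF lin_hv subset_UNIV]])
  then obtain \<theta> where \<theta>: "linear_on UNIV pscale (*) \<theta>" "\<forall>x\<in>?V. \<theta> (?r (D x)) = hv h x" by blast
  have "linear_on UNIV pscale (*) (\<lambda>v. \<theta> (?r v))" by (rule linear_on_comp[OF lr \<theta>(1)]) simp
  moreover have "\<theta> (?r v) = 0" if "v \<in> coord_space (below_smaller X UNIV (d - 1) z)" for v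
  proof -
    have "?r v = 0" using that by (intro poly_mapping_eqI) (simp add: coord_space_iff)
    then show ?thesis
      using linear_on_zero[OF vector_space_pscale vector_space_field subspace_UNIV[OF vector_space_pscale] \<theta>(1)] by simp
  qed
  ultimately have "\<exists>h'\<in>homs (d - 1) z. \<forall>v\<in>coord_space (below X UNIV (d - 1) z). hv h' v = \<theta> (?r v)"
    by (rule homs_realise)
  then obtain h' where h': "h' \<in> homs (d - 1) z"
    "\<forall>v\<in>coord_space (below X UNIV (d - 1) z). hv h' v = \<theta> (?r v)" by blast
  have "Hom_precomp (obj F d) (diff F d) h' = h"
    by (rule precomp_eqI[OF h _ h'(1)]) (simp add: h'(2) D_below \<theta>(2))
  with h'(1) show ?thesis by blast
qed

text \<open>The double dual of a complex has the same homology as the complex where the latter is finite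
  dimensional; \<open>U\<close> represents a spanning set of the homology.\<close>

lemma ev_surj:
  assumes U: "finite U" "U \<subseteq> cyc UNIV d z"
    and span: "\<And>\<psi> y. linear_on UNIV pscale (*) \<psi> \<Longrightarrow> (\<And>u. u \<in> U \<Longrightarrow> \<psi> u = 0) \<Longrightarrow>
      (\<And>b. b \<in> bd UNIV d z \<Longrightarrow> \<psi> b = 0) \<Longrightarrow> y \<in> cyc UNIV d z \<Longrightarrow> \<psi> y = 0"
    and \<Phi>: "\<Phi> \<in> space (nu s (obj F d)) (eps + z)"
    and cocyc: "nu_map s (obj F d) (obj F (d - 1)) (diff F d) (eps + z) \<Phi> = 0"
  shows "\<exists>y\<in>cyc UNIV d z. \<exists>\<Phi>'\<in>space (nu s (obj F (d + 1))) (eps + z).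
    \<Phi> - ev d z y = nu_map s (obj F (d + 1)) (obj F d) (diff F (d + 1)) (eps + z) \<Phi>'"
proof -
  let ?d = "Hom_precomp (obj F (d + 1)) (diff F (d + 1)) :: (int ^ 'n \<Rightarrow> 'v \<Rightarrow> 'k) \<Rightarrow> _"
  have lin_d: "linear_on S hom_scale hom_scale ?d" for S
    by (auto simp: linear_on_def Hom_precomp_def fun_eq_iff fun_scale_def)
  have lin_\<Phi>: "linear_on (homs d z) hom_scale (*) \<Phi>" and \<Phi>0: "\<And>h. h \<notin> homs d z \<Longrightarrow> \<Phi> h = 0"
    using \<Phi> by (auto simp: nu_space)
  define Z where "Z = {h \<in> homs d z. ?d h = 0}"
  have Z: "module.subspace hom_scale Z"
    unfolding subspace_iff[OF vector_space_hom_scale] Z_def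
    using homs_closed linear_onD[OF lin_d[of UNIV]] vector_space.vector_space_assms
      linear_on_zero[OF vector_space_hom_scale vector_space_hom_scale subspace_UNIV[OF vector_space_hom_scale] lin_d]
    by (auto simp: fun_scale_def fun_eq_iff)
  \<comment> \<open>Restriction of cocycles to the finite set \<open>U\<close>. A cocycle in the
    kernel vanishes on \<open>U\<close> and on \<open>bd\<close>, hence on all cycles, and is a
    coboundary by \<open>homs_cocycle_exact\<close>; \<Phi> kills it since \<Phi> is a cycle. So
    \<Phi> on \<open>Z\<close> depends only on finitely many values.\<close>
  define \<delta> where "\<delta> h = (\<lambda>u. if u \<in> U then hv h u else 0)" for h
  have lin_\<delta>: "linear_on Z hom_scale (fun_scale (*)) \<delta>"
    by (auto simp: linear_on_def \<delta>_def hv_hom_lin fun_eq_iff fun_scale_apply)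
  have "\<Phi> h = 0" if h: "h \<in> Z" and \<delta>0: "\<delta> h = 0" for h
  proof -
    have hd: "h \<in> homs d z" and dh: "?d h = 0" using h by (auto simp: Z_def)
    have "hv h y = 0" if y: "y \<in> cyc UNIV d z" for y
    proof (rule span[OF lin_hv _ _ y])
      show "hv h u = 0" if "u \<in> U" for u using fun_cong[OF \<delta>0, of u] that by (simp add: \<delta>_def)
      show "hv h b = 0" if "b \<in> bd UNIV d z" for b
      proof -
        obtain v where v: "v \<in> coord_space (below X UNIV (d + 1) z)" "b - D v \<in> coord_space (below_smaller X UNIV d z)"
          using \<open>b \<in> bd UNIV d z\<close> by (auto simp: bd_def)
        have "hv h (D v) = 0" using hv_precomp[OF hd v(1)] dh by (simp add: hv_def lin_ext_def)
        then show ?thesis using hv_smaller[OF hd v(2)] by (simp add: hv_lin)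
      qed
    qed
    from homs_cocycle_exact[OF hd this] obtain h' where
      h': "h' \<in> homs (d - 1) z" "Hom_precomp (obj F d) (diff F d) h' = h" by blast
    then show ?thesis using fun_cong[OF cocyc, of h'] by (simp add: nu_map_apply)
  qed
  moreover have "Z \<subseteq> homs d z" by (auto simp: Z_def)
  ultimately have "\<exists>\<theta>. linear_on UNIV (fun_scale (*)) (*) \<theta> \<and> (\<forall>h\<in>Z. \<theta> (\<delta> h) = \<Phi> h)"
    by (intro factor_through[OF vector_space_hom_scale vector_space_fun[OF vector_space_field] vector_space_field Z lin_\<delta>
      linear_on_subset[OF lin_\<Phi>]])
  then obtain \<theta> where \<theta>: "linear_on UNIV (fun_scale (*)) (*) \<theta>" "\<And>h. h \<in> Z \<Longrightarrow> \<theta> (\<delta> h) = \<Phi> h" by blast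
  define one where "one u = (\<lambda>v. if v = u then 1 :: 'k else 0)" for u :: "'i \<Rightarrow>\<^sub>0 'k"
  \<comment> \<open>A functional on the finite dimensional image of \<delta> is a combination of
    evaluations at the elements of \<open>U\<close>, with coefficients the values of \<theta> on
    unit vectors; \<open>y\<close> is the corresponding combination of these elements.\<close>
  define y where "y = (\<Sum>u\<in>U. pscale (\<theta> (one u)) u)"
  have \<theta>0: "\<theta> 0 = 0"
    by (rule linear_on_zero[OF vector_space_fun[OF vector_space_field] vector_space_field
        subspace_UNIV[OF vector_space_fun[OF vector_space_field]] \<theta>(1)])
  have \<theta>sum: "\<theta> (\<Sum>u\<in>V. fun_scale (*) (c u) (one u)) = (\<Sum>u\<in>V. c u * \<theta> (one u))" for V c
    using \<theta>(1) \<theta>0 by (induction V rule: infinite_finite_induct) (simp_all add: linear_on_def)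
  have ev_y: "hv h y = \<Phi> h" if h: "h \<in> Z" for h
  proof -
    have "\<delta> h v = (\<Sum>u\<in>U. fun_scale (*) (hv h u) (one u)) v" for v
    proof -
      have "(\<Sum>u\<in>W. fun_scale (*) (hv h u) (one u)) v = (\<Sum>u\<in>W. hv h u * one u v)" for W
        by (induction W rule: infinite_finite_induct) (simp_all add: fun_scale_def)
      then show ?thesis using U(1) by (simp add: \<delta>_def one_def if_distrib[of "(*) _"] cong: if_cong)
    qed
    then have "\<delta> h = (\<Sum>u\<in>U. fun_scale (*) (hv h u) (one u))" by blast
    then have "\<Phi> h = (\<Sum>u\<in>U. hv h u * \<theta> (one u))" using \<theta>(2)[OF h] \<theta>sum by simp
    then show ?thesis by (simp add: y_def hv_sum hv_lin mult.commute)
  qed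
  interpret P: vector_space "pscale :: 'k \<Rightarrow> ('i \<Rightarrow>\<^sub>0 'k) \<Rightarrow> _" by (rule vector_space_pscale)
  have y: "y \<in> cyc UNIV d z"
    unfolding y_def using U(2) by (intro P.subspace_sum P.subspace_scale subspace_cyc) auto
  have lin_\<chi>: "linear_on (homs d z) hom_scale (*) (\<lambda>h. \<Phi> h - hv h y)"
    using lin_\<Phi> by (auto simp: linear_on_def hv_hom_lin algebra_simps)
  \<comment> \<open>The difference of \<Phi> and evaluation at \<open>y\<close> vanishes on the
    kernel \<open>Z\<close> of the dual differential, so it factors through that differential. The
    factor is the bounding element in \<nu>.\<close>
  have "\<Phi> h - hv h y = 0" if "h \<in> homs d z" "?d h = 0" for h using ev_y that by (simp add: Z_def)
  then have "\<exists>\<tau>. linear_on UNIV hom_scale (*) \<tau> \<and> (\<forall>h\<in>homs d z. \<tau> (?d h) = \<Phi> h - hv h y)"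
    by (intro factor_through[OF vector_space_hom_scale vector_space_hom_scale vector_space_field
      pers_moduleD(1)[OF pers_homs] lin_d lin_\<chi>])
  then obtain \<tau> where \<tau>: "linear_on UNIV hom_scale (*) \<tau>" "\<And>h. h \<in> homs d z \<Longrightarrow> \<tau> (?d h) = \<Phi> h - hv h y" by blast
  define \<Phi>' where "\<Phi>' h = (if h \<in> homs (d + 1) z then \<tau> h else 0)" for h
  have "\<Phi>' \<in> space (nu s (obj F (d + 1))) (eps + z)"
    unfolding nu_space using \<tau>(1) homs_closed by (auto simp: \<Phi>'_def linear_on_def)
  moreover have "\<Phi> - ev d z y = nu_map s (obj F (d + 1)) (obj F d) (diff F (d + 1)) (eps + z) \<Phi>'"
    using \<tau>(2) precomp_in' \<Phi>0 by (auto simp: fun_eq_iff nu_map_apply ev_def \<Phi>'_def)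
  ultimately show ?thesis using y by blast
qed

end

subsection \<open>Transport along inclusions of ambient spaces\<close>

text \<open>\<open>r\<close> is only a set-theoretic left inverse, and its linearity on the range of
  \<open>i\<close> is derived in \<open>r_lin\<close>. This admits \<open>Abs_poly_mapping\<close>,
  which is unspecified on functions of infinite support.\<close>

locale ambient_inclusion =
  fixes s :: "'k::field \<Rightarrow> 'a \<Rightarrow> 'a::ab_group_add" and u :: "'k \<Rightarrow> 'u \<Rightarrow> 'u::ab_group_add"
    and i :: "'a \<Rightarrow> 'u" and r :: "'u \<Rightarrow> 'a"
  assumes s: "vector_space s" and u: "vector_space u" and lin: "linear_on UNIV s u i" and r [simp]: "r (i x) = x"
begin

lemma i_lin: "i (x + y) = i x + i y" "i (s c x) = u c (i x)" "i (x - y) = i x - i y" "i 0 = 0"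
  using lin linear_on_diff[OF s u subspace_UNIV[OF s] lin] linear_on_zero[OF s u subspace_UNIV[OF s] lin]
  by (simp_all add: linear_on_def)

lemma i_eq [simp]: "i x = i y \<longleftrightarrow> x = y"
  by (metis r)

lemma i_eq_0 [simp]: "i x = 0 \<longleftrightarrow> x = 0"
  using i_eq[of x 0] by (simp add: i_lin)

lemma r_lin:
  assumes "S \<subseteq> range i"
  shows "linear_on S u s r"
  unfolding linear_on_def
proof (intro conjI ballI allI)
  fix x y c assume "x \<in> S" "y \<in> S"
  then obtain a b where ab: "x = i a" "y = i b" using assms by blast
  show "r (x + y) = r x + r y" using r[of "a + b"] by (simp add: ab i_lin)
next
  fix x c assume "x \<in> S"
  then obtain a where a: "x = i a" using assms by blast
  show "r (u c x) = s c (r x)" using r[of "s c a"] by (simp add: a i_lin)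
qed

lemma linear_push:
  assumes "linear_on S s t f"
  shows "linear_on (i ` S) u t (\<lambda>x. f (r x))"
  by (rule linear_on_comp[OF r_lin assms]) auto

lemma pers_module_push:
  assumes M: "pers_module s M"
  shows "pers_module u (push_pmod i r M)"
  unfolding pers_module_def
proof (intro conjI allI impI ballI)
  note M = pers_moduleD[OF M]
  fix z
  show "module.subspace u (space (push_pmod i r M) z)"
    unfolding push_pmod_def pmod.simps
    by (rule subspace_linear_image[OF s u M(1) linear_on_subset[OF lin subset_UNIV]])
  fix w assume zw: "z \<le> w"
  have "linear_on (space M z) s u (\<lambda>x. i (trans M z w x))"
    by (rule linear_on_comp[OF M(2)[OF zw] lin]) simp
  from linear_push[OF this]
  show "linear_on (space (push_pmod i r M) z) u u (trans (push_pmod i r M) z w)"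
    by (simp add: push_pmod_def)
  show "trans (push_pmod i r M) z w ` space (push_pmod i r M) z \<subseteq> space (push_pmod i r M) w"
    using M(3)[OF zw] by (auto simp: push_pmod_def)
  fix v x assume "w \<le> v" "x \<in> space (push_pmod i r M) z"
  then show "trans (push_pmod i r M) w v (trans (push_pmod i r M) z w x) = trans (push_pmod i r M) z v x"
    using M(5)[OF zw] by (auto simp: push_pmod_def)
next
  fix z x assume "x \<in> space (push_pmod i r M) z"
  then show "trans (push_pmod i r M) z z x = x"
    using pers_moduleD(4)[OF M] by (auto simp: push_pmod_def)
qed

lemma pfd_push:
  assumes M: "pers_module s M" and fin: "pfd s M"
  shows "pfd u (push_pmod i r M)"
  unfolding pfd_def push_pmod_def pmod.simps
  using fin_dim_image[OF s u pers_moduleD(1)[OF M] linear_on_subset[OF lin subset_UNIV]] fin by (simp add: pfd_def)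

end

lemma pmod_hom_push:
  assumes I: "ambient_inclusion s u i r" and J: "ambient_inclusion t v j q" and f: "pmod_hom s t M N f"
  shows "pmod_hom u v (push_pmod i r M) (push_pmod j q N) (\<lambda>z x. j (f z (r x)))"
proof -
  interpret I: ambient_inclusion s u i r by fact
  interpret J: ambient_inclusion t v j q by fact
  note f = pmod_homD[OF f]
  show ?thesis unfolding pmod_hom_def
  proof (intro conjI allI impI ballI)
    fix z
    have "linear_on (space M z) s v (\<lambda>x. j (f z x))" by (rule linear_on_comp[OF f(1) J.lin]) simp
    from I.linear_push[OF this]
    show "linear_on (space (push_pmod i r M) z) u v (\<lambda>x. j (f z (r x)))" by (simp add: push_pmod_def)
    show "(\<lambda>x. j (f z (r x))) ` space (push_pmod i r M) z \<subseteq> space (push_pmod j q N) z"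
      using f(2) by (auto simp: push_pmod_def)
    fix w x assume "z \<le> w" "x \<in> space (push_pmod i r M) z"
    then show "j (f w (r (trans (push_pmod i r M) z w x))) = trans (push_pmod j q N) z w (j (f z (r x)))"
      using f(3) by (auto simp: push_pmod_def)
  qed
qed

lemma chain_map_push:
  assumes I: "ambient_inclusion s u i r" and J: "ambient_inclusion t v j q" and f: "chain_map s t C D f"
  shows "chain_map u v (push_cpx i r C) (push_cpx j q D) (\<lambda>d z x. j (f d z (r x)))"
proof -
  interpret I: ambient_inclusion s u i r by fact
  interpret J: ambient_inclusion t v j q by fact
  show ?thesis unfolding chain_map_def
  proof (intro conjI allI ballI)
    fix d
    show "pmod_hom u v (obj (push_cpx i r C) d) (obj (push_cpx j q D) d) (\<lambda>z x. j (f d z (r x)))"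
      unfolding push_cpx_def cpx.simps by (rule pmod_hom_push[OF I J chain_mapD(1)[OF f]])
    fix z x assume "x \<in> space (obj (push_cpx i r C) d) z"
    then show "j (f (d - 1) z (r (diff (push_cpx i r C) d z x))) = diff (push_cpx j q D) d z (j (f d z (r x)))"
      using chain_mapD(2)[OF f] by (auto simp: push_cpx_def push_pmod_def)
  qed
qed

context ambient_inclusion
begin

lemma complex_push:
  assumes C: "complex s C"
  shows "complex u (push_cpx i r C)"
  unfolding complex_def
proof (intro conjI allI ballI)
  fix d
  have A: "ambient_inclusion s u i r" by unfold_locales
  show "pers_module u (obj (push_cpx i r C) d)"
    using pers_module_push[OF complexD(1)[OF C]] by (simp add: push_cpx_def)
  show "pmod_hom u u (obj (push_cpx i r C) d) (obj (push_cpx i r C) (d - 1)) (diff (push_cpx i r C) d)"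
    using pmod_hom_push[OF A A complexD(2)[OF C, of d]] by (simp add: push_cpx_def)
  fix z x assume "x \<in> space (obj (push_cpx i r C) d) z"
  then show "diff (push_cpx i r C) (d - 1) z (diff (push_cpx i r C) d z x) = 0"
    using complexD(3)[OF C] by (auto simp: push_cpx_def push_pmod_def i_lin)
qed

lemma cycles_push: "cycles (push_cpx i r C) d z = i ` cycles C d z"
  by (auto simp: cycles_def push_cpx_def push_pmod_def i_lin)

lemma boundaries_push: "boundaries (push_cpx i r C) d z = i ` boundaries C d z"
  by (force simp: boundaries_def push_cpx_def push_pmod_def image_iff)

end

lemma inclusion_left: "vector_space s \<Longrightarrow> vector_space t \<Longrightarrow> ambient_inclusion s (prod_scale s t) (\<lambda>x. (x, 0)) fst"
  by (intro ambient_inclusion.intro vector_space_prod)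
    (auto simp: linear_on_def prod_scale_def vector_space_def module_def
      module.scale_zero_right module_iff_vector_space[symmetric])

lemma inclusion_right: "vector_space s \<Longrightarrow> vector_space t \<Longrightarrow> ambient_inclusion t (prod_scale s t) (\<lambda>y. (0, y)) snd"
  by (intro ambient_inclusion.intro vector_space_prod)
    (auto simp: linear_on_def prod_scale_def module.scale_zero_right module_iff_vector_space[symmetric])

subsection \<open>Homotopic maps agree in the derived category\<close>

definition prod_cpx :: "('n::finite, 'a) cpx \<Rightarrow> ('n, 'b) cpx \<Rightarrow> ('n, 'a \<times> 'b) cpx" where
  "prod_cpx C A = \<lparr>
     obj = (\<lambda>d. \<lparr> space = (\<lambda>z. space (obj C d) z \<times> space (obj A d) z),
                  trans = (\<lambda>z w p. (trans (obj C d) z w (fst p), trans (obj A d) z w (snd p))) \<rparr>),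
     diff = (\<lambda>d z p. (diff C d z (fst p), diff A d z (snd p))) \<rparr>"

abbreviation "in_left \<equiv> push_cpx (\<lambda>x. (x, 0)) fst"
abbreviation "in_right \<equiv> push_cpx (\<lambda>y. (0, y)) snd"

lemma linear_on_prod:
  "linear_on S s s' f \<Longrightarrow> linear_on T t t' g \<Longrightarrow>
    linear_on (S \<times> T) (prod_scale s t) (prod_scale s' t') (\<lambda>p. (f (fst p), g (snd p)))"
  by (auto simp: linear_on_def prod_scale_def)

lemma subspace_prod:
  assumes "vector_space s" "vector_space t" "module.subspace s S" "module.subspace t T"
  shows "module.subspace (prod_scale s t) (S \<times> T)"
  using assms(3,4) unfolding subspace_iff[OF assms(1)] subspace_iff[OF assms(2)]
    subspace_iff[OF vector_space_prod[OF assms(1,2)]]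
  by (auto simp: prod_scale_def zero_prod_def)

lemma complex_prod:
  assumes s: "vector_space s" and t: "vector_space t" and C: "complex s C" and A: "complex t A"
  shows "complex (prod_scale s t) (prod_cpx C A)"
  unfolding complex_def
proof (intro conjI allI ballI)
  fix d
  note pC = pers_moduleD[OF complexD(1)[OF C]] and pA = pers_moduleD[OF complexD(1)[OF A]]
  show "pers_module (prod_scale s t) (obj (prod_cpx C A) d)"
    unfolding pers_module_def prod_cpx_def
    using subspace_prod[OF s t pC(1) pA(1)] linear_on_prod[OF pC(2) pA(2)] pC(3-) pA(3-)
    by (auto simp: image_subset_iff)
  show "pmod_hom (prod_scale s t) (prod_scale s t) (obj (prod_cpx C A) d) (obj (prod_cpx C A) (d - 1)) (diff (prod_cpx C A) d)"
    unfolding pmod_hom_def prod_cpx_def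
    using linear_on_prod[OF pmod_homD(1)[OF complexD(2)[OF C]] pmod_homD(1)[OF complexD(2)[OF A]]]
      pmod_homD(2,3)[OF complexD(2)[OF C]] pmod_homD(2,3)[OF complexD(2)[OF A]]
    by (auto simp: image_subset_iff)
  fix z p assume "p \<in> space (obj (prod_cpx C A) d) z"
  then show "diff (prod_cpx C A) (d - 1) z (diff (prod_cpx C A) d z p) = 0"
    using complexD(3)[OF C] complexD(3)[OF A] by (auto simp: prod_cpx_def zero_prod_def)
qed

lemma pfd_prod:
  assumes s: "vector_space s" and t: "vector_space t" and C: "complex s C" and A: "complex t A"
    and "pfd s (obj C d)" "pfd t (obj A d)"
  shows "pfd (prod_scale s t) (obj (prod_cpx C A) d)"
  unfolding pfd_def
proof
  fix z
  interpret L: ambient_inclusion s "prod_scale s t" "\<lambda>x. (x, 0)" fst by (rule inclusion_left[OF s t])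
  interpret R: ambient_inclusion t "prod_scale s t" "\<lambda>y. (0, y)" snd by (rule inclusion_right[OF s t])
  note 0 = pers_module_closed(1)[OF s complexD(1)[OF C]] pers_module_closed(1)[OF t complexD(1)[OF A]]
  have "fin_dim (prod_scale s t) ((\<lambda>x. (x, 0)) ` space (obj C d) z)"
    using L.pfd_push[OF complexD(1)[OF C] assms(5)] by (simp add: pfd_def push_pmod_def)
  moreover have "fin_dim (prod_scale s t) ((\<lambda>y. (0, y)) ` space (obj A d) z)"
    using R.pfd_push[OF complexD(1)[OF A] assms(6)] by (simp add: pfd_def push_pmod_def)
  ultimately show "fin_dim (prod_scale s t) (space (obj (prod_cpx C A) d) z)"
    by (rule fin_dim_add[OF L.u]) (auto simp: prod_cpx_def 0)
qed

section \<open>Calculus of paths in the derived category\<close>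

lemma derived_eq_appendI:
  assumes "derived_eq s \<C> X Y p p'" "derived_eq s \<C> Y Z q q'" "pq = p @ q" "pq' = p' @ q'"
  shows "derived_eq s \<C> X Z pq pq'"
  using derived_eq.append[OF assms(1,2)] assms(3,4) by simp

lemma chain_map_comp:
  assumes f: "chain_map s t C D f" and g: "chain_map t u D E g"
  shows "chain_map s u C E (\<lambda>d z x. g d z (f d z x))"
  unfolding chain_map_def
  using pmod_hom_comp[OF chain_mapD(1)[OF f] chain_mapD(1)[OF g]] chain_mapD(2)[OF f] chain_mapD(2)[OF g]
    pmod_homD(2)[OF chain_mapD(1)[OF f]] by simp

lemma derived_eq_Fwd:
  assumes "complex_in s \<C> X" "complex_in s \<C> Y" "complex_in s \<C> Z" "chain_map s s X Y f" "chain_map s s Y Z g"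
    "chain_map s s X Z h" "\<And>d z x. x \<in> space (obj X d) z \<Longrightarrow> g d z (f d z x) = h d z x"
  shows "derived_eq s \<C> X Z [Fwd X Y f, Fwd Y Z g] [Fwd X Z h]"
proof (rule derived_eq.trans[OF derived_eq.comp[OF assms(1-5)]])
  have "chain_map s s X Z (\<lambda>d z x. g d z (f d z x))" by (rule chain_map_comp[OF assms(4,5)])
  then show "derived_eq s \<C> X Z [Fwd X Z (\<lambda>d z x. g d z (f d z x))] [Fwd X Z h]"
    using assms by (intro derived_eq.ext) auto
qed

text \<open>In a localisation a section of a quasi-isomorphism equals its formal inverse: insert
  \<open>p\<close> followed by its inverse after \<open>i\<close> and cancel \<open>i\<close>
  against \<open>p\<close>. Consequently any two sections of \<open>p\<close> agree.\<close>

lemma derived_eq_section: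
  assumes X: "complex_in s \<C> X" and P: "complex_in s \<C> P" and i: "chain_map s s X P i" and p: "quasi_iso s s P X p"
    and pi: "\<And>d z x. x \<in> space (obj X d) z \<Longrightarrow> p d z (i d z x) = x"
  shows "derived_eq s \<C> X P [Fwd X P i] [Inv P X p]"
proof -
  have pc: "chain_map s s P X p" using p by (simp add: quasi_iso_def)
  have id: "chain_map s s X X (\<lambda>d z x. x)"
    by (auto simp: chain_map_def pmod_hom_def linear_on_def)
  have pathI: "derived_path s \<C> X [Inv P X p] P" by (intro derived_path.intros X P p)
  have pathF: "derived_path s \<C> X [Fwd X P i] P" by (intro derived_path.intros X P i)
  have "derived_eq s \<C> X P [Fwd X P i] [Fwd X P i, Fwd P X p, Inv P X p]"
    by (rule derived_eq_appendI[OF derived_eq.refl[OF pathF] derived_eq.sym[OF derived_eq.inv_right[OF P X p]]]) simp_all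
  also have "derived_eq s \<C> X P [Fwd X P i, Fwd P X p, Inv P X p] [Fwd X X (\<lambda>d z x. x), Inv P X p]"
    by (rule derived_eq_appendI[OF derived_eq_Fwd[OF X P X i pc id pi] derived_eq.refl[OF pathI]]) simp_all
  also (derived_eq.trans) have "derived_eq s \<C> X P [Fwd X X (\<lambda>d z x. x), Inv P X p] [Inv P X p]"
    by (rule derived_eq_appendI[OF derived_eq.ident[OF X] derived_eq.refl[OF pathI]]) simp_all
  finally (derived_eq.trans) show ?thesis .
qed

text \<open>If \<open>\<alpha> - \<beta>\<close> factors through an acyclic complex \<open>A\<close>, then \<open>\<alpha>\<close> and \<open>\<beta>\<close> are the composites of one
  map on \<open>C \<oplus> A\<close> with two sections of the quasi-isomorphism \<open>C \<oplus> A \<rightarrow> C\<close>.\<close>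

lemma derived_eq_via_acyclic:
  fixes C :: "('n::finite, 'a::ab_group_add) cpx" and A Y :: "('n, 'b::ab_group_add) cpx"
  assumes s: "vector_space s" and t: "vector_space t"
    and C: "complex s C" and A: "complex t A" and Y: "complex t Y"
    and acyclic: "\<And>d z. cycles A d z \<subseteq> boundaries A d z"
    and \<iota>: "chain_map s t C A \<iota>" and \<gamma>: "chain_map t t A Y \<gamma>"
    and \<alpha>: "chain_map s t C Y \<alpha>" and \<beta>: "chain_map s t C Y \<beta>"
    and fac: "\<And>d z x. x \<in> space (obj C d) z \<Longrightarrow> \<alpha> d z x = \<beta> d z x + \<gamma> d z (\<iota> d z x)"
    and \<C>: "\<And>d. \<C> (obj (in_left C) d)" "\<And>d. \<C> (obj (prod_cpx C A) d)" "\<And>d. \<C> (obj (in_right Y) d)"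
  shows "derived_eq (prod_scale s t) \<C> (in_left C) (in_right Y)
    [Fwd (in_left C) (in_right Y) (\<lambda>d z u. (0, \<alpha> d z (fst u)))]
    [Fwd (in_left C) (in_right Y) (\<lambda>d z u. (0, \<beta> d z (fst u)))]"
proof -
  let ?p = "prod_scale s t" and ?L = "in_left C :: ('n, 'a \<times> 'b) cpx" and ?R = "in_right Y :: ('n, 'a \<times> 'b) cpx"
    and ?P = "prod_cpx C A"
  note il = inclusion_left[OF s t] and ir = inclusion_right[OF s t]
  interpret L: ambient_inclusion s ?p "\<lambda>x. (x, 0)" fst by (rule il)
  interpret R: ambient_inclusion t ?p "\<lambda>y. (0, y)" snd by (rule ir)
  have cL: "complex ?p ?L" by (rule L.complex_push[OF C])
  have cR: "complex ?p ?R" by (rule R.complex_push[OF Y])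
  have cP: "complex ?p ?P" by (rule complex_prod[OF s t C A])
  have inL: "complex_in ?p \<C> ?L" and inR: "complex_in ?p \<C> ?R" and inP: "complex_in ?p \<C> ?P"
    using cL cR cP \<C> by (auto simp: complex_in_def)
  have cA: "chain_map ?p ?p ?L ?R (\<lambda>d z u. (0, \<alpha> d z (fst u)))" by (rule chain_map_push[OF il ir \<alpha>])
  have cB: "chain_map ?p ?p ?L ?R (\<lambda>d z u. (0, \<beta> d z (fst u)))" by (rule chain_map_push[OF il ir \<beta>])
  note C0 = pers_module_closed(1)[OF s complexD(1)[OF C]] and A0 = pers_module_closed(1)[OF t complexD(1)[OF A]]
  have cpx0: "trans (obj A d) z w 0 = 0" if "z \<le> w" for d z w
    by (rule linear_on_zero[OF t t pers_moduleD(1,2)[OF complexD(1)[OF A]]]) (rule that)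
  have diff0: "diff A d z 0 = 0" for d z
    by (rule linear_on_zero[OF t t pers_moduleD(1)[OF complexD(1)[OF A]] pmod_homD(1)[OF complexD(2)[OF A]]])
  have sect: "chain_map ?p ?p ?L ?P (\<lambda>d z u. (fst u, f d z (fst u)))" if f: "chain_map s t C A f" for f
    unfolding chain_map_def pmod_hom_def
    using pmod_homD[OF chain_mapD(1)[OF f]] chain_mapD(2)[OF f]
    by (auto simp: push_cpx_def push_pmod_def prod_cpx_def linear_on_def prod_scale_def)
  have zero: "chain_map s t C A (\<lambda>d z x. 0)"
    unfolding chain_map_def pmod_hom_def using A0 cpx0 diff0 L.i_lin(2)
    by (auto simp: linear_on_def prod_scale_def)
  have proj: "chain_map ?p ?p ?P ?L (\<lambda>d z u. (fst u, 0))"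
    unfolding chain_map_def pmod_hom_def
    using L.i_lin(2) by (auto simp: push_cpx_def push_pmod_def prod_cpx_def linear_on_def prod_scale_def)
  have qp: "quasi_iso ?p ?p ?P ?L (\<lambda>d z u. (fst u, 0))"
  proof (rule quasi_isoI[OF L.u L.u cP cL proj])
    fix d z x assume x: "x \<in> cycles ?P d z" and b: "(fst x, 0) \<in> boundaries ?L d z"
    have "snd x \<in> cycles A d z" using x by (auto simp: cycles_def prod_cpx_def zero_prod_def)
    then obtain a where a: "a \<in> space (obj A (d + 1)) z" "snd x = diff A (d + 1) z a"
      using subsetD[OF acyclic] unfolding boundaries_def by blast
    have "fst x \<in> boundaries C d z" using b by (auto simp: L.boundaries_push)
    then obtain c where c: "c \<in> space (obj C (d + 1)) z" "fst x = diff C (d + 1) z c"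
      by (auto simp: boundaries_def)
    show "x \<in> boundaries ?P d z"
      unfolding boundaries_def prod_cpx_def by (rule image_eqI[of _ _ "(c, a)"]) (auto simp: a c prod_eq_iff)
  next
    fix d z y assume y: "y \<in> cycles ?L d z"
    then obtain x where x: "x \<in> cycles C d z" "y = (x, 0)" by (auto simp: L.cycles_push)
    have "(x, 0) \<in> cycles ?P d z" using x A0 diff0 by (auto simp: cycles_def prod_cpx_def zero_prod_def)
    moreover have "0 \<in> boundaries ?L d z"
      unfolding L.boundaries_push using pers_module_closed(1)[OF s complexD(1)[OF C]]
        linear_on_zero[OF s s pers_moduleD(1)[OF complexD(1)[OF C]] pmod_homD(1)[OF complexD(2)[OF C]]]
      by (force simp: boundaries_def zero_prod_def image_iff)
    ultimately show "\<exists>v\<in>cycles ?P d z. y - (fst v, 0) \<in> boundaries ?L d z"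
      using x(2) by (intro bexI[of _ "(x, 0)"]) (auto simp: zero_prod_def)
  qed
  \<comment> \<open>Restricts to \<alpha> along the section with second component \<iota>, by
    \<open>fac\<close>, and to \<beta> along the section with second component 0.\<close>
  have g: "chain_map ?p ?p ?P ?R (\<lambda>d z u. (0, \<beta> d z (fst u) + \<gamma> d z (snd u)))"
  proof -
    have add: "diff Y d z (a + b) = diff Y d z a + diff Y d z b"
      if "a \<in> space (obj Y d) z" "b \<in> space (obj Y d) z" for d z a b
      using linear_onD(1)[OF pmod_homD(1)[OF complexD(2)[OF Y]] that] .
    have tadd: "trans (obj Y d) z w (a + b) = trans (obj Y d) z w a + trans (obj Y d) z w b"
      if "z \<le> w" "a \<in> space (obj Y d) z" "b \<in> space (obj Y d) z" for d z w a b
      using linear_onD(1)[OF pers_moduleD(2)[OF complexD(1)[OF Y] that(1)] that(2,3)] .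
    note bb = pmod_homD[OF chain_mapD(1)[OF \<beta>]] and gg = pmod_homD[OF chain_mapD(1)[OF \<gamma>]]
    interpret T: vector_space t by (rule t)
    interpret S: vector_space s by (rule s)
    show ?thesis
      unfolding chain_map_def pmod_hom_def
      using linear_onD[OF bb(1)] linear_onD[OF gg(1)] bb(2,3) gg(2,3) add tadd chain_mapD(2)[OF \<beta>] chain_mapD(2)[OF \<gamma>]
        pers_module_closed(2)[OF t complexD(1)[OF Y]]
      by (auto simp: push_cpx_def push_pmod_def prod_cpx_def linear_on_def prod_scale_def image_subset_iff
          T.scale_right_distrib)
  qed
  have "derived_eq ?p \<C> ?L ?P [Fwd ?L ?P (\<lambda>d z u. (fst u, f d z (fst u)))] [Inv ?P ?L (\<lambda>d z u. (fst u, 0))]"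
    if "chain_map s t C A f" for f
    by (rule derived_eq_section[OF inL inP sect[OF that] qp]) (auto simp: push_cpx_def push_pmod_def)
  from this[OF \<iota>] derived_eq.sym[OF this[OF zero]]
  have sec: "derived_eq ?p \<C> ?L ?P [Fwd ?L ?P (\<lambda>d z u. (fst u, \<iota> d z (fst u)))] [Fwd ?L ?P (\<lambda>d z u. (fst u, 0))]"
    by (rule derived_eq.trans)
  let ?g = "Fwd ?P ?R (\<lambda>d z u. (0, \<beta> d z (fst u) + \<gamma> d z (snd u)))"
  have path: "derived_path ?p \<C> ?P [?g] ?R" by (intro derived_path.intros inP inR g)
  have g0: "\<gamma> d z 0 = 0" for d z
    by (rule linear_on_zero[OF t t pers_moduleD(1)[OF complexD(1)[OF A]] pmod_homD(1)[OF chain_mapD(1)[OF \<gamma>]]])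
  have "derived_eq ?p \<C> ?L ?R [Fwd ?L ?P (\<lambda>d z u. (fst u, \<iota> d z (fst u))), ?g]
      [Fwd ?L ?R (\<lambda>d z u. (0, \<alpha> d z (fst u)))]"
    by (rule derived_eq_Fwd[OF inL inP inR sect[OF \<iota>] g cA]) (auto simp: push_cpx_def push_pmod_def fac)
  from derived_eq.sym[OF this]
  have 1: "derived_eq ?p \<C> ?L ?R [Fwd ?L ?R (\<lambda>d z u. (0, \<alpha> d z (fst u)))]
      [Fwd ?L ?P (\<lambda>d z u. (fst u, \<iota> d z (fst u))), ?g]" .
  have 2: "derived_eq ?p \<C> ?L ?R [Fwd ?L ?P (\<lambda>d z u. (fst u, \<iota> d z (fst u))), ?g] [Fwd ?L ?P (\<lambda>d z u. (fst u, 0)), ?g]"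
    by (rule derived_eq_appendI[OF sec derived_eq.refl[OF path]]) simp_all
  have 3: "derived_eq ?p \<C> ?L ?R [Fwd ?L ?P (\<lambda>d z u. (fst u, 0)), ?g] [Fwd ?L ?R (\<lambda>d z u. (0, \<beta> d z (fst u)))]"
    by (rule derived_eq_Fwd[OF inL inP inR sect[OF zero] g cB]) (auto simp: push_cpx_def push_pmod_def g0)
  show ?thesis by (rule derived_eq.trans[OF 1 derived_eq.trans[OF 2 3]])
qed

lemma derived_iso_quasi_iso:
  assumes "complex_in s \<C> X" "complex_in s \<C> Y" "quasi_iso s s X Y f"
  shows "derived_iso s \<C> X Y [Fwd X Y f]"
  unfolding derived_iso_def
proof (intro conjI exI[of _ "[Inv X Y f]"])
  have "chain_map s s X Y f" using assms(3) by (simp add: quasi_iso_def)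
  then show "derived_path s \<C> X [Fwd X Y f] Y" by (intro derived_path.intros assms)
  show "derived_path s \<C> Y [Inv X Y f] X" by (intro derived_path.intros assms)
qed (simp_all add: derived_eq.inv_right derived_eq.inv_left assms)

subsection \<open>The complex \<open>\<nu>F[n]\<langle>\<epsilon>\<rangle>\<close>\<close>

lemma serre_obj: "obj (serre_cpx s F) d = pmod_shift eps (nu s (obj F (int CARD('n) + d)))"
  for F :: "('n::finite, 'v::ab_group_add) cpx"
  by (simp add: serre_cpx_def cpx_shift_def cpx_translate_def nu_cpx_def)

lemma serre_diff: "diff (serre_cpx s F) d z x =
    sg CARD('n) (nu_map s (obj F (int CARD('n) + d)) (obj F (int CARD('n) + d - 1)) (diff F (int CARD('n) + d)) (eps + z) x)"
  for F :: "('n::finite, 'v::ab_group_add) cpx"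
  by (simp add: serre_cpx_def cpx_shift_def cpx_translate_def nu_cpx_def sg_def)

lemma serre_map: "serre_map s F G f d z =
    nu_map s (obj F (int CARD('n) + d)) (obj G (int CARD('n) + d)) (f (int CARD('n) + d)) (eps + z)"
  for F :: "('n::finite, 'v::ab_group_add) cpx"
  by (simp add: serre_map_def)

lemma pmod_hom_shift: "pmod_hom s t M N f \<Longrightarrow> pmod_hom s t (pmod_shift e M) (pmod_shift e N) (\<lambda>z. f (e + z))"
  by (simp add: pmod_hom_def pmod_shift_def)

lemma pmod_hom_sg:
  assumes t: "vector_space t" and N: "pers_module t N" and f: "pmod_hom s t M N f"
  shows "pmod_hom s t M N (\<lambda>z x. sg n (f z x))"
proof -
  interpret vector_space t by fact
  note f = pmod_homD[OF f] and N' = pers_moduleD[OF N]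
  have neg: "- x \<in> space N z" if "x \<in> space N z" for x z by (rule subspace_neg[OF N'(1) that])
  have tneg: "trans N z w (- x) = - trans N z w x" if "z \<le> w" "x \<in> space N z" for z w x
    by (rule linear_on_uminus[OF t t N'(2)[OF that(1)] that(2)])
  show ?thesis
    unfolding pmod_hom_def using linear_onD[OF f(1)] f(2,3) neg tneg
    by (cases "even n") (auto simp: sg_def linear_on_def)
qed

lemma nu_map_sg: "nu_map s M M' f z (sg n \<phi>) = sg n (nu_map s M M' f z \<phi>)"
  by (auto simp: nu_map_apply sg_def fun_eq_iff)

lemma nu_map_add: "nu_map s M M' f z (\<phi> + \<psi>) = nu_map s M M' f z \<phi> + nu_map s M M' f z \<psi>"
  by (auto simp: nu_map_apply fun_eq_iff)

lemma nu_map_nu_map_zero: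
  assumes s: "vector_space s" and M: "pers_module s M" "pers_module s M'" "pers_module s M''"
    and f: "pmod_hom s s M M' f" and g: "pmod_hom s s M' M'' g"
    and 0: "\<And>z x. x \<in> space M z \<Longrightarrow> g z (f z x) = 0" and \<phi>: "\<phi> \<in> space (nu s M) z"
  shows "nu_map s M' M'' g z (nu_map s M M' f z \<phi>) = 0"
proof -
  have "nu_map s M' M'' g z (nu_map s M M' f z \<phi>) = nu_map s M M'' (\<lambda>w x. g w (f w x)) z \<phi>"
    by (rule nu_map_comp[OF s M(1,2) f g])
  also have "nu_map s M M'' (\<lambda>w x. g w (f w x)) = nu_map s M M'' (\<lambda>w x. 0)"
    by (rule nu_map_cong) (rule 0)
  also have "nu_map s M M'' (\<lambda>w x. 0) z \<phi> = 0" by (rule nu_map_zero[OF s M(3,1) \<phi>])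
  finally show ?thesis .
qed

lemma complex_serre:
  fixes F :: "('n::finite, 'v::ab_group_add) cpx"
  assumes s: "vector_space s" and F: "complex s F"
  shows "complex nu_scale (serre_cpx s F)"
  unfolding complex_def
proof (intro conjI allI ballI)
  fix d
  let ?e = "int CARD('n) + d"
  note pF = complexD(1)[OF F]
  have e: "int CARD('n) + (d - 1) = ?e - 1" by simp
  show "pers_module nu_scale (obj (serre_cpx s F) d)"
    unfolding serre_obj by (intro pers_module_shift pers_module_nu s pF)
  show "pmod_hom nu_scale nu_scale (obj (serre_cpx s F) d) (obj (serre_cpx s F) (d - 1)) (diff (serre_cpx s F) d)"
    unfolding serre_obj e serre_diff[abs_def]
    by (intro pmod_hom_sg[OF vector_space_nu_scale] pers_module_shift pers_module_nu s pF
      pmod_hom_shift[OF pmod_hom_nu_map[OF s pF pF complexD(2)[OF F]]])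
  fix z \<phi> assume "\<phi> \<in> space (obj (serre_cpx s F) d) z"
  then have "\<phi> \<in> space (nu s (obj F ?e)) (eps + z)" by (simp add: serre_obj pmod_shift_def)
  from nu_map_nu_map_zero[OF s pF pF pF complexD(2)[OF F] complexD(2)[OF F] complexD(3)[OF F] this]
  show "diff (serre_cpx s F) (d - 1) z (diff (serre_cpx s F) d z \<phi>) = 0"
    unfolding serre_diff e nu_map_sg by simp
qed

lemma chain_map_serre:
  fixes F G :: "('n::finite, 'v::ab_group_add) cpx"
  assumes s: "vector_space s" and F: "complex s F" and G: "complex s G" and f: "chain_map s s F G f"
  shows "chain_map nu_scale nu_scale (serre_cpx s F) (serre_cpx s G) (serre_map s F G f)"
  unfolding chain_map_def
proof (intro conjI allI ballI)
  fix d
  let ?e = "int CARD('n) + d"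
  note pF = complexD(1)[OF F] and pG = complexD(1)[OF G]
  have e: "int CARD('n) + (d - 1) = ?e - 1" by simp
  show "pmod_hom nu_scale nu_scale (obj (serre_cpx s F) d) (obj (serre_cpx s G) d) (serre_map s F G f d)"
    unfolding serre_obj serre_map[abs_def]
    by (intro pmod_hom_shift pmod_hom_nu_map s pF pG chain_mapD(1)[OF f])
  fix z \<phi>
  have "nu_map s (obj F (?e - 1)) (obj G (?e - 1)) (f (?e - 1)) w (nu_map s (obj F ?e) (obj F (?e - 1)) (diff F ?e) w \<phi>) =
    nu_map s (obj G ?e) (obj G (?e - 1)) (diff G ?e) w (nu_map s (obj F ?e) (obj G ?e) (f ?e) w \<phi>)" for w
    unfolding nu_map_comp[OF s pF pF complexD(2)[OF F] chain_mapD(1)[OF f]]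
      nu_map_comp[OF s pF pG chain_mapD(1)[OF f] complexD(2)[OF G]]
    by (rule fun_cong[OF fun_cong[OF nu_map_cong[OF chain_mapD(2)[OF f]]]])
  then show "serre_map s F G f (d - 1) z (diff (serre_cpx s F) d z \<phi>) = diff (serre_cpx s G) d z (serre_map s F G f d z \<phi>)"
    unfolding serre_diff serre_map e by (simp add: nu_map_sg)
qed

subsection \<open>The quasi-isomorphism\<close>

text \<open>One order of the coordinates is fixed for all complexes, since
  \<open>hcomp_homotopy\<close> compares composites of contractions along the same list.\<close>

definition univ_list :: "'n::finite list" where
  "univ_list = (SOME xs. set xs = UNIV \<and> distinct xs)"

lemma univ_list [simp]: "set (univ_list :: 'n::finite list) = UNIV" "distinct (univ_list :: 'n list)"
  "length (univ_list :: 'n list) = CARD('n)"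
proof -
  have "\<exists>xs :: 'n list. set xs = UNIV \<and> distinct xs" by (rule finite_distinct_list) simp
  then have *: "set (univ_list :: 'n list) = UNIV \<and> distinct (univ_list :: 'n list)"
    unfolding univ_list_def by (rule someI_ex)
  then show "set (univ_list :: 'n list) = UNIV" "distinct (univ_list :: 'n list)" by auto
  then show "length (univ_list :: 'n list) = CARD('n)" using distinct_card by metis
qed

locale resolved = presentation s F X io
  for s :: "'k::field \<Rightarrow> 'v \<Rightarrow> 'v::ab_group_add" and F :: "('n::finite, 'v) cpx"
    and X :: "('i, 'n) index" and io :: "int \<Rightarrow> int ^ 'n \<Rightarrow> 'v \<Rightarrow> ('i \<Rightarrow>\<^sub>0 'k)" +
  fixes h :: "'n \<Rightarrow> ('i \<Rightarrow>\<^sub>0 'k) \<Rightarrow> ('i \<Rightarrow>\<^sub>0 'k)"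
  assumes contr: "contraction j (h j)" and fin: "pfd s (obj F d)"
begin

abbreviation H :: "('i \<Rightarrow>\<^sub>0 'k) \<Rightarrow> ('i \<Rightarrow>\<^sub>0 'k)" where
  "H \<equiv> hcomp h univ_list"

text \<open>\<open>H\<close> raises the degree by \<open>n\<close> and need respect none of the
  filtrations, so it ends in \<open>below X UNIV\<close>, the domain on which evaluation represents
  \<nu>.\<close>

definition phi :: "('n, 'v, ('n, 'k, 'v) nu_space) cmap" where
  "phi d z x = ev (int CARD('n) + d) z (H (io d z x))"

lemma H_below: "x \<in> coord_space (below X {} d z) \<Longrightarrow> H x \<in> coord_space (below X UNIV (int CARD('n) + d) z)"
  using filt_map_below[OF filt_hcomp[OF contr], of x "{}" d z univ_list] by (simp add: add.commute)

lemma H_io: "x \<in> space (obj F d) z \<Longrightarrow> H (io d z x) \<in> coord_space (below X UNIV (int CARD('n) + d) z)"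
  by (rule H_below[OF io_in])

lemma lin_H: "lin H"
  by (rule lin_hcomp[OF contr])

lemma serre_space: "\<phi> \<in> space (obj (serre_cpx s F) d) z \<longleftrightarrow> \<phi> \<in> space (nu s (obj F (int CARD('n) + d))) (eps + z)"
  by (simp add: serre_obj pmod_shift_def)

lemma serre_diff_ev:
  assumes "y \<in> coord_space (below X UNIV (int CARD('n) + d) z)"
  shows "diff (serre_cpx s F) d z (ev (int CARD('n) + d) z y) = sg CARD('n) (ev (int CARD('n) + d - 1) z (D y))"
  unfolding serre_diff ev_diff[OF assms] ..

lemma chain_map_phi: "chain_map s nu_scale F (serre_cpx s F) phi"
  unfolding chain_map_def
proof (intro conjI allI ballI)
  fix d
  show "pmod_hom s nu_scale (obj F d) (obj (serre_cpx s F) d) (phi d)"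
    unfolding pmod_hom_def
  proof (intro conjI allI impI ballI)
    fix z
    show "linear_on (space (obj F d) z) s nu_scale (phi d z)"
      unfolding phi_def[abs_def]
      by (rule linear_on_comp[OF linear_on_comp[OF io_lin lin_H] linear_ev]) auto
    show "phi d z ` space (obj F d) z \<subseteq> space (obj (serre_cpx s F) d) z"
      unfolding phi_def using ev_in by (auto simp: serre_space)
    fix w x assume "z \<le> w" "x \<in> space (obj F d) z"
    then show "phi d w (trans (obj F d) z w x) = trans (obj (serre_cpx s F) d) z w (phi d z x)"
      by (simp add: phi_def serre_obj pmod_shift_def ev_trans io_trans)
  qed
  fix z x assume x: "x \<in> space (obj F d) z"
  let ?c = "CARD('n)" and ?y = "io d z x"
  have "filt_null X X (set univ_list) (int (length (univ_list :: 'n list)) - 1)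
    (\<lambda>x. D (H x) - sg (length (univ_list :: 'n list)) (H (D x)))"
    by (rule D_hcomp[OF contr]) simp
  from filt_null_below[OF this io_in[OF x]]
  have "D (H ?y) - sg ?c (H (D ?y)) \<in> coord_space (below_smaller X UNIV (int CARD('n) + d - 1) z)"
    by (simp add: algebra_simps)
  then have "ev (int CARD('n) + d - 1) z (D (H ?y)) = ev (int CARD('n) + d - 1) z (sg ?c (H (D ?y)))"
    using ev_smaller ev_lin(4) by fastforce
  also have "\<dots> = sg ?c (ev (int CARD('n) + d - 1) z (H (D ?y)))" by (simp add: sg_def ev_lin)
  \<comment> \<open>The sign acquired by moving \<open>D\<close> past the \<open>n\<close>
    contractions cancels against the sign in the differential of the translated complex.\<close>
  finally have "diff (serre_cpx s F) d z (phi d z x) = ev (int CARD('n) + d - 1) z (H (D ?y))"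
    unfolding phi_def serre_diff_ev[OF H_io[OF x]] by simp
  then show "phi (d - 1) z (diff F d z x) = diff (serre_cpx s F) d z (phi d z x)"
    by (simp add: phi_def D_io[OF x] add_diff_eq)
qed

text \<open>With no coordinate inverted nothing but 0 is small, so \<open>cyc {}\<close> and
  \<open>bd {}\<close> are the images under \<open>io\<close> of the cycles and boundaries of
  \<open>F\<close> itself.\<close>

lemma smaller_empty: "below_smaller X {} d z = {}"
  by (simp add: below_smaller_def)

lemma coord_space_empty: "x \<in> coord_space {} \<longleftrightarrow> x = 0"
  by (auto simp: coord_space_iff intro: poly_mapping_eqI)

lemma cyc_empty: "x \<in> cyc {} d z \<longleftrightarrow> (\<exists>x'\<in>cycles F d z. x = io d z x')"
proof
  assume x: "x \<in> cyc {} d z"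
  then have "x \<in> coord_space (below X {} d z)" by (simp add: cyc_def)
  then obtain x' where "x' \<in> space (obj F d) z" "x = io d z x'" by (rule io_surj)
  with x show "\<exists>x'\<in>cycles F d z. x = io d z x'"
    by (auto simp: cyc_def io_cycles smaller_empty coord_space_empty)
qed (auto simp: cyc_def io_cycles io_in)

lemma ev_bd:
  assumes "b \<in> bd UNIV d z"
  shows "\<exists>\<Psi>\<in>space (nu s (obj F (d + 1))) (eps + z).
    nu_map s (obj F (d + 1)) (obj F d) (diff F (d + 1)) (eps + z) \<Psi> = ev d z b"
proof -
  obtain v where v: "v \<in> coord_space (below X UNIV (d + 1) z)" "b - D v \<in> coord_space (below_smaller X UNIV d z)"
    using assms by (auto simp: bd_def)
  have "ev d z (D v) = ev d z b" using ev_smaller[OF v(2)] by (simp add: ev_lin)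
  then show ?thesis using ev_diff[OF v(1)] by (intro bexI[OF _ ev_in[of "d + 1" z v]]) simp
qed

lemma serre_boundaries:
  assumes "\<Psi> \<in> space (nu s (obj F (int CARD('n) + d + 1))) (eps + z)"
  shows "nu_map s (obj F (int CARD('n) + d + 1)) (obj F (int CARD('n) + d)) (diff F (int CARD('n) + d + 1)) (eps + z) \<Psi> \<in> boundaries (serre_cpx s F) d z"
proof -
  have e: "int CARD('n) + (d + 1) = int CARD('n) + d + 1" by simp
  interpret V: vector_space "nu_scale :: 'k \<Rightarrow> ('n, 'k, 'v) nu_space \<Rightarrow> _" by (rule vector_space_nu_scale)
  have "sg CARD('n) \<Psi> \<in> space (nu s (obj F (int CARD('n) + d + 1))) (eps + z)"
    using assms V.subspace_neg[OF pers_moduleD(1)[OF pers_module_nu[OF vs complexD(1)[OF cF]]]] by (simp add: sg_def)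
  then show ?thesis
    unfolding boundaries_def by (intro image_eqI[of _ _ "sg CARD('n) \<Psi>"]) (simp_all add: serre_diff serre_space e nu_map_sg)
qed

text \<open>The boundary is pulled back along the factors of \<open>phi\<close> in reverse order:
  through the double dual by \<open>ev_inj\<close>, through the contractions by
  \<open>hcomp_inj\<close>, and through \<open>io\<close> because it is injective.\<close>

lemma phi_inj:
  assumes x: "x \<in> cycles F d z" and b: "phi d z x \<in> boundaries (serre_cpx s F) d z"
  shows "x \<in> boundaries F d z"
proof -
  let ?e = "int CARD('n) + d"
  have e: "int CARD('n) + (d + 1) = ?e + 1" by simp
  from b obtain \<Phi> where \<Phi>: "\<Phi> \<in> space (nu s (obj F (?e + 1))) (eps + z)" and
    eq: "phi d z x = sg CARD('n) (nu_map s (obj F (?e + 1)) (obj F ?e) (diff F (?e + 1)) (eps + z) \<Phi>)"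
    by (auto simp: boundaries_def serre_diff serre_space e)
  interpret V: vector_space "nu_scale :: 'k \<Rightarrow> ('n, 'k, 'v) nu_space \<Rightarrow> _" by (rule vector_space_nu_scale)
  have \<Phi>': "sg CARD('n) \<Phi> \<in> space (nu s (obj F (?e + 1))) (eps + z)"
    using \<Phi> V.subspace_neg[OF pers_moduleD(1)[OF pers_module_nu[OF vs complexD(1)[OF cF]]]] by (simp add: sg_def)
  have c: "io d z x \<in> cyc {} d z" using x by (auto simp: cyc_empty)
  have "H (io d z x) \<in> cyc UNIV ?e z"
    using hcomp_cyc[OF contr _ _ c, of univ_list] by (simp add: add.commute)
  then have "H (io d z x) \<in> bd UNIV ?e z"
    by (rule ev_inj[OF _ \<Phi>']) (use eq in \<open>simp add: nu_map_sg phi_def\<close>)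
  then have "io d z x \<in> bd {} d z"
    using hcomp_inj[OF contr _ _ c, of univ_list] by (simp add: add.commute)
  then obtain y where y: "y \<in> coord_space (below X {} (d + 1) z)" "io d z x = D y"
    by (auto simp: bd_def smaller_empty coord_space_empty)
  from y(1) obtain y' where y': "y' \<in> space (obj F (d + 1)) z" "y = io (d + 1) z y'" by (rule io_surj)
  have "x \<in> space (obj F d) z" using x by (simp add: cycles_def)
  moreover have "diff F (d + 1) z y' \<in> space (obj F d) z"
    using pmod_homD(2)[OF complexD(2)[OF cF] y'(1)] by simp
  ultimately have "x = diff F (d + 1) z y'"
    using io_inj y(2) D_io[OF y'(1)] y'(2) by simp
  then show "x \<in> boundaries F d z" using y'(1) by (auto simp: boundaries_def)
qed

text \<open>Surjectivity of evaluation needs a finite set spanning the homology of the last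
  subquotient. The cycles of \<open>F\<close> in grade \<open>z\<close> are finite dimensional, and
  the contractions carry a spanning set of them to such a set \<open>U\<close>, being surjective on
  homology.\<close>

lemma phi_surj:
  assumes "\<Phi> \<in> cycles (serre_cpx s F) d z"
  shows "\<exists>x\<in>cycles F d z. \<Phi> - phi d z x \<in> boundaries (serre_cpx s F) d z"
proof -
  let ?e = "int CARD('n) + d"
  from assms have \<Phi>: "\<Phi> \<in> space (nu s (obj F ?e)) (eps + z)"
    and 0: "nu_map s (obj F ?e) (obj F (?e - 1)) (diff F ?e) (eps + z) \<Phi> = 0"
    by (auto simp: cycles_def serre_space serre_diff sg_def split: if_splits)
  interpret S: vector_space s by (rule vs)
  have sub: "module.subspace s (cycles F d z)"
    using subspace_iff[OF vs] F_sub[of d z] linear_onD[OF pmod_homD(1)[OF complexD(2)[OF cF, of d], of z]]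
      linear_on_zero[OF vs vs F_sub pmod_homD(1)[OF complexD(2)[OF cF, of d], of z]]
    by (auto simp: cycles_def)
  have "fin_dim s (cycles F d z)"
    by (rule fin_dim_subset[OF vs sub F_sub]) (use fin in \<open>auto simp: cycles_def pfd_def\<close>)
  then obtain B where B: "finite B" "B \<subseteq> cycles F d z" "cycles F d z \<subseteq> S.span B" by (auto simp: fin_dim_def)
  define U where "U = (\<lambda>x. H (io d z x)) ` B"
  have Hcyc: "H x \<in> cyc UNIV ?e z" if "x \<in> cyc {} d z" for x
    using hcomp_cyc[OF contr _ _ that, of univ_list] by (simp add: add.commute)
  have Hsurj: "\<exists>x\<in>cycles F d z. y - H (io d z x) \<in> bd UNIV ?e z" if "y \<in> cyc UNIV ?e z" for y
    using hcomp_surj[OF contr, of univ_list "{}" y d z] that by (auto simp: cyc_empty add.commute)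
  have "\<exists>y\<in>cyc UNIV ?e z. \<exists>\<Phi>'\<in>space (nu s (obj F (?e + 1))) (eps + z).
    \<Phi> - ev ?e z y = nu_map s (obj F (?e + 1)) (obj F ?e) (diff F (?e + 1)) (eps + z) \<Phi>'"
  proof (rule ev_surj[OF _ _ _ \<Phi> 0])
    show "finite U" using B(1) by (simp add: U_def)
    show "U \<subseteq> cyc UNIV ?e z" using B(2) Hcyc cyc_empty by (auto simp: U_def)
    fix \<psi> :: "('i \<Rightarrow>\<^sub>0 'k) \<Rightarrow> 'k" and y
    assume \<psi>: "linear_on UNIV pscale (*) \<psi>" and \<psi>U: "\<And>u. u \<in> U \<Longrightarrow> \<psi> u = 0"
      and \<psi>b: "\<And>b. b \<in> bd UNIV ?e z \<Longrightarrow> \<psi> b = 0" and y: "y \<in> cyc UNIV ?e z"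
    obtain x where x: "x \<in> cycles F d z" "y - H (io d z x) \<in> bd UNIV ?e z" using Hsurj[OF y] by blast
    have lin: "linear_on (cycles F d z) s (*) (\<lambda>x. \<psi> (H (io d z x)))"
      by (rule linear_on_comp[OF linear_on_comp[OF linear_on_subset[OF io_lin] lin_H] \<psi>]) (auto simp: cycles_def)
    have "module.subspace s {x \<in> cycles F d z. \<psi> (H (io d z x)) = 0}"
      using sub linear_onD[OF lin] linear_on_zero[OF vs vector_space_field sub lin]
      unfolding subspace_iff[OF vs] by auto
    moreover have "B \<subseteq> {x \<in> cycles F d z. \<psi> (H (io d z x)) = 0}" using B(2) \<psi>U by (auto simp: U_def)
    ultimately have "\<psi> (H (io d z x)) = 0" using S.span_minimal B(3) x(1) by blast
    moreover have "\<psi> y = \<psi> (y - H (io d z x)) + \<psi> (H (io d z x))"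
      using linear_onD(1)[OF \<psi>, of "y - H (io d z x)" "H (io d z x)"] by simp
    ultimately show "\<psi> y = 0" using \<psi>b[OF x(2)] by simp
  qed
  then obtain y \<Phi>' where y: "y \<in> cyc UNIV ?e z" and \<Phi>': "\<Phi>' \<in> space (nu s (obj F (?e + 1))) (eps + z)"
    "\<Phi> - ev ?e z y = nu_map s (obj F (?e + 1)) (obj F ?e) (diff F (?e + 1)) (eps + z) \<Phi>'" by blast
  obtain x where x: "x \<in> cycles F d z" "y - H (io d z x) \<in> bd UNIV ?e z" using Hsurj[OF y] by blast
  obtain \<Psi> where \<Psi>: "\<Psi> \<in> space (nu s (obj F (?e + 1))) (eps + z)"
    "nu_map s (obj F (?e + 1)) (obj F ?e) (diff F (?e + 1)) (eps + z) \<Psi> = ev ?e z (y - H (io d z x))"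
    using ev_bd[OF x(2)] by blast
  have "\<Phi> - phi d z x = (\<Phi> - ev ?e z y) + ev ?e z (y - H (io d z x))" by (simp add: phi_def ev_lin)
  also have "\<dots> = nu_map s (obj F (?e + 1)) (obj F ?e) (diff F (?e + 1)) (eps + z) (\<Phi>' + \<Psi>)"
    by (simp only: \<Phi>'(2) \<Psi>(2) nu_map_add)
  also have "\<dots> \<in> boundaries (serre_cpx s F) d z"
    by (rule serre_boundaries[OF pers_module_closed(2)[OF vector_space_nu_scale
      pers_module_nu[OF vs complexD(1)[OF cF]] \<Phi>'(1) \<Psi>(1)]])
  finally show "\<exists>x\<in>cycles F d z. \<Phi> - phi d z x \<in> boundaries (serre_cpx s F) d z" using x(1) by blast
qed

end

subsection \<open>Naturality\<close>

text \<open>The cone of the identity of \<open>F\<close>, with the differential of \<open>F\<close> removed by a change of basis.\<close>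

definition disc :: "('i, 'n::finite) index \<Rightarrow> ('n, 'i \<Rightarrow>\<^sub>0 'k::field) cpx" where
  "disc X = \<lparr> obj = (\<lambda>d. \<lparr> space = (\<lambda>z. coord_space (below X {} d z \<union> below X {} (d - 1) z)),
                           trans = (\<lambda>z w x. x) \<rparr>),
              diff = (\<lambda>d z. restrict_to {i. gdeg X i = d - 1}) \<rparr>"

lemma complex_disc: "complex pscale (disc X :: ('n::finite, 'i \<Rightarrow>\<^sub>0 'k::field) cpx)"
  unfolding complex_def pers_module_def pmod_hom_def disc_def
  by (auto simp: subspace_coord_space linear_restrict_to coord_space_iff below_def intro!: poly_mapping_eqI)
    (auto simp: linear_on_def less_eq_vec_def intro: order_trans)

text \<open>A cycle in degree \<open>d\<close> has no component on generators of degree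
  \<open>d - 1\<close>. What remains has degree \<open>d\<close> and is its own preimage: in degree
  \<open>d + 1\<close> of \<open>disc X\<close> this is the summand that the differential
  retains.\<close>

lemma disc_acyclic: "cycles (disc X) d z \<subseteq> boundaries (disc X) d z"
proof
  fix x assume x: "x \<in> cycles (disc X) d z"
  have 0: "restrict_to {i. gdeg X i = d - 1} x = 0" using x by (simp add: cycles_def disc_def)
  have 1: "lookup x i = 0" if "gdeg X i = d - 1" for i
  proof -
    have "lookup (restrict_to {i. gdeg X i = d - 1} x) i = 0" unfolding 0 by simp
    then show ?thesis using that by simp
  qed
  have "lookup x i = 0" if "i \<notin> below X {} d z" for i
    using 1 x that by (cases "gdeg X i = d - 1") (auto simp: cycles_def disc_def coord_space_iff below_def)
  then have "x = restrict_to {i. gdeg X i = d} x" "x \<in> coord_space (below X {} (d + 1) z \<union> below X {} d z)"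
    by (auto simp: coord_space_iff below_def intro!: poly_mapping_eqI)
  then show "x \<in> boundaries (disc X) d z"
    unfolding boundaries_def by (intro image_eqI[of _ _ x]) (simp_all add: disc_def)
qed

lemma (in presentation) pfd_disc:
  assumes "\<And>d. pfd s (obj F d)"
  shows "pfd pscale (obj (disc X :: ('n, 'i \<Rightarrow>\<^sub>0 'k) cpx) d)"
  unfolding pfd_def
proof
  fix z
  have f: "fin_dim pscale (coord_space (below X {} e z) :: ('i \<Rightarrow>\<^sub>0 'k) set)" for e
    using fin_dim_image[OF vs vector_space_pscale F_sub io_lin, of e z] assms
    by (simp add: pfd_def bij_betw_imp_surj_on[OF io_bij])
  show "fin_dim pscale (space (obj (disc X :: ('n, 'i \<Rightarrow>\<^sub>0 'k) cpx) d) z)"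
  proof (rule fin_dim_add[OF vector_space_pscale f[of d] f[of "d - 1"]])
    fix x assume "x \<in> space (obj (disc X :: ('n, 'i \<Rightarrow>\<^sub>0 'k) cpx) d) z"
    then have "x \<in> coord_space (below X {} d z \<union> below X {} (d - 1) z)" by (simp add: disc_def)
    then show "\<exists>a\<in>coord_space (below X {} d z). \<exists>b\<in>coord_space (below X {} (d - 1) z). x = a + b"
      by (elim coord_space_Un) blast
  qed (auto simp: disc_def intro: coord_space_mono)
qed

text \<open>For indices of type \<open>int ^ 'n \<Rightarrow> 'v \<Rightarrow> 'k\<close> the
  functions from indices to the field form precisely the ambient type of \<nu>. Through
  \<open>lookup\<close>, \<open>disc X\<close> moves there, and its product with \<open>F\<close>
  lies in the common ambient type.\<close>

lemma inclusion_lookup: "ambient_inclusion pscale (fun_scale (*)) (lookup :: ('i \<Rightarrow>\<^sub>0 'k::field) \<Rightarrow> _) Abs_poly_mapping"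
  by (rule ambient_inclusion.intro)
    (auto simp: vector_space_pscale vector_space_fun vector_space_field linear_on_def fun_scale_def fun_eq_iff
      lookup_add lookup_inverse)

lemma inclusion_id: "vector_space s \<Longrightarrow> ambient_inclusion s s (\<lambda>x. x) (\<lambda>x. x)"
  by (simp add: ambient_inclusion_def linear_on_def)

lemma push_id: "push_cpx (\<lambda>x. x) (\<lambda>x. x) C = C"
  by (intro cpx.equality HOL.ext pmod.equality) (simp_all add: push_cpx_def push_pmod_def)

locale resolved_map = F: resolved s F X io h + G: resolved s G Y io' g
  for s :: "'k::field \<Rightarrow> 'v \<Rightarrow> 'v::ab_group_add" and F G :: "('n::finite, 'v) cpx"
    and X Y :: "('i, 'n) index" and io io' h g +
  fixes f :: "('n, 'v, 'v) cmap"
  assumes f: "chain_map s s F G f"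
begin

sublocale presentation_pair s F G X Y io io' 0 f
  by unfold_locales (simp add: chain_mapD(1)[OF f])

lemma T_io: "x \<in> space (obj F d) z \<Longrightarrow> T (io d z x) = io' d z (f d z x)"
  using induced_io[of x d z] by simp

lemma T_D:
  assumes "i \<in> gens X"
  shows "G.D (T (basis i)) = T (F.D (basis i))"
proof -
  note g = F.gen[OF assms]
  let ?d = "gdeg X i" and ?z = "mdeg X i"
  have "G.D (T (basis i)) = G.D (io' ?d ?z (f ?d ?z (F.gen i)))" using T_io[OF g(1)] g(2) by simp
  also have "\<dots> = io' (?d - 1) ?z (f (?d - 1) ?z (diff F ?d ?z (F.gen i)))"
    using G.D_io[OF pmod_homD(2)[OF chain_mapD(1)[OF f] g(1)]] chain_mapD(2)[OF f g(1)] by simp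
  also have "\<dots> = T (io (?d - 1) ?z (diff F ?d ?z (F.gen i)))"
    by (rule T_io[OF pmod_homD(2)[OF complexD(2)[OF F.cF] g(1)], symmetric])
  finally show ?thesis using F.D_io[OF g(1)] g(2) by simp
qed

text \<open>\<open>hcomp_homotopy\<close> provides a homotopy up to null maps, and evaluation kills
  the latter. A homotopy is then restated as a factorisation of the difference through the acyclic
  complex \<open>disc X\<close>, the form that \<open>derived_eq_via_acyclic\<close>
  expects.\<close>

lemma homotopy:
  obtains \<gamma> where "chain_map pscale nu_scale (disc X) (serre_cpx s G) \<gamma>"
    "\<And>d z x. x \<in> space (obj F d) z \<Longrightarrow>
      G.phi d z (f d z x) = serre_map s F G f d z (F.phi d z x) + \<gamma> d z (io d z x + F.D (io d z x))"
proof -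
  let ?c = "CARD('n)" and ?n = "int CARD('n)"
  have "\<exists>K. filt_map X Y (set univ_list) (int (length (univ_list :: 'n list)) + 1) K \<and>
    filt_null X Y (set univ_list) (int (length (univ_list :: 'n list)))
      (\<lambda>x. G.H (T x) - T (F.H x) - (G.D (K x) + sg (length (univ_list :: 'n list)) (K (F.D x))))"
    by (rule hcomp_homotopy[OF F.filtered_complex_axioms G.filtered_complex_axioms F.contr G.contr filt_induced T_D]) simp_all
  then obtain K where K: "filt_map X Y UNIV (?n + 1) K" and
    N: "filt_null X Y UNIV ?n (\<lambda>x. G.H (T x) - T (F.H x) - (G.D (K x) + sg ?c (K (F.D x))))" by auto
  have lK: "lin K" using K by (simp add: filt_map_def)
  have K_below: "K x \<in> coord_space (below Y UNIV (?n + d + 1) z)" if "x \<in> coord_space (below X {} d z)" for x d z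
    using filt_map_below[OF K that] by (simp add: algebra_simps)
  let ?r = "\<lambda>d. restrict_to {i. gdeg X i = d}"
  \<comment> \<open>An element of \<open>disc X\<close> is a pair of components of degrees
    \<open>d\<close> and \<open>d - 1\<close>. On the pair of \<open>x\<close> and
    \<open>D x\<close> the formula gives the homotopy term \<open>E K x\<close> plus the signed
    \<open>K D x\<close>; on a general pair it is the extension of this that commutes with the
    differentials.\<close>
  define \<gamma> where "\<gamma> d z v = G.ev (?n + d) z (G.D (K (?r d v)) + sg ?c (K (?r (d - 1) v)))" for d z v
  have r: "?r d v \<in> coord_space (below X {} d z)" "?r (d - 1) v \<in> coord_space (below X {} (d - 1) z)"
    if "v \<in> space (obj (disc X) d) z" for d z and v :: "'i \<Rightarrow>\<^sub>0 'k"
    using that by (auto simp: disc_def coord_space_iff below_def)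
  have lr: "lin (?r d)" for d by (rule linear_restrict_to)
  have lin\<gamma>: "lin (\<lambda>v. G.D (K (?r d v)) + sg ?c (K (?r (d - 1) v)))" for d
    by (intro lin_plus lin_sg' lin_comp[OF lin_comp[OF lr lK] G.lin_D] lin_comp[OF lr lK])
  have "chain_map pscale nu_scale (disc X) (serre_cpx s G) \<gamma>"
    unfolding chain_map_def
  proof (intro conjI allI ballI)
    fix d
    show "pmod_hom pscale nu_scale (obj (disc X) d) (obj (serre_cpx s G) d) (\<gamma> d)"
      unfolding pmod_hom_def
    proof (intro conjI allI impI ballI)
      fix z
      show "linear_on (space (obj (disc X) d) z) pscale nu_scale (\<gamma> d z)"
        unfolding \<gamma>_def[abs_def]
        by (rule linear_on_comp[OF linear_on_subset[OF lin\<gamma> subset_UNIV] G.linear_ev]) auto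
      show "\<gamma> d z ` space (obj (disc X) d) z \<subseteq> space (obj (serre_cpx s G) d) z"
        using G.ev_in by (auto simp: \<gamma>_def G.serre_space)
      fix w v assume "z \<le> w"
      then show "\<gamma> d w (trans (obj (disc X) d) z w v) = trans (obj (serre_cpx s G) d) z w (\<gamma> d z v)"
        by (simp add: \<gamma>_def disc_def serre_obj pmod_shift_def G.ev_trans)
    qed
    fix z and v :: "'i \<Rightarrow>\<^sub>0 'k" assume v: "v \<in> space (obj (disc X) d) z"
    have 1: "?r (d - 1) (?r (d - 1) v) = ?r (d - 1) v" "?r (d - 1 - 1) (?r (d - 1) v) = 0"
      by (auto intro!: poly_mapping_eqI)
    have "\<gamma> (d - 1) z (diff (disc X) d z v) = G.ev (?n + d - 1) z (G.D (K (?r (d - 1) v)))"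
      unfolding \<gamma>_def disc_def cpx.simps 1 by (simp add: lin_zero[OF lK] add_diff_eq)
    moreover have "diff (serre_cpx s G) d z (\<gamma> d z v) = G.ev (?n + d - 1) z (G.D (K (?r (d - 1) v)))"
    proof -
      have a: "G.D (K (?r d v)) \<in> coord_space (below Y UNIV (?n + d) z)"
        using G.D_below[OF K_below[OF r(1)[OF v]]] by simp
      have b: "K (?r (d - 1) v) \<in> coord_space (below Y UNIV (?n + d) z)" using K_below[OF r(2)[OF v]] by simp
      have "G.D (G.D (K (?r d v))) = 0" by (rule G.D_D[OF G.below_in_gens[OF K_below[OF r(1)[OF v]]]])
      then show ?thesis
        unfolding \<gamma>_def using a b
        by (subst G.serre_diff_ev) (auto simp: coord_space_add coord_space_diff lin_simps[OF G.lin_D] sg_def G.ev_lin)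
    qed
    ultimately show "\<gamma> (d - 1) z (diff (disc X) d z v) = diff (serre_cpx s G) d z (\<gamma> d z v)" by simp
  qed
  moreover have "G.phi d z (f d z x) = serre_map s F G f d z (F.phi d z x) + \<gamma> d z (io d z x + F.D (io d z x))"
    if x: "x \<in> space (obj F d) z" for d z x
  proof -
    let ?y = "io d z x"
    have y: "?y \<in> coord_space (below X {} d z)" by (rule F.io_in[OF x])
    have Dy: "F.D ?y \<in> coord_space (below X {} (d - 1) z)" by (rule F.D_below[OF y])
    have y0: "lookup ?y i = 0" if "gdeg X i \<noteq> d" for i using y that by (simp add: coord_space_iff below_def)
    have Dy0: "lookup (F.D ?y) i = 0" if "gdeg X i \<noteq> d - 1" for i using Dy that by (simp add: coord_space_iff below_def)
    have r: "?r d (?y + F.D ?y) = ?y" "?r (d - 1) (?y + F.D ?y) = F.D ?y"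
      by (rule poly_mapping_eqI, simp add: lookup_add y0 Dy0)+
    have "G.H (T ?y) - T (F.H ?y) - (G.D (K ?y) + sg ?c (K (F.D ?y))) \<in> coord_space (below_smaller Y UNIV (?n + d) z)"
      using filt_null_below[OF N y] by (simp add: add.commute)
    from G.ev_smaller[OF this]
    have "G.ev (?n + d) z (G.H (T ?y)) = G.ev (?n + d) z (T (F.H ?y)) + G.ev (?n + d) z (G.D (K ?y) + sg ?c (K (F.D ?y)))"
      by (simp only: G.ev_lin(1,4) diff_diff_eq right_minus_eq)
    moreover have "serre_map s F G f d z (F.phi d z x) = G.ev (?n + d) z (T (F.H ?y))"
      using ev_map[OF F.H_io[OF x]] by (simp add: serre_map F.phi_def)
    ultimately show ?thesis unfolding \<gamma>_def r G.phi_def T_io[OF x, symmetric] by simp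
  qed
  ultimately show thesis by (rule that)
qed

end

lemma resolved_exists:
  fixes F :: "('n::finite, 'v::ab_group_add) cpx" and s :: "'k::field \<Rightarrow> 'v \<Rightarrow> 'v"
  assumes s: "vector_space s" and F: "free_complex_finite_homology s F"
  shows "\<exists>X :: (int ^ 'n \<Rightarrow> 'v \<Rightarrow> 'k, 'n) index. \<exists>io h. resolved s F X io h"
proof -
  \<comment> \<open>The index becomes the indicator function of one point. The pairs of degree and
    grade are countable, so such a pair is coded by one integer, used as a constant vector; the
    element of \<open>'v\<close>, whose type may be uncountable, occupies the second argument. This
    places the indices in the type required for \<open>inclusion_lookup\<close>.\<close>
  define enc :: "int \<times> ((int ^ 'n) \<times> 'v) \<Rightarrow> int ^ 'n \<Rightarrow> 'v \<Rightarrow> 'k" where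
    "enc = (\<lambda>(d, z, v) z' v'. if z' = (\<chi> l. int (to_nat (d, z))) \<and> v' = v then 1 else 0)"
  have "inj enc"
  proof (rule injI)
    fix p q assume eq: "enc p = enc q"
    obtain d z v d' z' v' where pq: "p = (d, z, v)" "q = (d', z', v')" by (cases p; cases q) auto
    have "enc q (\<chi> l. int (to_nat (d, z))) v = 1" unfolding eq[symmetric] by (simp add: pq enc_def)
    then have "(\<chi> l. int (to_nat (d, z))) = ((\<chi> l. int (to_nat (d', z'))) :: int ^ 'n)" "v = v'"
      unfolding pq enc_def by (simp_all only: prod.case split: if_splits) simp_all
    then have "to_nat (d, z) = to_nat (d', z')" "v = v'" by (simp_all add: vec_eq_iff)
    then show "p = q" using inj_to_nat by (auto simp: pq dest: injD)
  qed
  moreover have cF: "complex s F" and free: "\<And>d. free_module s (obj F d)" and fin: "\<And>d. pfd s (obj F d)"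
    using F by (auto simp: free_complex_finite_homology_def)
  ultimately obtain X :: "(int ^ 'n \<Rightarrow> 'v \<Rightarrow> 'k, 'n) index" and io where P: "presentation s F X io"
    using free_presentation[OF s] by blast
  interpret presentation s F X io by (rule P)
  have "\<exists>h. contraction j h" for j
    by (rule contraction_exists) (rule localisation_acyclic[OF F])
  then obtain h where "\<And>j. contraction j (h j)" by metis
  then have "resolved s F X io h" by unfold_locales (auto simp: fin)
  then show ?thesis by blast
qed

text \<open>The inclusion of \<open>F\<close> into the cone of its identity, after the change of
  basis: \<open>x + D x\<close> stands for the pair of \<open>x\<close> and \<open>D x\<close>,
  whose components are told apart by \<open>gdeg\<close>.\<close>

lemma (in presentation) chain_map_disc:
  "chain_map s pscale F (disc X) (\<lambda>d z x. io d z x + D (io d z x))"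
  unfolding chain_map_def
proof (intro conjI allI ballI)
  fix d
  have in1: "io d z x \<in> coord_space (below X {} d z \<union> below X {} (d - 1) z)" if "x \<in> space (obj F d) z" for x z
    using io_in[OF that] by (rule coord_space_mono) simp
  have in2: "D (io d z x) \<in> coord_space (below X {} d z \<union> below X {} (d - 1) z)" if "x \<in> space (obj F d) z" for x z
    using D_below[OF io_in[OF that]] by (rule coord_space_mono) simp
  show "pmod_hom s pscale (obj F d) (obj (disc X) d) (\<lambda>z x. io d z x + D (io d z x))"
    unfolding pmod_hom_def
  proof (intro conjI allI impI ballI)
    fix z
    show "linear_on (space (obj F d) z) s pscale (\<lambda>x. io d z x + D (io d z x))"
      using linear_on_comp[OF io_lin lin_plus[OF lin_id lin_D]] by simp
    show "(\<lambda>x. io d z x + D (io d z x)) ` space (obj F d) z \<subseteq> space (obj (disc X) d) z"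
      using coord_space_add[OF in1 in2] by (auto simp: disc_def)
  qed (simp add: disc_def io_trans)
  fix z x assume x: "x \<in> space (obj F d) z"
  have "io d z x \<in> coord_space (below X {} d z)" "D (io d z x) \<in> coord_space (below X {} (d - 1) z)"
    by (rule io_in[OF x], rule D_below[OF io_in[OF x]])
  then have "restrict_to {i. gdeg X i = d - 1} (io d z x + D (io d z x)) = D (io d z x)"
    by (auto intro!: poly_mapping_eqI simp: lookup_add coord_space_iff below_def)
  moreover have "D (D (io d z x)) = 0" by (rule D_D[OF below_in_gens[OF io_in[OF x]]])
  ultimately show "io (d - 1) z (diff F d z x) + D (io (d - 1) z (diff F d z x)) =
      diff (disc X) d z (io d z x + D (io d z x))"
    by (simp add: disc_def D_io[OF x, symmetric])
qed

text \<open>Stated for an arbitrary class so that it yields both parts of the theorem. Besides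
  source and target, the only complexes on the paths used are products of \<open>F\<close> with a
  pointwise finite dimensional complex, which enter through the homotopies.\<close>

lemma naturally_quasi_isomorphic_serre:
  fixes s :: "'k::field \<Rightarrow> 'v::ab_group_add \<Rightarrow> 'v" and P :: "('n::finite, 'v) cpx \<Rightarrow> bool"
  assumes s: "vector_space s" and P: "\<And>F. P F \<Longrightarrow> free_complex_finite_homology s F"
    and \<C>: "\<And>F d. P F \<Longrightarrow> \<C> (obj (left_cpx F) d)" "\<And>F d. P F \<Longrightarrow> \<C> (obj (right_cpx (serre_cpx s F)) d)"
    "\<And>(F :: ('n, 'v) cpx) A d. P F \<Longrightarrow> complex nu_scale A \<Longrightarrow> (\<And>d. pfd nu_scale (obj A d)) \<Longrightarrow> \<C> (obj (prod_cpx F A) d)"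
  shows "naturally_quasi_isomorphic s \<C> P"
proof -
  \<comment> \<open>Presentation and contractions are chosen separately for each complex, with no
    compatibility along chain maps. The naturality squares therefore commute only up to the homotopy
    from \<open>homotopy\<close>.\<close>
  have "\<forall>F. \<exists>X :: (int ^ 'n \<Rightarrow> 'v \<Rightarrow> 'k, 'n) index. \<exists>io h. P F \<longrightarrow> resolved s F X io h"
    using resolved_exists[OF s P] by blast
  then obtain X :: "_ \<Rightarrow> (int ^ 'n \<Rightarrow> 'v \<Rightarrow> 'k, 'n) index" and io h where
    res: "\<And>F. P F \<Longrightarrow> resolved s F (X F) (io F) (h F)" by metis
  define ph where "ph F = resolved.phi s F (X F) (io F) (h F)" for F
  note il = inclusion_left[OF s vector_space_nu_scale] and ir = inclusion_right[OF s vector_space_nu_scale]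
  interpret L: ambient_inclusion s "common_scale s" "\<lambda>x. (x, 0 :: ('n, 'k, 'v) nu_space)" fst by (rule il)
  interpret R: ambient_inclusion nu_scale "common_scale s" "\<lambda>y :: ('n, 'k, 'v) nu_space. (0 :: 'v, y)" snd by (rule ir)
  let ?L = "left_cpx :: ('n, 'v) cpx \<Rightarrow> ('n, ('n, 'k, 'v) common) cpx"
  let ?R = "\<lambda>F :: ('n, 'v) cpx. right_cpx (serre_cpx s F) :: ('n, ('n, 'k, 'v) common) cpx"
  define \<eta> where "\<eta> F = [Fwd (?L F) (?R F) (\<lambda>d z u. (0, ph F d z (fst u)))]" for F
  have cF: "complex s F" if "P F" for F using P[OF that] by (simp add: free_complex_finite_homology_def)
  have inL: "complex_in (common_scale s) \<C> (?L F)" if "P F" for F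
    unfolding complex_in_def using L.complex_push[OF cF[OF that]] \<C>(1)[OF that] by (simp add: left_cpx_def)
  have inR: "complex_in (common_scale s) \<C> (?R F)" if "P F" for F
    unfolding complex_in_def using R.complex_push[OF complex_serre[OF s cF[OF that]]] \<C>(2)[OF that] by (simp add: right_cpx_def)
  have ch: "chain_map s nu_scale F (serre_cpx s F) (ph F)" if "P F" for F
    unfolding ph_def by (rule resolved.chain_map_phi[OF res[OF that]])
  have chp: "chain_map (common_scale s) (common_scale s) (?L F) (?R F) (\<lambda>d z u. (0, ph F d z (fst u)))" if "P F" for F
    using chain_map_push[OF il ir ch[OF that]] by (simp add: left_cpx_def right_cpx_def)
  have iso: "derived_iso (common_scale s) \<C> (?L F) (?R F) (\<eta> F)" if F: "P F" for F
    unfolding \<eta>_def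
  proof (rule derived_iso_quasi_iso[OF inL[OF F] inR[OF F]])
    have cL: "complex (common_scale s) (?L F)" and cR: "complex (common_scale s) (?R F)"
      using inL[OF F] inR[OF F] by (auto simp: complex_in_def)
    show "quasi_iso (common_scale s) (common_scale s) (?L F) (?R F) (\<lambda>d z u. (0, ph F d z (fst u)))"
    proof (rule quasi_isoI[OF L.u L.u cL cR chp[OF F]])
      fix d z x assume x: "x \<in> cycles (?L F) d z" and b: "(0, ph F d z (fst x)) \<in> boundaries (?R F) d z"
      obtain x' where x': "x' \<in> cycles F d z" "x = (x', 0)" using x by (auto simp: left_cpx_def L.cycles_push)
      have "ph F d z x' \<in> boundaries (serre_cpx s F) d z"
        using b by (auto simp: x'(2) right_cpx_def R.boundaries_push)
      then have "x' \<in> boundaries F d z"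
        using resolved.phi_inj[OF res[OF F] x'(1)] by (simp add: ph_def)
      then show "x \<in> boundaries (?L F) d z" by (simp add: left_cpx_def L.boundaries_push x'(2))
    next
      fix d z y assume "y \<in> cycles (?R F) d z"
      then obtain y' where y': "y' \<in> cycles (serre_cpx s F) d z" "y = (0, y')"
        by (auto simp: right_cpx_def R.cycles_push)
      obtain x where x: "x \<in> cycles F d z" "y' - ph F d z x \<in> boundaries (serre_cpx s F) d z"
        using resolved.phi_surj[OF res[OF F] y'(1)] by (auto simp: ph_def)
      then show "\<exists>v\<in>cycles (?L F) d z. y - (0, ph F d z (fst v)) \<in> boundaries (?R F) d z"
        by (intro bexI[of _ "(x, 0)"]) (auto simp: left_cpx_def right_cpx_def L.cycles_push R.boundaries_push y'(2))
    qed
  qed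
  have nat: "derived_eq (common_scale s) \<C> (?L F) (?R G)
      (\<eta> F @ [Fwd (?R F) (?R G) (right_cmap (serre_map s F G f))])
      ([Fwd (?L F) (?L G) (left_cmap f)] @ \<eta> G)"
    if F: "P F" and G: "P G" and f: "chain_map s s F G f" for F G f
  proof -
    interpret resolved_map s F G "X F" "X G" "io F" "io G" "h F" "h G" f
      unfolding resolved_map_def resolved_map_axioms_def using res[OF F] res[OF G] f by blast
    let ?\<alpha> = "\<lambda>d z x. ph G d z (f d z x)" and ?\<beta> = "\<lambda>d z x. serre_map s F G f d z (ph F d z x)"
    let ?A = "push_cpx lookup Abs_poly_mapping (disc (X F)) :: ('n, ('n, 'k, 'v) nu_space) cpx"
    let ?i = "\<lambda>d z x. io F d z x + F.D (io F d z x)"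
    interpret E: ambient_inclusion pscale nu_scale
      "lookup :: ((int ^ 'n \<Rightarrow> 'v \<Rightarrow> 'k) \<Rightarrow>\<^sub>0 'k) \<Rightarrow> _" Abs_poly_mapping
      by (rule inclusion_lookup)
    obtain \<gamma> where \<gamma>: "chain_map pscale nu_scale (disc (X F)) (serre_cpx s G) \<gamma>"
      and eq: "\<And>d z x. x \<in> space (obj F d) z \<Longrightarrow> ?\<alpha> d z x = ?\<beta> d z x + \<gamma> d z (?i d z x)"
      using homotopy unfolding ph_def by blast
    have S: "chain_map nu_scale nu_scale (serre_cpx s F) (serre_cpx s G) (serre_map s F G f)"
      by (rule chain_map_serre[OF s cF[OF F] cF[OF G] f])
    have \<alpha>: "chain_map s nu_scale F (serre_cpx s G) ?\<alpha>" by (rule chain_map_comp[OF f ch[OF G]])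
    have \<beta>: "chain_map s nu_scale F (serre_cpx s G) ?\<beta>" by (rule chain_map_comp[OF ch[OF F] S])
    have \<iota>: "chain_map s nu_scale F ?A (\<lambda>d z x. lookup (?i d z x))"
      using chain_map_push[OF inclusion_id[OF s] inclusion_lookup F.chain_map_disc] by (simp add: push_id)
    have \<gamma>': "chain_map nu_scale nu_scale ?A (serre_cpx s G) (\<lambda>d z u. \<gamma> d z (Abs_poly_mapping u))"
      using chain_map_push[OF inclusion_lookup inclusion_id[OF vector_space_nu_scale] \<gamma>] by (simp add: push_id)
    have pfdA: "pfd nu_scale (obj ?A d)" for d
      using E.pfd_push[OF complexD(1)[OF complex_disc] F.pfd_disc[OF F.fin]] by (simp add: push_cpx_def)
    have cA: "complex nu_scale ?A" by (rule E.complex_push[OF complex_disc])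
    have acyclic: "cycles ?A d z \<subseteq> boundaries ?A d z" for d z
      unfolding E.cycles_push E.boundaries_push by (rule image_mono[OF disc_acyclic])
    have "derived_eq (common_scale s) \<C> (in_left F) (in_right (serre_cpx s G))
      [Fwd (in_left F) (in_right (serre_cpx s G)) (\<lambda>d z u. (0, ?\<alpha> d z (fst u)))]
      [Fwd (in_left F) (in_right (serre_cpx s G)) (\<lambda>d z u. (0, ?\<beta> d z (fst u)))]"
    proof (rule derived_eq_via_acyclic[OF s vector_space_nu_scale cF[OF F] cA complex_serre[OF s cF[OF G]] acyclic \<iota> \<gamma>' \<alpha> \<beta>])
      show "\<C> (obj (in_left F) d)" for d using \<C>(1)[OF F] by (simp add: left_cpx_def)
      show "\<C> (obj (prod_cpx F ?A) d)" for d by (rule \<C>(3)[OF F cA pfdA])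
      show "\<C> (obj (in_right (serre_cpx s G)) d)" for d using \<C>(2)[OF G] by (simp add: right_cpx_def)
    qed (simp add: eq)
    then have hom: "derived_eq (common_scale s) \<C> (?L F) (?R G)
      [Fwd (?L F) (?R G) (\<lambda>d z u. (0, ?\<alpha> d z (fst u)))] [Fwd (?L F) (?R G) (\<lambda>d z u. (0, ?\<beta> d z (fst u)))]"
      by (simp add: left_cpx_def right_cpx_def)
    have c\<alpha>: "chain_map (common_scale s) (common_scale s) (?L F) (?R G) (\<lambda>d z u. (0, ?\<alpha> d z (fst u)))"
      using chain_map_push[OF il ir \<alpha>] by (simp add: left_cpx_def right_cpx_def)
    have c\<beta>: "chain_map (common_scale s) (common_scale s) (?L F) (?R G) (\<lambda>d z u. (0, ?\<beta> d z (fst u)))"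
      using chain_map_push[OF il ir \<beta>] by (simp add: left_cpx_def right_cpx_def)
    have cf: "chain_map (common_scale s) (common_scale s) (?L F) (?L G) (left_cmap f)"
      using chain_map_push[OF il il f] by (simp add: left_cpx_def left_cmap_def push_cmap_def)
    have cS: "chain_map (common_scale s) (common_scale s) (?R F) (?R G) (right_cmap (serre_map s F G f))"
      using chain_map_push[OF ir ir S] by (simp add: right_cpx_def right_cmap_def push_cmap_def)
    have 1: "derived_eq (common_scale s) \<C> (?L F) (?R G)
      [Fwd (?L F) (?L G) (left_cmap f), Fwd (?L G) (?R G) (\<lambda>d z u. (0, ph G d z (fst u)))]
      [Fwd (?L F) (?R G) (\<lambda>d z u. (0, ?\<alpha> d z (fst u)))]"
      by (rule derived_eq_Fwd[OF inL[OF F] inL[OF G] inR[OF G] cf chp[OF G] c\<alpha>]) (simp add: left_cmap_def push_cmap_def)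
    have 2: "derived_eq (common_scale s) \<C> (?L F) (?R G)
      [Fwd (?L F) (?R F) (\<lambda>d z u. (0, ph F d z (fst u))), Fwd (?R F) (?R G) (right_cmap (serre_map s F G f))]
      [Fwd (?L F) (?R G) (\<lambda>d z u. (0, ?\<beta> d z (fst u)))]"
      by (rule derived_eq_Fwd[OF inL[OF F] inR[OF F] inR[OF G] chp[OF F] cS c\<beta>]) (simp add: right_cmap_def push_cmap_def)
    show ?thesis
      using derived_eq.trans[OF 2 derived_eq.trans[OF derived_eq.sym[OF hom] derived_eq.sym[OF 1]]] by (simp add: \<eta>_def)
  qed
  show ?thesis unfolding naturally_quasi_isomorphic_def using iso nat by blast
qed

theorem theorem10:
  fixes s :: "'k::field \<Rightarrow> 'v::ab_group_add \<Rightarrow> 'v"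
  assumes "vector_space s"
  shows "naturally_quasi_isomorphic s (\<lambda>_. True)
           (\<lambda>F :: ('n::finite, 'v) cpx. free_complex_finite_homology s F)
       \<and> naturally_quasi_isomorphic s (pfd (common_scale s))
           (\<lambda>F :: ('n, 'v) cpx. free_complex_finite_homology s F \<and>
                                (\<forall>d. pfd nu_scale (nu s (obj F d))))"
proof
  show "naturally_quasi_isomorphic s (\<lambda>_. True) (\<lambda>F :: ('n::finite, 'v) cpx. free_complex_finite_homology s F)"
    by (rule naturally_quasi_isomorphic_serre[OF assms]) simp_all
  interpret L: ambient_inclusion s "common_scale s" "\<lambda>x. (x, 0 :: ('n, 'k, 'v) nu_space)" fst
    by (rule inclusion_left[OF assms vector_space_nu_scale])
  interpret R: ambient_inclusion nu_scale "common_scale s" "\<lambda>y :: ('n, 'k, 'v) nu_space. (0 :: 'v, y)" snd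
    by (rule inclusion_right[OF assms vector_space_nu_scale])
  show "naturally_quasi_isomorphic s (pfd (common_scale s))
      (\<lambda>F :: ('n, 'v) cpx. free_complex_finite_homology s F \<and> (\<forall>d. pfd nu_scale (nu s (obj F d))))"
  proof (rule naturally_quasi_isomorphic_serre[OF assms])
    fix F :: "('n, 'v) cpx" and d
    assume F: "free_complex_finite_homology s F \<and> (\<forall>d. pfd nu_scale (nu s (obj F d)))"
    then have cF: "complex s F" and fin: "\<And>d. pfd s (obj F d)" and fin': "\<And>d. pfd nu_scale (nu s (obj F d))"
      by (auto simp: free_complex_finite_homology_def)
    show "free_complex_finite_homology s F" using F ..
    show "pfd (common_scale s) (obj (left_cpx F) d)"
      using L.pfd_push[OF complexD(1)[OF cF] fin] by (simp add: left_cpx_def push_cpx_def)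
    have "pfd nu_scale (obj (serre_cpx s F) d)"
      using fin' unfolding serre_obj by (simp add: pfd_def pmod_shift_def)
    then show "pfd (common_scale s) (obj (right_cpx (serre_cpx s F)) d)"
      using R.pfd_push[OF complexD(1)[OF complex_serre[OF assms cF]]] by (simp add: right_cpx_def push_cpx_def)
    fix A :: "('n, ('n, 'k, 'v) nu_space) cpx"
    assume "complex nu_scale A" "\<And>d. pfd nu_scale (obj A d)"
    then show "pfd (common_scale s) (obj (prod_cpx F A) d)"
      using pfd_prod[OF assms vector_space_nu_scale cF] fin by blast
  qed
qed

end
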